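(* Let $f\in C^2(\mathbb R;\mathbb R)$ satisfy $f''\ge c$ on $\mathbb R$ for some constant $c>0$ and $f(0)=\min_{\mathbb R} f=0$, and let $T>0$. Let $w\in L^\infty(\mathbb R;\mathbb R)$ be such that $I^{CL}_T(w)\neq\emptyset$ and $w\in SBV_{loc}(\mathbb R;\mathbb R)$. Then, with respect to the $L^1_{loc}$ topology on $L^\infty(\mathbb R;\mathbb R)$, the set $I^{CL}_T(w)$ is: (T1) closed; (T2) with empty interior.
   Context: A map $u\in L^\infty([0,T]\times\mathbb R;\mathbb R)\cap C^0([0,T];L^1_{loc}(\mathbb R;\mathbb R))$ is a weak entropy solution to $\partial_t u+\partial_x f(u)=0$ if, for every $k\in\mathbb R$ and every nonnegative $\varphi\in C^1_c(]0,T[\times\mathbb R)$, $$\iint\bigl(|u-k|\,\partial_t\varphi+\operatorname{sgn}(u-k)\,(f(u)-f(k))\,\partial_x\varphi\bigr)\,dt\,dx\ge 0.$$ For $u_o\in L^\infty(\mathbb R;\mathbb R)$, $S^{CL}_t u_o$ denotes the value at time $t\in[0,T]$ of the unique weak entropy solution with $u(0,\cdot)=u_o$, and $$I^{CL}_T(w):=\{u_o\in L^\infty(\mathbb R;\mathbb R): S^{CL}_T u_o=w\}.$$ $SBV_{loc}(\mathbb R;\mathbb R)$ is the set of functions of locally bounded variation whose distributional derivative has no Cantor part. *)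

theory Defs
  imports "HOL-Analysis.Analysis"
begin

definition C2 :: "(real \<Rightarrow> real) \<Rightarrow> bool" where
  "C2 f \<longleftrightarrow> f differentiable_on UNIV \<and> deriv f differentiable_on UNIV
     \<and> continuous_on UNIV (deriv (deriv f))"

text \<open>The space \<open>C\<^sup>1\<^sub>c(\<Omega>)\<close> for open \<open>\<Omega>\<close>; its elements are extended by zero outside \<open>\<Omega>\<close>.\<close>

definition C1c :: "'a::euclidean_space set \<Rightarrow> ('a \<Rightarrow> real) set" where
  "C1c \<Omega> = {\<phi>. \<phi> differentiable_on UNIV
     \<and> (\<forall>h. continuous_on UNIV (\<lambda>z. frechet_derivative \<phi> (at z) h))
     \<and> compact (closure {z. \<phi> z \<noteq> 0}) \<and> closure {z. \<phi> z \<noteq> 0} \<subseteq> \<Omega>}"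

text \<open>Representatives are taken Borel measurable; every Lebesgue measurable function agrees
  almost everywhere with a Borel measurable one, so no class is lost.\<close>

definition Linf_on :: "'a::euclidean_space set \<Rightarrow> ('a \<Rightarrow> real) set" where
  "Linf_on \<Omega> = {u. u \<in> borel_measurable (restrict_space lborel \<Omega>)
     \<and> (\<exists>M. AE z\<in>\<Omega> in lborel. \<bar>u z\<bar> \<le> M)}"

definition Linf_eq :: "(real \<Rightarrow> real) \<Rightarrow> (real \<Rightarrow> real) \<Rightarrow> bool" where
  "Linf_eq u v \<longleftrightarrow> u \<in> Linf_on UNIV \<and> v \<in> Linf_on UNIV \<and> (AE x in lborel. u x = v x)"

text \<open>The type \<open>linf\<close> is \<open>L\<^sup>\<infinity>(\<real>;\<real>)\<close>, whose elements are classes modulo equality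
  almost everywhere.\<close>

quotient_type linf = "real \<Rightarrow> real" / partial: Linf_eq
proof (rule part_equivpI)
  have "Linf_eq (\<lambda>_. 0) (\<lambda>_. 0)"
    by (auto simp: Linf_eq_def Linf_on_def intro!: exI[of _ 0])
  then show "\<exists>u. Linf_eq u u" by blast
  show "symp Linf_eq"
    by (rule sympI) (auto simp: Linf_eq_def eq_commute)
  show "transp Linf_eq"
    by (rule transpI) (auto simp: Linf_eq_def elim: AE_mp)
qed

text \<open>The function \<open>rep_linf v\<close> is a representative of the class \<open>v\<close>. The notions below
  do not depend on its choice.\<close>

definition represents :: "(real \<Rightarrow> real) \<Rightarrow> linf \<Rightarrow> bool" where
  "represents g v \<longleftrightarrow> (AE x in lborel. g x = rep_linf v x)"

definition L1_dist :: "real set \<Rightarrow> linf \<Rightarrow> linf \<Rightarrow> real" where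
  "L1_dist K u v = (LINT x:K|lborel. \<bar>rep_linf u x - rep_linf v x\<bar>)"

definition L1loc_topology :: "linf topology" where
  "L1loc_topology = topology_generated_by
     {{v. L1_dist K u v < e} | K u e. compact K \<and> 0 < e}"

definition C0_L1loc :: "real set \<Rightarrow> (real \<times> real \<Rightarrow> real) \<Rightarrow> bool" where
  "C0_L1loc J u \<longleftrightarrow>
     (\<forall>t\<in>J. \<forall>K. compact K \<longrightarrow> set_integrable lborel K (\<lambda>x. u (t, x))) \<and>
     (\<forall>t\<in>J. \<forall>K. compact K \<longrightarrow>
        ((\<lambda>s. LINT x:K|lborel. \<bar>u (s, x) - u (t, x)\<bar>) \<longlongrightarrow> 0) (at t within J))"

text \<open>The first argument of \<open>u\<close> and \<open>\<phi>\<close> is time, so \<open>(1, 0)\<close> and \<open>(0, 1)\<close> are the directions of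
  \<open>\<partial>\<^sub>t\<close> and \<open>\<partial>\<^sub>x\<close>. A class in \<open>L\<^sup>\<infinity>([0,T] \<times> \<real>) \<inter> C\<^sup>0([0,T]; L\<^sup>1\<^sub>l\<^sub>o\<^sub>c(\<real>))\<close> is given by a jointly
  Borel measurable representative all of whose time slices are the right ones; the limes superior
  over \<open>n\<close> of the means of \<open>u(t, \<cdot>)\<close> on \<open>[x - 1/n, x + 1/n]\<close> is such a representative.\<close>

definition weak_entropy_solution ::
    "(real \<Rightarrow> real) \<Rightarrow> real \<Rightarrow> (real \<times> real \<Rightarrow> real) \<Rightarrow> bool" where
  "weak_entropy_solution f T u \<longleftrightarrow>
     u \<in> Linf_on ({0..T} \<times> UNIV) \<and> C0_L1loc {0..T} u \<and>
     (\<forall>k. \<forall>\<phi> \<in> C1c ({0<..<T} \<times> UNIV). (\<forall>z. 0 \<le> \<phi> z) \<longrightarrow>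
        0 \<le> (LINT z:{0<..<T} \<times> UNIV|lborel.
               \<bar>u z - k\<bar> * frechet_derivative \<phi> (at z) (1, 0)
               + sgn (u z - k) * (f (u z) - f k) * frechet_derivative \<phi> (at z) (0, 1)))"

definition S_CL :: "(real \<Rightarrow> real) \<Rightarrow> real \<Rightarrow> real \<Rightarrow> linf \<Rightarrow> linf" where
  "S_CL f T t uo = (THE v. \<exists>u. weak_entropy_solution f T u
     \<and> represents (\<lambda>x. u (0, x)) uo \<and> represents (\<lambda>x. u (t, x)) v)"

definition I_CL :: "(real \<Rightarrow> real) \<Rightarrow> real \<Rightarrow> linf \<Rightarrow> linf set" where
  "I_CL f T w = {uo. S_CL f T T uo = w}"

definition Radon_measure :: "real measure \<Rightarrow> bool" where
  "Radon_measure \<mu> \<longleftrightarrow> sets \<mu> = sets borel \<and> (\<forall>K. compact K \<longrightarrow> emeasure \<mu> K < \<infinity>)"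

definition mutually_singular :: "real measure \<Rightarrow> real measure \<Rightarrow> bool" where
  "mutually_singular \<mu> \<nu> \<longleftrightarrow> (\<exists>N \<in> sets borel. emeasure \<mu> N = 0 \<and> emeasure \<nu> (- N) = 0)"

text \<open>The distributional derivative of \<open>w\<close> is the signed Radon measure \<open>\<mu> - \<nu>\<close>, given by its
  Jordan decomposition; the pair \<open>(\<mu>, \<nu>)\<close> is determined by \<open>w\<close>.\<close>

definition has_measure_derivative :: "linf \<Rightarrow> real measure \<Rightarrow> real measure \<Rightarrow> bool" where
  "has_measure_derivative w \<mu> \<nu> \<longleftrightarrow>
     Radon_measure \<mu> \<and> Radon_measure \<nu> \<and> mutually_singular \<mu> \<nu> \<and>
     (\<forall>\<phi> \<in> C1c UNIV. (LINT x|lborel. rep_linf w x * deriv \<phi> x)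
        = - ((LINT x|\<mu>. \<phi> x) - (LINT x|\<nu>. \<phi> x)))"

definition Lebesgue_decomposition ::
    "real measure \<Rightarrow> real measure \<Rightarrow> real measure \<Rightarrow> bool" where
  "Lebesgue_decomposition \<mu> \<alpha> \<sigma> \<longleftrightarrow>
     sets \<alpha> = sets borel \<and> sets \<sigma> = sets borel \<and>
     absolutely_continuous lborel \<alpha> \<and> mutually_singular \<sigma> lborel \<and>
     (\<forall>B \<in> sets borel. emeasure \<mu> B = emeasure \<alpha> B + emeasure \<sigma> B)"

text \<open>The Cantor part of \<open>\<mu>\<close> is its singular part \<open>\<sigma>\<close> restricted to the complement of the
  (countable) set of atoms.\<close>

definition no_Cantor_part :: "real measure \<Rightarrow> bool" where
  "no_Cantor_part \<mu> \<longleftrightarrow>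
     (\<exists>\<alpha> \<sigma>. Lebesgue_decomposition \<mu> \<alpha> \<sigma> \<and> emeasure \<sigma> {x. emeasure \<sigma> {x} = 0} = 0)"

text \<open>Since elements of \<open>L\<^sup>\<infinity>(\<real>)\<close> are locally integrable, this is the intersection of
  \<open>SBV\<^sub>l\<^sub>o\<^sub>c(\<real>)\<close> with \<open>L\<^sup>\<infinity>(\<real>)\<close>. The Cantor parts of \<open>\<mu>\<close> and \<open>\<nu>\<close> are mutually singular, so that of
  \<open>\<mu> - \<nu>\<close> vanishes if and only if both do.\<close>

definition SBV_loc :: "linf set" where
  "SBV_loc = {w. \<exists>\<mu> \<nu>. has_measure_derivative w \<mu> \<nu> \<and> no_Cantor_part \<mu> \<and> no_Cantor_part \<nu>}"

end

theory Submission
  imports Defs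
begin

text \<open>The entropy solution with initial datum \<open>w\<close> is the spatial derivative of the Hopf-Lax
  function \<open>V(t, x) = min\<^sub>y U(y) + t L((x - y) / t)\<close>, where \<open>U\<close> is a primitive of \<open>w\<close> and \<open>L\<close> is the
  Legendre transform of \<open>f\<close>. The Hopf-Lax semigroup preserves the order of derivatives and fixes
  constants, so \<open>max(u, k)\<close> and \<open>min(u, k)\<close> are a sub- and a supersolution, which gives Kruzkov's
  inequalities. Uniqueness is Kruzkov's doubling of variables; since the Hopf-Lax solution is
  continuous at almost every point, the doubling limit is plain dominated convergence.

  Hence \<open>u\<^sub>o\<close> belongs to the set iff \<open>V(T, \<cdot>)\<close> is a primitive of \<open>w\<close>. For such data the minimisers lie
  within a distance of \<open>x\<close> that depends on \<open>w\<close> only, so \<open>V(T, x)\<close> is continuous in \<open>U\<close> for locally uniform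
  convergence: the set is closed. Adding mass \<open>1\<close> far away from the origin raises
  \<open>V(T, + \<infinity>) - V(T, - \<infinity>)\<close> by \<open>1\<close>, so no neighbourhood of a point is contained in the set.\<close>

section \<open>Flux and Legendre transform\<close>

text \<open>\<open>S_CL\<close> is a definite description, so nothing can be said about
  \<open>I_CL\<close> before existence and uniqueness hold for every bounded datum, with uniqueness
  among all entropy solutions. Having an explicit solution settles both: in the doubling argument
  only one of the two functions is shifted, and taking the explicit one means that no fine property
  of the unknown solution enters.

  Primitives make the topology manageable: the L1 distance on an interval bounds primitives
  uniformly there, and a minimum over a fixed compact set moves by no more than the minimised
  function. The obstacle is that a ball of \<open>L1_dist\<close> contains data of arbitrarily large
  sup norm, whereas the speed of propagation grows with the norm, so no compact set contains the
  minimisers of all data in the ball. One does for those data that reach \<open>w\<close>, since at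
  time \<open>T\<close> the speeds are \<open>deriv f\<close> of \<open>w\<close>; and only those
  have to be excluded when the complement is shown to be open.\<close>

locale convex_flux =
  fixes f :: "real \<Rightarrow> real" and c :: real
  assumes C2: "C2 f" and c_pos: "0 < c" and f2_ge: "\<And>x. c \<le> deriv (deriv f) x"
    and f_0: "f 0 = 0" and f_min: "\<And>x. f 0 \<le> f x"
begin

lemma f_deriv: "(f has_real_derivative deriv f x) (at x)"
  using C2 by (auto simp: C2_def differentiable_on_def DERIV_deriv_iff_real_differentiable)

lemma f1_deriv: "(deriv f has_real_derivative deriv (deriv f) x) (at x)"
  using C2 by (auto simp: C2_def differentiable_on_def DERIV_deriv_iff_real_differentiable)

lemma continuous_f: "continuous_on A f"
  using f_deriv by (meson DERIV_isCont continuous_at_imp_continuous_on)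

lemma continuous_f1: "continuous_on A (deriv f)"
  using f1_deriv by (meson DERIV_isCont continuous_at_imp_continuous_on)

lemma f_borel [measurable]: "f \<in> borel_measurable borel"
  using continuous_f by (rule borel_measurable_continuous_onI)

lemma f1_0: "deriv f 0 = 0"
  by (rule DERIV_local_min[OF f_deriv zero_less_one]) (use f_min in auto)

lemma f1_diff_ge:
  assumes "x \<le> y" shows "c * (y - x) \<le> deriv f y - deriv f x"
proof -
  have "deriv f x - c * x \<le> deriv f y - c * y"
    using assms
    by (rule DERIV_nonneg_imp_nondecreasing)
      (use f2_ge in \<open>auto intro!: derivative_eq_intros f1_deriv exI\<close>)
  then show ?thesis by (simp add: algebra_simps)
qed

lemma f1_strict_mono: "x < y \<Longrightarrow> deriv f x < deriv f y"
  using f1_diff_ge[of x y] c_pos by (smt (verit) mult_pos_pos)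

lemma f1_mono: "x \<le> y \<Longrightarrow> deriv f x \<le> deriv f y"
  using f1_strict_mono[of x y] by (cases "x = y") auto

text \<open>The difference of \<open>f\<close> and the parabola with second derivative
  \<open>c\<close> has a nondecreasing derivative, hence lies above its tangents; adding the
  parabola back leaves the quadratic remainder. This remainder later turns closeness of values into
  closeness of velocities.\<close>

lemma f_tangent: "f x + deriv f x * (y - x) + c / 2 * (y - x)\<^sup>2 \<le> f y"
proof -
  let ?h = "\<lambda>y. f y - c / 2 * y\<^sup>2"
  have D: "(?h has_real_derivative (deriv f x - c * x)) (at x)" for x
    by (auto intro!: derivative_eq_intros f_deriv)
  have "convex_on UNIV ?h"
  proof (rule convex_on_realI)
    show "(?h has_real_derivative (deriv f x - c * x)) (at x)" for x by (rule D)
    show "deriv f x - c * x \<le> deriv f y - c * y" if "x \<le> y" for x y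
      using f1_diff_ge[OF that] by (simp add: algebra_simps)
  qed auto
  then have "?h x + (deriv f x - c * x) * (y - x) \<le> ?h y"
    using convex_on_imp_above_tangent[of UNIV ?h x y "deriv f x - c * x"] D[of x]
    by (simp add: algebra_simps)
  then show ?thesis by (simp add: field_simps power2_eq_square)
qed

text \<open>\<open>deriv f\<close> vanishes at 0 and grows with slope at least \<open>c\<close>, so
  the value \<open>q\<close> is reached within distance \<open>\<bar>q\<bar> / c\<close> of the
  origin.\<close>

lemma f1_surj: "\<exists>p. deriv f p = q"
proof -
  define b where "b = \<bar>q\<bar> / c"
  have b: "0 \<le> b" "c * b = \<bar>q\<bar>" using c_pos by (auto simp: b_def)
  have "deriv f (- b) \<le> q" "q \<le> deriv f b"
    using f1_diff_ge[of "-b" 0] f1_diff_ge[of 0 b] b f1_0 by auto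
  then show ?thesis
    using IVT'[of "deriv f" "- b" q b] continuous_f1 b by auto
qed

text \<open>The inverse of \<open>deriv f\<close>, and the slope of the Legendre transform
  \<open>L\<close>: it converts a speed of propagation into the value that travels with it.\<close>

definition g :: "real \<Rightarrow> real" where "g q = (SOME p. deriv f p = q)"

lemma f1_g [simp]: "deriv f (g q) = q"
  unfolding g_def using someI_ex[OF f1_surj] .

lemma g_f1 [simp]: "g (deriv f p) = p"
  using f1_strict_mono[of p "g (deriv f p)"] f1_strict_mono[of "g (deriv f p)" p] f1_g[of "deriv f p"]
  by (metis linorder_less_linear less_irrefl)

lemma g_strict_mono: "q < r \<Longrightarrow> g q < g r"
  using f1_mono[of "g r" "g q"] by (metis f1_g not_le)

lemma g_mono: "q \<le> r \<Longrightarrow> g q \<le> g r"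
  using g_strict_mono[of q r] by (cases "q = r") auto

lemma g_inj: "g q = g r \<longleftrightarrow> q = r"
  by (metis f1_g)

lemma g_lipschitz: "\<bar>g q - g r\<bar> \<le> \<bar>q - r\<bar> / c"
proof -
  have *: "g r - g q \<le> (r - q) / c" if "q \<le> r" for q r
    using f1_diff_ge[OF g_mono[OF that]] c_pos by (simp add: field_simps)
  show ?thesis using *[of q r] *[of r q] g_mono[of q r] g_mono[of r q] by (cases "q \<le> r") auto
qed

lemma continuous_g: "continuous_on A g"
proof -
  have "(1 / c)-lipschitz_on A g"
    using g_lipschitz c_pos by (intro lipschitz_onI) (auto simp: dist_real_def)
  then show ?thesis by (rule lipschitz_on_continuous_on)
qed

lemma g_borel [measurable]: "g \<in> borel_measurable borel"
  using continuous_g by (rule borel_measurable_continuous_onI)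

text \<open>The Legendre transform in closed form: the concave function \<open>p * q - f p\<close>
  of \<open>p\<close> is largest where \<open>deriv f p = q\<close>, that is at
  \<open>p = g q\<close>.\<close>

definition L :: "real \<Rightarrow> real" where "L q = q * g q - f (g q)"

lemma continuous_L: "continuous_on A L"
  unfolding L_def
  by (intro continuous_intros continuous_g continuous_on_compose2[OF continuous_f continuous_g]) auto

text \<open>The tangent of \<open>f\<close> at \<open>g q\<close> has slope \<open>q\<close>, so the
  remainder in \<open>f_tangent\<close> becomes a defect in the Fenchel-Young inequality: away from
  \<open>p = g q\<close> the loss is at least quadratic.\<close>

lemma young_strong: "p * q - f p + c / 2 * (g q - p)\<^sup>2 \<le> L q"
  using f_tangent[of "g q" p] by (simp add: L_def algebra_simps power2_commute)

lemma young: "p * q - f p \<le> L q"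
  using young_strong[of p q] c_pos by (smt (verit) divide_pos_pos mult_nonneg_nonneg zero_le_power2)

lemma L_f1: "L (deriv f p) = p * deriv f p - f p"
  by (simp add: L_def)

lemma L_tangent: "L q + g q * (r - q) \<le> L r"
  using young[of "g q" r] by (simp add: L_def algebra_simps)

lemma L_tangent_strict: "q \<noteq> r \<Longrightarrow> L q + g q * (r - q) < L r"
  using young_strong[of "g q" r] c_pos g_inj[of q r]
  by (smt (verit) L_def mult_pos_pos divide_pos_pos zero_less_power2 mult.commute right_diff_distrib)

lemma L_strict_convex:
  assumes "a < b" "0 < \<theta>" "\<theta> < 1"
  shows "L (a + \<theta> * (b - a)) < (1 - \<theta>) * L a + \<theta> * L b"
proof -
  let ?m = "a + \<theta> * (b - a)"
  have "0 < \<theta> * (b - a)" "0 < (1 - \<theta>) * (b - a)" using assms by auto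
  then have ne: "?m \<noteq> a" "?m \<noteq> b" by (auto simp: algebra_simps)
  have "(1 - \<theta>) * (L ?m + g ?m * (a - ?m)) < (1 - \<theta>) * L a"
    using L_tangent_strict[OF ne(1)] assms by simp
  moreover have "\<theta> * (L ?m + g ?m * (b - ?m)) < \<theta> * L b"
    using L_tangent_strict[OF ne(2)] assms by simp
  ultimately have "(1 - \<theta>) * (L ?m + g ?m * (a - ?m)) + \<theta> * (L ?m + g ?m * (b - ?m)) < (1 - \<theta>) * L a + \<theta> * L b"
    by linarith
  then show ?thesis by (simp add: algebra_simps)
qed

lemma L_convex:
  assumes "0 \<le> \<theta>" "\<theta> \<le> 1"
  shows "L (a + \<theta> * (b - a)) \<le> (1 - \<theta>) * L a + \<theta> * L b"
proof -
  consider "\<theta> = 0" | "\<theta> = 1" | "a = b" | "a < b" "0 < \<theta>" "\<theta> < 1" | "b < a" "0 < \<theta>" "\<theta> < 1"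
    using assms by linarith
  then show ?thesis
  proof cases
    case 4
    then show ?thesis using L_strict_convex[of a b \<theta>] by simp
  next
    case 5
    then show ?thesis using L_strict_convex[of b a "1 - \<theta>"] by (simp add: algebra_simps)
  qed (auto simp: algebra_simps)
qed

text \<open>Both \<open>q1 + d\<close> and \<open>q2\<close> lie strictly between \<open>q1\<close>
  and \<open>q2 + d\<close>, with complementary convex weights, so two strict convexity inequalities
  add up. This exchange inequality is behind the non-crossing of minimising lines and the
  preservation of order.\<close>

lemma L_four_points:
  assumes "q1 < q2" "0 < d"
  shows "L (q1 + d) + L q2 < L q1 + L (q2 + d)"
proof -
  define w \<alpha> where "w = q2 + d - q1" and "\<alpha> = d / w"
  have w: "0 < w" "d < w" using assms by (auto simp: w_def)
  then have \<alpha>: "0 < \<alpha>" "\<alpha> < 1" "\<alpha> * w = d" "(1 - \<alpha>) * w = q2 - q1"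
    using assms by (auto simp: \<alpha>_def algebra_simps) (simp add: w_def)
  have "L (q1 + d) < (1 - \<alpha>) * L q1 + \<alpha> * L (q2 + d)"
    using L_strict_convex[of q1 "q2 + d" \<alpha>] assms \<alpha> by (simp flip: w_def)
  moreover have "L q2 < \<alpha> * L q1 + (1 - \<alpha>) * L (q2 + d)"
    using L_strict_convex[of q1 "q2 + d" "1 - \<alpha>"] assms \<alpha> by (simp flip: w_def)
  ultimately show ?thesis by (simp add: algebra_simps)
qed

end

section \<open>The Hopf-Lax formula\<close>

lemma lipschitz_real:
  fixes U :: "real \<Rightarrow> real"
  assumes "M-lipschitz_on UNIV U" shows "\<bar>U x - U y\<bar> \<le> M * \<bar>x - y\<bar>"
  using lipschitz_onD[OF assms, of x y] by (simp add: dist_real_def)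

context convex_flux
begin

definition cost :: "(real \<Rightarrow> real) \<Rightarrow> real \<Rightarrow> real \<Rightarrow> real \<Rightarrow> real" where
  "cost U t x y = U y + t * L ((x - y) / t)"

definition is_arg :: "(real \<Rightarrow> real) \<Rightarrow> real \<Rightarrow> real \<Rightarrow> real \<Rightarrow> bool" where
  "is_arg U t x y \<longleftrightarrow> (\<forall>z. cost U t x y \<le> cost U t x z)"

definition ymax :: "(real \<Rightarrow> real) \<Rightarrow> real \<Rightarrow> real \<Rightarrow> real" where
  "ymax U t x = Sup {y. is_arg U t x y}"

definition ymin :: "(real \<Rightarrow> real) \<Rightarrow> real \<Rightarrow> real \<Rightarrow> real" where
  "ymin U t x = Inf {y. is_arg U t x y}"

text \<open>Written as the cost at the rightmost minimiser instead of an infimum; it is used for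
  Lipschitz \<open>U\<close> and positive \<open>t\<close>, where minimisers exist.\<close>

definition HL :: "(real \<Rightarrow> real) \<Rightarrow> real \<Rightarrow> real \<Rightarrow> real" where
  "HL U t x = cost U t x (ymax U t x)"

text \<open>A minimiser \<open>y\<close> is the foot of a characteristic through
  \<open>(t, x)\<close>, a line of speed \<open>(x - y) / t\<close>, and the value transported along
  it is the one whose \<open>deriv f\<close> is that speed. For Lipschitz \<open>U\<close> and fixed
  positive \<open>t\<close>, the choice of the rightmost foot matters at countably many
  \<open>x\<close> only.\<close>

definition vel :: "(real \<Rightarrow> real) \<Rightarrow> real \<Rightarrow> real \<Rightarrow> real" where
  "vel U t x = g ((x - ymax U t x) / t)"

definition uniq :: "(real \<Rightarrow> real) \<Rightarrow> real \<Rightarrow> real \<Rightarrow> bool" where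
  "uniq U t x \<longleftrightarrow> ymin U t x = ymax U t x"

section \<open>Finite speed of propagation and existence of minimisers\<close>

lemma cost_project_right:
  assumes "M-lipschitz_on UNIV U" "0 < t" "deriv f M < (x - y) / t"
  shows "cost U t x (x - deriv f M * t) < cost U t x y"
proof -
  define q r where "q = (x - y) / t" and "r = deriv f M"
  have y: "y = x - q * t" using assms by (simp add: q_def)
  \<comment> \<open>At the speed \<open>r = deriv f M\<close> the slope of \<open>L\<close> is
    \<open>M\<close>. Slowing down from \<open>q\<close> to \<open>r\<close> therefore saves more in
    \<open>L\<close> than the Lipschitz function \<open>U\<close> can lose along the displacement of
    the foot.\<close>
  have "L r + M * (q - r) < L q"
    using L_tangent_strict[of r q] assms by (simp add: q_def r_def)
  then have "t * (L r + M * (q - r)) < t * L q" using assms by simp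
  moreover have "\<bar>x - r * t - y\<bar> = (q - r) * t"
    using assms by (simp add: y left_diff_distrib[symmetric] abs_mult) (simp add: q_def r_def)
  then have "U (x - r * t) \<le> U y + M * ((q - r) * t)"
    using lipschitz_real[OF assms(1), of "x - r * t" y] by simp
  moreover have "cost U t x (x - r * t) = U (x - r * t) + t * L r" "cost U t x y = U y + t * L q"
    using assms by (auto simp: cost_def q_def)
  ultimately show ?thesis by (simp add: algebra_simps flip: r_def)
qed

lemma cost_project_left:
  assumes "M-lipschitz_on UNIV U" "0 < t" "(x - y) / t < deriv f (- M)"
  shows "cost U t x (x - deriv f (- M) * t) < cost U t x y"
proof -
  define q r where "q = (x - y) / t" and "r = deriv f (- M)"
  have y: "y = x - q * t" using assms by (simp add: q_def)
  have "L r + (- M) * (q - r) < L q"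
    using L_tangent_strict[of r q] assms by (simp add: q_def r_def)
  then have "t * (L r + (- M) * (q - r)) < t * L q" using assms by simp
  moreover have "\<bar>x - r * t - y\<bar> = (r - q) * t"
    using assms by (simp add: y left_diff_distrib[symmetric] abs_mult) (simp add: q_def r_def)
  then have "U (x - r * t) \<le> U y + M * ((r - q) * t)"
    using lipschitz_real[OF assms(1), of "x - r * t" y] by simp
  moreover have "cost U t x (x - r * t) = U (x - r * t) + t * L r" "cost U t x y = U y + t * L q"
    using assms by (auto simp: cost_def q_def)
  ultimately show ?thesis by (simp add: algebra_simps flip: r_def)
qed

lemma arg_bounds:
  assumes "M-lipschitz_on UNIV U" "0 < t" "is_arg U t x y"
  shows "deriv f (- M) \<le> (x - y) / t" "(x - y) / t \<le> deriv f M"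
  using cost_project_left[OF assms(1,2), of x y] cost_project_right[OF assms(1,2), of x y] assms(3)
  by (force simp: is_arg_def not_less[symmetric])+

lemma arg_bounds':
  assumes "M-lipschitz_on UNIV U" "0 < t" "is_arg U t x y"
  shows "x - deriv f M * t \<le> y" "y \<le> x - deriv f (- M) * t"
  using arg_bounds[OF assms] assms(2) by (auto simp: field_simps)

lemma continuous_cost:
  assumes "M-lipschitz_on UNIV U" "0 < t"
  shows "continuous_on A (cost U t x)"
  unfolding cost_def
  by (intro continuous_intros continuous_on_compose2[OF continuous_L]
      continuous_on_subset[OF lipschitz_on_continuous_on[OF assms(1)]]) (use assms in auto)

text \<open>A minimiser over the compact interval of admissible feet is global, because a foot
  outside loses against the nearer endpoint by the two projection lemmas.\<close>

lemma ex_arg: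
  assumes lip: "M-lipschitz_on UNIV U" and t: "0 < t"
  shows "\<exists>y. is_arg U t x y"
proof -
  let ?a = "x - deriv f M * t" and ?b = "x - deriv f (- M) * t"
  have M: "0 \<le> M" using lip by (rule lipschitz_on_nonneg)
  have ab: "?a \<le> ?b" using f1_mono[of "- M" M] M t by simp
  obtain y where y: "y \<in> {?a..?b}" "\<And>z. z \<in> {?a..?b} \<Longrightarrow> cost U t x y \<le> cost U t x z"
    using continuous_attains_inf[of "{?a..?b}" "cost U t x"] continuous_cost[OF lip t] ab by auto
  have "cost U t x y \<le> cost U t x z" for z
  proof -
    consider "z \<in> {?a..?b}" | "z < ?a" | "?b < z" by force
    then show ?thesis
    proof cases
      case 2
      then have "deriv f M < (x - z) / t" using t by (simp add: field_simps)
      from cost_project_right[OF lip t this] y(2)[of ?a] ab show ?thesis by simp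
    next
      case 3
      then have "(x - z) / t < deriv f (- M)" using t by (simp add: field_simps)
      from cost_project_left[OF lip t this] y(2)[of ?b] ab show ?thesis by simp
    qed (use y in auto)
  qed
  then show ?thesis by (auto simp: is_arg_def)
qed

text \<open>The cost is jointly continuous at positive times, so minimality against each fixed
  competitor passes to the limit. Compactness of the sets of minimisers and continuity of
  \<open>ymax\<close> both rest on this.\<close>

lemma arg_limit:
  assumes lip: "M-lipschitz_on UNIV U" and t: "0 < t"
    and lim: "T \<longlonglongrightarrow> t" "X \<longlonglongrightarrow> x" "Y \<longlonglongrightarrow> y" and arg: "\<And>n. is_arg U (T n) (X n) (Y n)"
  shows "is_arg U t x y"
proof -
  have cU: "isCont U y" for y
    using lipschitz_on_continuous_on[OF lip] by (simp add: continuous_on_eq_continuous_at)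
  have cL: "isCont L y" for y
    using continuous_L[of UNIV] by (simp add: continuous_on_eq_continuous_at)
  have lim_cost: "(\<lambda>n. cost U (T n) (X n) (Z n)) \<longlonglongrightarrow> cost U t x z" if "Z \<longlonglongrightarrow> z" for Z z
    unfolding cost_def
    by (intro tendsto_intros lim that isCont_tendsto_compose[OF cU] isCont_tendsto_compose[OF cL])
      (use t in auto)
  have "cost U t x y \<le> cost U t x z" for z
    by (rule LIMSEQ_le[OF lim_cost[OF lim(3)] lim_cost[OF tendsto_const]])
      (use arg in \<open>auto simp: is_arg_def\<close>)
  then show ?thesis by (simp add: is_arg_def)
qed

lemma compact_args:
  assumes lip: "M-lipschitz_on UNIV U" and t: "0 < t"
  shows "compact {y. is_arg U t x y}"
proof -
  have "{y. is_arg U t x y} \<subseteq> {x - deriv f M * t..x - deriv f (- M) * t}"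
    using arg_bounds'[OF lip t] by auto
  then have "bounded {y. is_arg U t x y}" by (rule bounded_subset[rotated]) auto
  moreover have "closed {y. is_arg U t x y}"
    unfolding closed_sequential_limits
    using arg_limit[OF lip t tendsto_const tendsto_const] by blast
  ultimately show ?thesis by (simp add: compact_eq_bounded_closed)
qed

lemma is_arg_ymax:
  assumes lip: "M-lipschitz_on UNIV U" and t: "0 < t"
  shows "is_arg U t x (ymax U t x)"
  using closed_contains_Sup[of "{y. is_arg U t x y}"] compact_args[OF lip t, of x] ex_arg[OF lip t, of x]
  by (auto simp: ymax_def compact_eq_bounded_closed bounded_imp_bdd_above)

lemma is_arg_ymin:
  assumes lip: "M-lipschitz_on UNIV U" and t: "0 < t"
  shows "is_arg U t x (ymin U t x)"
  using closed_contains_Inf[of "{y. is_arg U t x y}"] compact_args[OF lip t, of x] ex_arg[OF lip t, of x]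
  by (auto simp: ymin_def compact_eq_bounded_closed bounded_imp_bdd_below)

lemma arg_le_ymax:
  assumes lip: "M-lipschitz_on UNIV U" and t: "0 < t" and "is_arg U t x y"
  shows "y \<le> ymax U t x" "ymin U t x \<le> y"
  using compact_args[OF lip t, of x] assms(3)
  by (auto simp: ymax_def ymin_def compact_eq_bounded_closed bounded_imp_bdd_above bounded_imp_bdd_below
      intro!: cSup_upper cInf_lower)

lemma HL_le:
  assumes "M-lipschitz_on UNIV U" "0 < t"
  shows "HL U t x \<le> cost U t x y"
  using is_arg_ymax[OF assms] by (simp add: HL_def is_arg_def)

lemma HL_arg:
  assumes "M-lipschitz_on UNIV U" "0 < t" "is_arg U t x y"
  shows "HL U t x = cost U t x y"
  using HL_le[OF assms(1,2), of x y] assms(3) by (simp add: HL_def is_arg_def order_antisym)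

section \<open>Monotonicity and generic uniqueness of the minimiser\<close>

lemma arg_mono:
  assumes t: "0 < t" and x: "x1 < x2" and arg: "is_arg U t x1 y1" "is_arg U t x2 y2"
  shows "y1 \<le> y2"
proof (rule ccontr)
  assume "\<not> y1 \<le> y2"
  then have "(x1 - y1) / t < (x1 - y2) / t" using t by (simp add: field_simps)
  \<comment> \<open>Exchanging the two feet would lower the sum of the two costs: the values of
    \<open>U\<close> are merely permuted, and the four-point inequality is strict.\<close>
  from L_four_points[OF this, of "(x2 - x1) / t"] x t
  have "L ((x2 - y1) / t) + L ((x1 - y2) / t) < L ((x1 - y1) / t) + L ((x2 - y2) / t)"
    by (simp add: add_divide_distrib[symmetric])
  then have "t * (L ((x2 - y1) / t) + L ((x1 - y2) / t)) < t * (L ((x1 - y1) / t) + L ((x2 - y2) / t))"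
    using t by simp
  moreover have "cost U t x1 y1 \<le> cost U t x1 y2" "cost U t x2 y2 \<le> cost U t x2 y1"
    using arg by (auto simp: is_arg_def)
  ultimately show False by (simp add: cost_def distrib_left)
qed

lemma mono_ymax:
  assumes "M-lipschitz_on UNIV U" "0 < t" shows "mono (ymax U t)"
proof (rule monoI)
  fix x y :: real assume "x \<le> y"
  then show "ymax U t x \<le> ymax U t y"
    using arg_mono[OF assms(2) _ is_arg_ymax[OF assms] is_arg_ymax[OF assms], of x y]
    by (cases "x = y") auto
qed

text \<open>Every foot of a point to the left of \<open>x\<close> lies to the left of every foot of
  \<open>x\<close>. Where the monotone function \<open>ymax U t\<close> is continuous, its limit
  from the left is thus at most \<open>ymin U t x\<close>, and a monotone function has only
  countably many discontinuities.\<close>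

lemma countable_not_uniq:
  assumes lip: "M-lipschitz_on UNIV U" and t: "0 < t"
  shows "countable {x. \<not> uniq U t x}"
proof (rule countable_subset[OF _ mono_ctble_discont[OF mono_ymax[OF assms]]], safe)
  fix x assume "\<not> uniq U t x" and "isCont (ymax U t) x"
  then have lim: "(ymax U t \<longlongrightarrow> ymax U t x) (at_left x)"
    by (simp add: isCont_def filterlim_at_split)
  have "eventually (\<lambda>y. ymax U t y \<le> ymin U t x) (at_left x)"
    using arg_mono[OF t _ is_arg_ymax[OF assms] is_arg_ymin[OF assms]]
    by (auto simp: eventually_at_filter)
  from tendsto_upperbound[OF lim this] have "ymax U t x \<le> ymin U t x" by simp
  moreover have "ymin U t x \<le> ymax U t x"
    using arg_le_ymax(1)[OF assms is_arg_ymin[OF assms]] .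
  ultimately show False using \<open>\<not> uniq U t x\<close> by (simp add: uniq_def)
qed

lemma AE_uniq:
  assumes "M-lipschitz_on UNIV U" "0 < t" shows "AE x in lborel. uniq U t x"
  using AE_not_in[OF countable_imp_null_set_lborel[OF countable_not_uniq[OF assms]]] by eventually_elim auto

text \<open>Feet converge along a subsequence because the speeds \<open>X n\<close> stay in one
  compact interval, and the limit is a minimiser by \<open>arg_limit\<close>. With half-lines for
  \<open>S\<close> this yields both the semicontinuity and the Borel measurability of the extreme
  minimisers.\<close>

lemma closure_args:
  assumes lip: "M-lipschitz_on UNIV U" and S: "closed S"
    and z: "z \<in> closure {z. 0 < fst z \<and> (\<exists>y\<in>S. is_arg U (fst z) (snd z) y)}" "0 < fst z"
  shows "\<exists>y\<in>S. is_arg U (fst z) (snd z) y"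
proof -
  obtain Z where Z: "\<And>n. Z n \<in> {z. 0 < fst z \<and> (\<exists>y\<in>S. is_arg U (fst z) (snd z) y)}" "Z \<longlonglongrightarrow> z"
    using z(1) by (auto simp: closure_sequential)
  obtain Y where Y: "\<And>n. Y n \<in> S" "\<And>n. is_arg U (fst (Z n)) (snd (Z n)) (Y n)"
    using Z(1) by simp metis
  define X where "X n = (snd (Z n) - Y n) / fst (Z n)" for n
  have X: "X n \<in> {deriv f (- M)..deriv f M}" for n
    using arg_bounds[OF lip _ Y(2)] Z(1)[of n] by (simp add: X_def)
  then have "range X \<subseteq> {deriv f (- M)..deriv f M}" by blast
  then have "bounded (range X)" by (rule bounded_subset[OF bounded_closed_interval])
  then obtain q r where r: "strict_mono r" and q: "(X \<circ> r) \<longlonglongrightarrow> q"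
    using bounded_imp_convergent_subsequence by metis
  have lf: "(\<lambda>n. fst (Z (r n))) \<longlonglongrightarrow> fst z" "(\<lambda>n. snd (Z (r n))) \<longlonglongrightarrow> snd z"
    using LIMSEQ_subseq_LIMSEQ[OF Z(2) r] by (auto simp: o_def intro: tendsto_fst tendsto_snd)
  have "Y (r n) = snd (Z (r n)) - fst (Z (r n)) * X (r n)" for n
    using Z(1)[of "r n"] by (simp add: X_def)
  moreover have "(\<lambda>n. snd (Z (r n)) - fst (Z (r n)) * X (r n)) \<longlonglongrightarrow> snd z - fst z * q"
    using q by (intro tendsto_intros lf) (simp add: o_def)
  ultimately have ly: "(\<lambda>n. Y (r n)) \<longlonglongrightarrow> snd z - fst z * q" by simp
  have "is_arg U (fst z) (snd z) (snd z - fst z * q)"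
    by (rule arg_limit[OF lip z(2) lf ly Y(2)])
  moreover have "snd z - fst z * q \<in> S"
    using closed_sequentially[OF S _ ly] Y(1) by blast
  ultimately show ?thesis by blast
qed

lemma eventually_no_arg:
  assumes lip: "M-lipschitz_on UNIV U" and "closed S" "0 < t" "\<And>y. y \<in> S \<Longrightarrow> \<not> is_arg U t x y"
  shows "eventually (\<lambda>z. 0 < fst z \<and> (\<forall>y\<in>S. \<not> is_arg U (fst z) (snd z) y)) (nhds (t, x))"
proof -
  let ?A = "{z. 0 < fst z \<and> (\<exists>y\<in>S. is_arg U (fst z) (snd z) y)}"
  have "(t, x) \<notin> closure ?A"
    using closure_args[OF lip assms(2), of "(t, x)"] assms(3,4) by auto
  then have "eventually (\<lambda>z. z \<in> - closure ?A) (nhds (t, x))"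
    by (intro eventually_nhds_in_open) auto
  moreover have "eventually (\<lambda>z. z \<in> {z. 0 < fst z}) (nhds (t, x))"
    using assms(3) by (intro eventually_nhds_in_open open_Collect_less continuous_intros) auto
  ultimately show ?thesis
    by eventually_elim (use closure_subset[of ?A] in auto)
qed

text \<open>Uniqueness excludes minimisers from every closed half-line that misses the foot, on
  either side, and by \<open>eventually_no_arg\<close> the exclusion persists for nearby times and
  positions.\<close>

lemma isCont_ymax:
  assumes lip: "M-lipschitz_on UNIV U" and t: "0 < t" and uq: "uniq U t x"
  shows "isCont (\<lambda>z. ymax U (fst z) (snd z)) (t, x)"
  unfolding continuous_at fst_conv snd_conv
proof (rule order_tendstoI)
  fix a assume a: "a < ymax U t x"
  have "\<not> is_arg U t x y" if "y \<in> {..a}" for y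
    using arg_le_ymax(2)[OF lip t, of x y] that a uq by (auto simp: uniq_def)
  with eventually_no_arg[OF lip closed_atMost t, of a x]
  have "eventually (\<lambda>z. 0 < fst z \<and> (\<forall>y\<in>{..a}. \<not> is_arg U (fst z) (snd z) y)) (nhds (t, x))" by blast
  then have "eventually (\<lambda>z. a < ymax U (fst z) (snd z)) (nhds (t, x))"
    by eventually_elim (use is_arg_ymax[OF lip] in \<open>auto simp: not_le[symmetric]\<close>)
  then show "eventually (\<lambda>z. a < ymax U (fst z) (snd z)) (at (t, x))"
    by (rule filter_leD[rotated]) (simp add: at_within_def)
next
  fix a assume a: "ymax U t x < a"
  have "\<not> is_arg U t x y" if "y \<in> {a..}" for y
    using arg_le_ymax(1)[OF lip t, of x y] that a by auto
  with eventually_no_arg[OF lip closed_atLeast t, of a x]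
  have "eventually (\<lambda>z. 0 < fst z \<and> (\<forall>y\<in>{a..}. \<not> is_arg U (fst z) (snd z) y)) (nhds (t, x))" by blast
  then have "eventually (\<lambda>z. ymax U (fst z) (snd z) < a) (nhds (t, x))"
    by eventually_elim (use is_arg_ymax[OF lip] in \<open>auto simp: not_le[symmetric]\<close>)
  then show "eventually (\<lambda>z. ymax U (fst z) (snd z) < a) (at (t, x))"
    by (rule filter_leD[rotated]) (simp add: at_within_def)
qed

lemma isCont_vel:
  assumes lip: "M-lipschitz_on UNIV U" and t: "0 < t" and uq: "uniq U t x"
  shows "isCont (\<lambda>z. vel U (fst z) (snd z)) (t, x)"
proof -
  have cg: "isCont g y" for y
    using continuous_g[of UNIV] by (simp add: continuous_on_eq_continuous_at)
  show ?thesis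
    unfolding vel_def
    by (intro continuous_intros isCont_ymax[OF assms] isCont_o2[OF _ cg]) (use t in auto)
qed

section \<open>Bounds and Borel measurability of the velocity field\<close>

lemma vel_bound:
  assumes lip: "M-lipschitz_on UNIV U" and t: "0 < t"
  shows "\<bar>vel U t x\<bar> \<le> M"
  using arg_bounds[OF assms is_arg_ymax[OF assms], of x]
    g_mono[of "deriv f (- M)" "(x - ymax U t x) / t"] g_mono[of "(x - ymax U t x) / t" "deriv f M"]
  by (auto simp: vel_def)

text \<open>Among positive times the set contains all its limit points, so it is a closed set cut by
  an open half-plane.\<close>

lemma args_borel:
  assumes lip: "M-lipschitz_on UNIV U" and S: "closed S"
  shows "{z. 0 < fst z \<and> (\<exists>y\<in>S. is_arg U (fst z) (snd z) y)} \<in> sets borel" (is "?A \<in> _")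
proof -
  have "?A = {z. 0 < fst z} \<inter> closure ?A"
  proof
    show "?A \<subseteq> {z. 0 < fst z} \<inter> closure ?A" using closure_subset[of ?A] by blast
    show "{z. 0 < fst z} \<inter> closure ?A \<subseteq> ?A"
    proof
      fix z assume "z \<in> {z. 0 < fst z} \<inter> closure ?A"
      then show "z \<in> ?A" using closure_args[OF assms, of z] by simp
    qed
  qed
  also have "\<dots> \<in> sets borel"
    by (intro sets.Int borel_open borel_closed open_Collect_less continuous_intros closed_closure)
  finally show ?thesis .
qed

lemma ymax_borel:
  assumes lip: "M-lipschitz_on UNIV U"
  shows "(\<lambda>z. if 0 < fst z then ymax U (fst z) (snd z) else 0) \<in> borel_measurable borel"
  unfolding borel_measurable_iff_ge
proof
  fix a
  have "{z. 0 < fst z \<and> a \<le> ymax U (fst z) (snd z)}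
      = {z. 0 < fst z \<and> (\<exists>y\<in>{a..}. is_arg U (fst z) (snd z) y)}"
    using is_arg_ymax[OF lip] arg_le_ymax(1)[OF lip] by force
  then have 1: "{z. 0 < fst z \<and> a \<le> ymax U (fst z) (snd z)} \<in> sets borel"
    using args_borel[OF lip, of "{a..}"] by simp
  have 2: "{z::real \<times> real. \<not> 0 < fst z \<and> a \<le> 0} \<in> sets borel"
    by (intro borel_closed closed_Collect_conj closed_Collect_const) (simp add: not_less closed_Collect_le continuous_intros)
  have "{z. a \<le> (if 0 < fst z then ymax U (fst z) (snd z) else 0)}
      = {z. 0 < fst z \<and> a \<le> ymax U (fst z) (snd z)} \<union> {z. \<not> 0 < fst z \<and> a \<le> 0}" by auto
  then show "{z \<in> space borel. a \<le> (if 0 < fst z then ymax U (fst z) (snd z) else 0)} \<in> sets borel"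
    using 1 2 by simp
qed

lemma ymin_borel:
  assumes lip: "M-lipschitz_on UNIV U"
  shows "(\<lambda>z. if 0 < fst z then ymin U (fst z) (snd z) else 0) \<in> borel_measurable borel"
  unfolding borel_measurable_iff_le
proof
  fix a
  have "{z. 0 < fst z \<and> ymin U (fst z) (snd z) \<le> a}
      = {z. 0 < fst z \<and> (\<exists>y\<in>{..a}. is_arg U (fst z) (snd z) y)}"
    using is_arg_ymin[OF lip] arg_le_ymax(2)[OF lip] by force
  then have 1: "{z. 0 < fst z \<and> ymin U (fst z) (snd z) \<le> a} \<in> sets borel"
    using args_borel[OF lip, of "{..a}"] by simp
  have 2: "{z::real \<times> real. \<not> 0 < fst z \<and> 0 \<le> a} \<in> sets borel"
    by (intro borel_closed closed_Collect_conj closed_Collect_const) (simp add: not_less closed_Collect_le continuous_intros)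
  have "{z. (if 0 < fst z then ymin U (fst z) (snd z) else 0) \<le> a}
      = {z. 0 < fst z \<and> ymin U (fst z) (snd z) \<le> a} \<union> {z. \<not> 0 < fst z \<and> 0 \<le> a}" by auto
  then show "{z \<in> space borel. (if 0 < fst z then ymin U (fst z) (snd z) else 0) \<le> a} \<in> sets borel"
    using 1 2 by simp
qed

lemma vel_borel:
  assumes lip: "M-lipschitz_on UNIV U"
  shows "(\<lambda>z. if 0 < fst z then vel U (fst z) (snd z) else 0) \<in> borel_measurable borel"
proof -
  define B where "B = (\<lambda>z. if 0 < fst z then ymax U (fst z) (snd z) else 0)"
  have [measurable]: "B \<in> borel_measurable (borel \<Otimes>\<^sub>M borel)"
    unfolding B_def borel_prod by (rule ymax_borel[OF lip])
  have "(\<lambda>z. if 0 < fst z then g ((snd z - B z) / fst z) else 0)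
    \<in> borel_measurable (borel \<Otimes>\<^sub>M borel)"
    by measurable
  also have "(\<lambda>z. if 0 < fst z then g ((snd z - B z) / fst z) else 0)
      = (\<lambda>z. if 0 < fst z then vel U (fst z) (snd z) else 0)"
    by (auto simp: vel_def B_def)
  finally show ?thesis by (simp only: borel_prod)
qed

lemma vel_borel_slice:
  assumes lip: "M-lipschitz_on UNIV U" and t: "0 < t"
  shows "vel U t \<in> borel_measurable borel"
proof -
  have "(\<lambda>x. (\<lambda>z. if 0 < fst z then vel U (fst z) (snd z) else 0) (t, x)) \<in> borel_measurable borel"
    by (rule measurable_compose[OF _ vel_borel[OF lip]]) simp
  then show ?thesis using t by simp
qed

text \<open>Exceptional points are countable on each time slice, so Fubini applies once the set is
  known to be measurable; for this both extreme minimisers are needed as Borel functions.\<close>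

lemma AE_uniq_pair:
  assumes lip: "M-lipschitz_on UNIV U"
  shows "AE z in lborel. 0 < fst z \<longrightarrow> uniq U (fst z) (snd z)"
proof -
  define A B where "A = (\<lambda>z. if 0 < fst z then ymin U (fst z) (snd z) else 0)"
    and "B = (\<lambda>z. if 0 < fst z then ymax U (fst z) (snd z) else 0)"
  have [measurable]: "A \<in> borel_measurable borel" "B \<in> borel_measurable borel"
    unfolding A_def B_def by (rule ymin_borel[OF lip], rule ymax_borel[OF lip])
  have "{z. A z = B z} \<in> sets borel" by measurable
  also have "{z. A z = B z} = {z. 0 < fst z \<longrightarrow> uniq U (fst z) (snd z)}"
    by (auto simp: uniq_def A_def B_def)
  finally have m: "{z. 0 < fst z \<longrightarrow> uniq U (fst z) (snd z)} \<in> sets (lborel \<Otimes>\<^sub>M lborel)"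
    unfolding lborel_prod sets_lborel .
  have "AE z in lborel \<Otimes>\<^sub>M lborel. 0 < fst z \<longrightarrow> uniq U (fst z) (snd z)"
  proof (rule lborel_pair.AE_pair_measure)
    show "{z \<in> space (lborel \<Otimes>\<^sub>M lborel). 0 < fst z \<longrightarrow> uniq U (fst z) (snd z)} \<in> sets (lborel \<Otimes>\<^sub>M lborel)"
      using m unfolding lborel_prod by simp
    show "AE x in lborel. AE y in lborel. 0 < fst (x, y) \<longrightarrow> uniq U (fst (x, y)) (snd (x, y))"
    proof (rule AE_I2)
      fix t :: real
      show "AE y in lborel. 0 < fst (t, y) \<longrightarrow> uniq U (fst (t, y)) (snd (t, y))"
        using AE_uniq[OF lip, of t] by (cases "0 < t") auto
    qed
  qed
  then show ?thesis unfolding lborel_prod .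
qed

section \<open>Regularity, semigroup law and order preservation of the Hopf-Lax function\<close>

lemma HL_lipschitz:
  assumes lip: "M-lipschitz_on UNIV U" and t: "0 < t"
  shows "M-lipschitz_on UNIV (HL U t)"
proof (rule lipschitz_onI)
  have *: "HL U t x' \<le> HL U t x + M * \<bar>x' - x\<bar>" for x x'
  proof -
    \<comment> \<open>Carrying the foot along with the point leaves the speed, and hence the term
      with \<open>L\<close>, unchanged.\<close>
    have "HL U t x' \<le> cost U t x' (ymax U t x + (x' - x))" by (rule HL_le[OF assms])
    also have "\<dots> = HL U t x + (U (ymax U t x + (x' - x)) - U (ymax U t x))"
      by (simp add: HL_def cost_def)
    also have "\<dots> \<le> HL U t x + M * \<bar>x' - x\<bar>"
      using lipschitz_real[OF lip, of "ymax U t x + (x' - x)" "ymax U t x"] by auto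
    finally show ?thesis .
  qed
  show "dist (HL U t x) (HL U t y) \<le> M * dist x y" for x y
    using *[of x y] *[of y x] by (auto simp: dist_real_def abs_minus_commute)
  show "0 \<le> M" using lip by (rule lipschitz_on_nonneg)
qed

text \<open>The foot of \<open>x\<close> is kept as a competitor for \<open>x'\<close>, so only the
  convex term with \<open>L\<close> changes. Exchanging the roles of the two points gives the bound
  from the other side.\<close>

lemma HL_diff_le:
  assumes lip: "M-lipschitz_on UNIV U" and t: "0 < t" and arg: "is_arg U t x y"
  shows "HL U t x' - HL U t x \<le> g ((x' - y) / t) * (x' - x)"
proof -
  have "HL U t x' - HL U t x \<le> cost U t x' y - cost U t x y"
    using HL_le[OF lip t, of x' y] HL_arg[OF lip t arg] by simp
  also have "\<dots> = t * (L ((x' - y) / t) - L ((x - y) / t))" by (simp add: cost_def algebra_simps)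
  also have "\<dots> \<le> t * (g ((x' - y) / t) * ((x' - y) / t - (x - y) / t))"
    using L_tangent[of "(x' - y) / t" "(x - y) / t"] t by (intro mult_left_mono) (auto simp: algebra_simps)
  also have "\<dots> = g ((x' - y) / t) * (x' - x)" using t by (simp add: field_simps)
  finally show ?thesis .
qed

text \<open>Difference quotients lie between two slopes, one from the foot of \<open>x\<close> seen
  from \<open>x'\<close>, the other from the foot of \<open>x'\<close> seen from \<open>x\<close>.
  Uniqueness makes \<open>ymax\<close> continuous at \<open>x\<close>, so both slopes tend to
  \<open>vel U t x\<close>.\<close>

lemma HL_deriv:
  assumes lip: "M-lipschitz_on UNIV U" and t: "0 < t" and uq: "uniq U t x"
  shows "(HL U t has_real_derivative vel U t x) (at x)"
proof -
  let ?y = "ymax U t"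
  have cg: "isCont g y" for y
    using continuous_g[of UNIV] by (simp add: continuous_on_eq_continuous_at)
  let ?a = "\<lambda>x'. g ((x - ?y x') / t)" and ?b = "\<lambda>x'. g ((x' - ?y x) / t)"
  have "isCont (\<lambda>x'. (\<lambda>z. ymax U (fst z) (snd z)) (t, x')) x"
    by (rule isCont_o2[where g="\<lambda>z. ymax U (fst z) (snd z)"])
      (auto intro!: isCont_ymax[OF assms] continuous_intros)
  then have "isCont ?y x" by simp
  then have a: "(?a \<longlongrightarrow> vel U t x) (at x)"
    unfolding vel_def isCont_def
    by (intro isCont_tendsto_compose[OF cg] tendsto_intros) (use t in auto)
  have b: "(?b \<longlongrightarrow> vel U t x) (at x)"
    unfolding vel_def by (intro isCont_tendsto_compose[OF cg] tendsto_intros) (use t in auto)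
  have 1: "HL U t x' - HL U t x \<le> ?b x' * (x' - x)" for x'
    by (rule HL_diff_le[OF lip t is_arg_ymax[OF lip t]])
  have 2: "?a x' * (x' - x) \<le> HL U t x' - HL U t x" for x'
    using HL_diff_le[OF lip t is_arg_ymax[OF lip t], of x x'] by (simp add: algebra_simps)
  have "((\<lambda>x'. (HL U t x' - HL U t x) / (x' - x)) \<longlongrightarrow> vel U t x) (at x)"
  proof (rule tendsto_sandwich)
    have *: "min (?a x') (?b x') \<le> (HL U t x' - HL U t x) / (x' - x)
        \<and> (HL U t x' - HL U t x) / (x' - x) \<le> max (?a x') (?b x')" if "x' \<noteq> x" for x'
    proof (cases "x < x'")
      case True
      then have "?a x' \<le> (HL U t x' - HL U t x) / (x' - x)" "(HL U t x' - HL U t x) / (x' - x) \<le> ?b x'"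
        using 1[of x'] 2[of x'] by (simp_all add: pos_le_divide_eq pos_divide_le_eq)
      then show ?thesis by linarith
    next
      case False
      then have "?b x' \<le> (HL U t x' - HL U t x) / (x' - x)" "(HL U t x' - HL U t x) / (x' - x) \<le> ?a x'"
        using 1[of x'] 2[of x'] that by (simp_all add: neg_le_divide_eq neg_divide_le_eq)
      then show ?thesis by linarith
    qed
    show "\<forall>\<^sub>F x' in at x. min (?a x') (?b x') \<le> (HL U t x' - HL U t x) / (x' - x)"
      "\<forall>\<^sub>F x' in at x. (HL U t x' - HL U t x) / (x' - x) \<le> max (?a x') (?b x')"
      using * by (auto simp: eventually_at_filter intro!: always_eventually)
  qed (use tendsto_min[OF a b] tendsto_max[OF a b] in auto)
  then show ?thesis by (simp add: has_field_derivative_iff)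
qed

lemma AE_HL_deriv:
  assumes "M-lipschitz_on UNIV U" "0 < t"
  shows "AE x in lborel. (HL U t has_real_derivative vel U t x) (at x)"
  using AE_uniq[OF assms] by eventually_elim (rule HL_deriv[OF assms])

text \<open>For the upper bound the minimising line over time \<open>t + h\<close> is cut at its
  intermediate point, both pieces having the same speed \<open>q\<close>. For the lower bound two
  consecutive lines are replaced by one, whose speed is the average of theirs weighted by duration,
  and convexity of \<open>L\<close> applies.\<close>

lemma HL_semigroup:
  assumes lip: "M-lipschitz_on UNIV U" and t: "0 < t" and h: "0 < h"
  shows "HL (HL U t) h x = HL U (t + h) x"
proof (rule antisym)
  have lip': "M-lipschitz_on UNIV (HL U t)" by (rule HL_lipschitz[OF lip t])
  have th: "0 < t + h" using t h by simp
  let ?y = "ymax U (t + h) x"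
  define q where "q = (x - ?y) / (t + h)"
  have q: "x - ?y = (t + h) * q" using th by (simp add: q_def)
  then have y: "?y = x - (t + h) * q" by simp
  have "HL (HL U t) h x \<le> cost (HL U t) h x (x - h * q)" by (rule HL_le[OF lip' h])
  also have "\<dots> = HL U t (x - h * q) + h * L q" using h by (simp add: cost_def)
  also have "\<dots> \<le> cost U t (x - h * q) ?y + h * L q"
    using HL_le[OF lip t, of "x - h * q" ?y] by simp
  also have "\<dots> = U ?y + (t + h) * L q"
  proof -
    have "x - h * q - ?y = t * q" using q by (simp add: algebra_simps)
    then have "(x - h * q - ?y) / t = q" using t by simp
    then show ?thesis using t by (simp add: cost_def algebra_simps)
  qed
  also have "\<dots> = HL U (t + h) x" by (simp add: HL_def cost_def q_def)
  finally show "HL (HL U t) h x \<le> HL U (t + h) x" .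
next
  have th: "0 < t + h" using t h by simp
  let ?z = "ymax (HL U t) h x"
  let ?y = "ymax U t ?z"
  have "HL U (t + h) x \<le> cost U (t + h) x ?y" by (rule HL_le[OF lip th])
  also have "\<dots> = U ?y + (t + h) * L ((x - ?y) / (t + h))" by (simp add: cost_def)
  also have "(x - ?y) / (t + h) = (?z - ?y) / t + h / (t + h) * ((x - ?z) / h - (?z - ?y) / t)"
  proof -
    have "h / (t + h) * ((x - ?z) / h) = (x - ?z) / (t + h)" using h th by simp
    moreover have "(?z - ?y) / t - h / (t + h) * ((?z - ?y) / t) = (?z - ?y) / (t + h)"
    proof -
      have "1 - h / (t + h) = t / (t + h)" using th by (simp add: field_simps)
      moreover have "(?z - ?y) / t - h / (t + h) * ((?z - ?y) / t) = (1 - h / (t + h)) * ((?z - ?y) / t)"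
        by (simp only: left_diff_distrib mult_1)
      ultimately show ?thesis using t by simp
    qed
    moreover have "(x - ?y) / (t + h) = (x - ?z) / (t + h) + (?z - ?y) / (t + h)"
      by (simp flip: add_divide_distrib)
    ultimately show ?thesis unfolding right_diff_distrib by linarith
  qed
  also have "L \<dots> \<le> (1 - h / (t + h)) * L ((?z - ?y) / t) + h / (t + h) * L ((x - ?z) / h)"
    by (rule L_convex) (use t h in auto)
  also have "U ?y + (t + h) * \<dots> = U ?y + t * L ((?z - ?y) / t) + h * L ((x - ?z) / h)"
  proof -
    have "(t + h) * (1 - h / (t + h)) = t" "(t + h) * (h / (t + h)) = h" using th by (auto simp: field_simps)
    then show ?thesis by (simp only: distrib_left mult.assoc[symmetric])
  qed
  also have "\<dots> = HL (HL U t) h x" by (simp add: HL_def cost_def)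
  finally show "HL U (t + h) x \<le> HL (HL U t) h x" using th by simp
qed

text \<open>Monotonicity of \<open>V - U\<close> encodes the order of the derivatives. The feet
  \<open>?a\<close> of \<open>x2\<close> for \<open>V\<close> and \<open>?b\<close> of
  \<open>x1\<close> for \<open>U\<close> serve as competitors for the other function: if
  \<open>?b \<le> ?a\<close>, each at its own point, and monotonicity of \<open>V - U\<close>
  decides; otherwise each at the other point, where the values of \<open>V\<close> and
  \<open>U\<close> cancel and the four-point inequality decides.\<close>

lemma HL_order:
  assumes lipU: "M-lipschitz_on UNIV U" and lipV: "N-lipschitz_on UNIV V" and h: "0 < h"
    and mono: "mono (\<lambda>x. V x - U x)"
  shows "mono (\<lambda>x. HL V h x - HL U h x)"
proof (rule monoI)
  fix x1 x2 :: real assume le: "x1 \<le> x2"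
  let ?a = "ymax V h x2" and ?b = "ymax U h x1"
  have "HL U h x2 + HL V h x1 \<le> HL V h x2 + HL U h x1"
  proof (cases "?b \<le> ?a")
    case True
    then have "V ?b - U ?b \<le> V ?a - U ?a" by (rule monoD[OF mono])
    moreover have "HL U h x2 \<le> cost U h x2 ?a" by (rule HL_le[OF lipU h])
    moreover have "HL V h x1 \<le> cost V h x1 ?b" by (rule HL_le[OF lipV h])
    moreover have "HL V h x2 = cost V h x2 ?a" "HL U h x1 = cost U h x1 ?b" by (auto simp: HL_def)
    ultimately show ?thesis by (simp add: cost_def)
  next
    case False
    have "HL U h x2 \<le> cost U h x2 ?b" by (rule HL_le[OF lipU h])
    moreover have "HL V h x1 \<le> cost V h x1 ?a" by (rule HL_le[OF lipV h])
    moreover have "HL V h x2 = cost V h x2 ?a" "HL U h x1 = cost U h x1 ?b" by (auto simp: HL_def)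
    moreover have "L ((x2 - ?b) / h) + L ((x1 - ?a) / h) \<le> L ((x1 - ?b) / h) + L ((x2 - ?a) / h)"
    proof (cases "x1 = x2")
      case True
      then show ?thesis by simp
    next
      case False
      have "(x1 - ?b) / h < (x1 - ?a) / h" using \<open>\<not> ?b \<le> ?a\<close> h by (simp add: divide_strict_right_mono)
      from L_four_points[OF this, of "(x2 - x1) / h"] False le h show ?thesis
        by (simp add: add_divide_distrib[symmetric])
    qed
    then have "h * (L ((x2 - ?b) / h) + L ((x1 - ?a) / h)) \<le> h * (L ((x1 - ?b) / h) + L ((x2 - ?a) / h))"
      using h by simp
    ultimately show ?thesis by (simp add: cost_def distrib_left)
  qed
  then show "HL V h x1 - HL U h x1 \<le> HL V h x2 - HL U h x2" by simp
qed

text \<open>Constant states persist: equality in Young's inequality occurs at the speed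
  \<open>deriv f k\<close>, so the linear primitive is merely lowered by \<open>h * f k\<close> and
  keeps its slope.\<close>

lemma HL_linear:
  assumes h: "0 < h"
  shows "HL (\<lambda>x. k * x) h x = k * x - h * f k"
proof -
  have lip: "\<bar>k\<bar>-lipschitz_on UNIV (\<lambda>x. k * x)"
    by (rule lipschitz_onI) (auto simp: dist_real_def abs_mult[symmetric] right_diff_distrib[symmetric])
  have c: "cost (\<lambda>x. k * x) h x z = k * x + h * (L ((x - z) / h) - k * ((x - z) / h))" for z
  proof -
    have "h * (k * ((x - z) / h)) = k * (x - z)" using h by simp
    then show ?thesis unfolding cost_def right_diff_distrib by simp
  qed
  have "is_arg (\<lambda>x. k * x) h x (x - h * deriv f k)"
    unfolding is_arg_def c
  proof (intro allI add_left_mono mult_left_mono)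
    fix z
    have "(x - (x - h * deriv f k)) / h = deriv f k" using h by simp
    then show "L ((x - (x - h * deriv f k)) / h) - k * ((x - (x - h * deriv f k)) / h) \<le> L ((x - z) / h) - k * ((x - z) / h)"
      using young[of k "(x - z) / h"] by (simp add: L_f1)
  qed (use h in auto)
  from HL_arg[OF lip h this] have "HL (\<lambda>x. k * x) h x = cost (\<lambda>x. k * x) h x (x - h * deriv f k)" .
  also have "\<dots> = k * x - h * f k" unfolding c using h by (simp add: L_f1 algebra_simps)
  finally show ?thesis .
qed

end

section \<open>Lipschitz functions and primitives\<close>

lemma emeasure_Icc_finite [simp]: "emeasure lborel {a..b::real} < top"
  using emeasure_bounded_finite[of "{a..b}"] by simp

text \<open>The form of dominated convergence behind most limits of integrals below, where a
  constant bound holds on a set of finite measure.\<close>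

lemma bounded_convergence:
  fixes s :: "nat \<Rightarrow> 'a \<Rightarrow> real"
  assumes K: "K \<in> sets M" "emeasure M K < \<infinity>"
    and f: "f \<in> borel_measurable M" and s: "\<And>n. s n \<in> borel_measurable M"
    and bound: "\<And>n. AE x in M. \<bar>s n x\<bar> \<le> B * indicator K x"
    and lim: "AE x in M. (\<lambda>n. s n x) \<longlonglongrightarrow> f x"
  shows "(\<lambda>n. LINT x|M. s n x) \<longlonglongrightarrow> (LINT x|M. f x)"
  by (rule integral_dominated_convergence[where w="\<lambda>x. B * indicator K x"])
    (use assms in auto)

lemma integrable_bounded_support:
  fixes f :: "'a \<Rightarrow> real"
  assumes K: "K \<in> sets M" "emeasure M K < \<infinity>"
    and f: "f \<in> borel_measurable M" and bound: "AE x in M. \<bar>f x\<bar> \<le> B * indicator K x"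
  shows "integrable M f"
  by (rule Bochner_Integration.integrable_bound[of _ "\<lambda>x. B * indicator K x"])
    (use assms in \<open>auto elim!: eventually_mono\<close>)

lemma lborel_integral_shift:
  "(LINT x|lborel. F (x + d)) = (LINT x|lborel. F x)" for F :: "real \<Rightarrow> real"
  using lborel_integral_real_affine[of 1 F d] by (simp add: add.commute)

section \<open>Locally integrable functions and their primitives\<close>

definition loc_int :: "(real \<Rightarrow> real) \<Rightarrow> bool" where
  "loc_int w \<longleftrightarrow> (\<forall>a b. set_integrable lborel {a..b} w)"

definition ess_bounded :: "real \<Rightarrow> (real \<Rightarrow> real) \<Rightarrow> bool" where
  "ess_bounded M w \<longleftrightarrow> w \<in> borel_measurable borel \<and> (AE x in lborel. \<bar>w x\<bar> \<le> M)"

lemma ess_bounded_nonneg: assumes "ess_bounded M w" shows "0 \<le> M"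
proof (rule ccontr)
  assume "\<not> 0 \<le> M"
  then have "AE x in (lborel :: real measure). False"
    using assms by (auto simp: ess_bounded_def elim!: eventually_mono)
  then show False using ae_filter_eq_bot_iff[of "lborel :: real measure"] by (simp add: trivial_limit_def)
qed

lemma ess_bounded_set_integrable:
  assumes "ess_bounded M w" "A \<in> sets borel" "emeasure lborel A < \<infinity>"
  shows "set_integrable lborel A w"
  unfolding set_integrable_def
  by (rule integrable_bounded_support[of A _ _ M])
    (use assms in \<open>auto simp: ess_bounded_def indicator_def elim!: eventually_mono\<close>)

lemma ess_bounded_loc_int: "ess_bounded M w \<Longrightarrow> loc_int w"
  by (auto simp: loc_int_def intro!: ess_bounded_set_integrable emeasure_bounded_finite)

lemma loc_int_set_integrable:
  assumes "loc_int w" "A \<in> sets borel" "A \<subseteq> {a..b}"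
  shows "set_integrable lborel A w"
  by (rule set_integrable_subset[of _ "{a..b}"]) (use assms in \<open>auto simp: loc_int_def\<close>)

lemma loc_int_Ioc: "loc_int w \<Longrightarrow> integrable lborel (\<lambda>x. indicator {a<..b} x * w x)"
  using loc_int_set_integrable[of w "{a<..b}" a b] by (simp add: set_integrable_def subset_eq)

lemma loc_int_endpoints:
  assumes w: "loc_int w"
  shows "(LINT y:{a..b}|lborel. w y) = (LINT y:{a<..b}|lborel. w y)"
    and "(LINT y:{a..<b}|lborel. w y) = (LINT y:{a<..b}|lborel. w y)"
proof -
  have m: "set_borel_measurable lborel A w" if "A \<in> sets borel" "A \<subseteq> {a..b}" for A
    using loc_int_set_integrable[OF w that] by (simp add: set_integrable_def set_borel_measurable_def borel_measurable_integrable)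
  have "AE x in lborel. x \<noteq> a" "AE x in lborel. x \<noteq> b" by (rule AE_lborel_singleton)+
  then have ae: "AE x in lborel. x \<in> {a<..b} \<longleftrightarrow> x \<in> {a..b}" "AE x in lborel. x \<in> {a<..b} \<longleftrightarrow> x \<in> {a..<b}"
    by (eventually_elim, auto)+
  show "(LINT y:{a..b}|lborel. w y) = (LINT y:{a<..b}|lborel. w y)"
    by (rule set_integral_cong_set[OF m m ae(1)]) auto
  show "(LINT y:{a..<b}|lborel. w y) = (LINT y:{a<..b}|lborel. w y)"
    by (rule set_integral_cong_set[OF m m ae(2)]) auto
qed

definition prim :: "(real \<Rightarrow> real) \<Rightarrow> real \<Rightarrow> real" where
  "prim w x = (if 0 \<le> x then LINT y:{0<..x}|lborel. w y else - (LINT y:{x<..0}|lborel. w y))"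

lemma prim_diff:
  assumes w: "loc_int w" and ab: "a \<le> b"
  shows "prim w b - prim w a = (LINT y:{a<..b}|lborel. w y)"
proof -
  have split: "(LINT y:{a<..d}|lborel. w y) = (LINT y:{a<..b}|lborel. w y) + (LINT y:{b<..d}|lborel. w y)"
    if "a \<le> b" "b \<le> d" for a b d
  proof -
    have "{a<..d} = {a<..b} \<union> {b<..d}" using that by auto
    moreover have "set_integrable lborel {a<..b} w" "set_integrable lborel {b<..d} w"
      by (rule loc_int_set_integrable[OF w, of _ a d]; use that in auto)+
    ultimately show ?thesis by (simp add: set_integral_Un)
  qed
  have "(LINT y:{}|lborel. w y) = 0" by (simp add: set_lebesgue_integral_def)
  then show ?thesis
    using split[of 0 a b] split[of a 0 b] split[of a b 0] ab by (auto simp: prim_def)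
qed

lemma prim_lipschitz:
  assumes w: "ess_bounded M w" shows "M-lipschitz_on UNIV (prim w)"
proof (rule lipschitz_onI)
  have *: "\<bar>prim w b - prim w a\<bar> \<le> M * (b - a)" if ab: "a \<le> b" for a b
  proof -
    have "norm (LINT y:{a<..b}|lborel. w y) \<le> (LINT y:{a<..b}|lborel. M)"
      unfolding set_lebesgue_integral_def
    proof (rule order_trans[OF integral_norm_bound integral_mono_AE])
      show "integrable lborel (\<lambda>x. norm (indicat_real {a<..b} x *\<^sub>R w x))"
        using ess_bounded_set_integrable[OF w, of "{a<..b}"] ab by (auto simp: set_integrable_def)
      show "integrable lborel (\<lambda>x. indicat_real {a<..b} x *\<^sub>R M)" using ab by auto
    qed (use w in \<open>auto simp: ess_bounded_def indicator_def elim!: eventually_mono\<close>)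
    then show ?thesis
      using ab by (simp add: prim_diff[OF ess_bounded_loc_int[OF w] ab] set_integral_const mult.commute)
  qed
  show "dist (prim w x) (prim w y) \<le> M * dist x y" for x y
    using *[of x y] *[of y x] by (cases "x \<le> y") (auto simp: dist_real_def abs_minus_commute)
qed (rule ess_bounded_nonneg[OF w])

text \<open>Lebesgue differentiation over intervals with left endpoint \<open>x\<close>. The left
  difference quotients are obtained afterwards by reflecting the line.\<close>

lemma AE_right_mean:
  assumes w: "loc_int w"
  shows "AE x in lborel. ((\<lambda>h. (prim w (x + h) - prim w x) / h) \<longlongrightarrow> w x) (at_right 0)"
proof -
  have "w integrable_on cbox a b" for a b
    using set_borel_integral_eq_integral(1)[OF loc_int_set_integrable[OF w, of "{a..b}" a b]] by simp
  then obtain N where N: "negligible N" "\<And>x e. \<lbrakk>x \<notin> N; 0 < e\<rbrakk> \<Longrightarrow>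
     \<exists>d>0. \<forall>h. 0 < h \<and> h < d \<longrightarrow> norm (integral (cbox x (x + h *\<^sub>R One)) w /\<^sub>R h ^ DIM(real) - w x) < e"
    using integrable_ccontinuous_explicit[of w] by blast
  have "AE x in lebesgue. x \<notin> N"
    using N(1) by (intro AE_not_in) (simp add: negligible_iff_null_sets)
  then have "AE x in lborel. x \<notin> N" by (simp add: AE_completion_iff)
  then show ?thesis
  proof eventually_elim
    fix x assume x: "x \<notin> N"
    show "((\<lambda>h. (prim w (x + h) - prim w x) / h) \<longlongrightarrow> w x) (at_right 0)"
    proof (rule tendstoI)
      fix e :: real assume "0 < e"
      from N(2)[OF x this] obtain d where d: "0 < d"
        "\<And>h. 0 < h \<Longrightarrow> h < d \<Longrightarrow> \<bar>integral {x..x + h} w / h - w x\<bar> < e"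
        by (auto simp: divide_inverse mult.commute)
      have "(prim w (x + h) - prim w x) / h = integral {x..x + h} w / h" if "0 < h" for h
      proof -
        have "set_integrable lborel {x..x + h} w" by (rule loc_int_set_integrable[OF w, of _ x "x + h"]) auto
        then have "integral {x..x + h} w = (LINT y:{x..x + h}|lborel. w y)"
          by (simp add: set_borel_integral_eq_integral(2))
        also have "\<dots> = (LINT y:{x<..x + h}|lborel. w y)"
          by (rule loc_int_endpoints(1)[OF w])
        finally show ?thesis using that by (simp add: prim_diff[OF w])
      qed
      then show "\<forall>\<^sub>F h in at_right 0. dist ((prim w (x + h) - prim w x) / h) (w x) < e"
        using d by (auto simp: eventually_at_right_field dist_real_def intro!: exI[of _ d])
    qed
  qed
qed

lemma AE_uminus:
  fixes P :: "real \<Rightarrow> bool"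
  assumes "AE x in lborel. P x" shows "AE x in lborel. P (- x)"
proof -
  obtain N where N: "N \<in> null_sets lborel" "{x. \<not> P x} \<subseteq> N"
    using assms by (auto simp: eventually_ae_filter)
  have "AE x in lborel. 0 + - 1 * x \<notin> N"
  proof (rule AE_borel_affine)
    have [measurable]: "N \<in> sets borel" using N(1) by auto
    show "Measurable.pred borel (\<lambda>x. x \<notin> N)" by measurable
  qed (use N(1) in \<open>auto intro: AE_not_in\<close>)
  then show ?thesis by eventually_elim (use N(2) in auto)
qed

text \<open>Right-hand means of the reflected function \<open>v\<close> at \<open>- x\<close> are
  left-hand means of \<open>w\<close> at \<open>x\<close>, so both one-sided quotients converge
  almost everywhere.\<close>

theorem AE_prim_deriv:
  assumes w: "loc_int w"
  shows "AE x in lborel. (prim w has_real_derivative w x) (at x)"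
proof -
  define v where "v x = w (- x)" for x
  have seti: "(LINT y:{a<..b}|lborel. v y) = (LINT y:{- b<..- a}|lborel. w y)" for a b
  proof -
    have "(LINT y:{a<..b}|lborel. v y) = (LINT y|lborel. indicator {a<..b} (- y) *\<^sub>R w y)"
      using lborel_integral_real_affine[of "-1" "\<lambda>y. indicator {a<..b} y *\<^sub>R v y" 0]
      by (simp add: set_lebesgue_integral_def v_def)
    also have "\<dots> = (LINT y:{- b..<- a}|lborel. w y)"
      unfolding set_lebesgue_integral_def by (intro Bochner_Integration.integral_cong) (auto simp: indicator_def)
    finally show ?thesis by (simp add: loc_int_endpoints(2)[OF w])
  qed
  have v: "loc_int v"
    unfolding loc_int_def
  proof (intro allI)
    fix a b
    have "integrable lborel (\<lambda>y. indicator {- b..- a} (0 + - 1 * y) *\<^sub>R w (0 + - 1 * y))"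
      using w by (intro lborel_integrable_real_affine) (auto simp: loc_int_def set_integrable_def)
    also have "(\<lambda>y. indicator {- b..- a} (0 + - 1 * y) *\<^sub>R w (0 + - 1 * y)) = (\<lambda>y. indicat_real {a..b} y *\<^sub>R v y)"
      by (auto simp: indicator_def v_def)
    finally show "set_integrable lborel {a..b} v" by (simp add: set_integrable_def)
  qed
  from AE_right_mean[OF w] AE_uminus[OF AE_right_mean[OF v]] show ?thesis
  proof eventually_elim
    case (elim x)
    have "(prim v (- x + h) - prim v (- x)) / h = (prim w (x + - h) - prim w x) / (- h)" if "0 < h" for h
      using prim_diff[OF w, of "x - h" x] prim_diff[OF v, of "- x" "- x + h"] that seti[of "- x" "- x + h"]
      by (simp add: field_simps)
    then have ev: "\<forall>\<^sub>F h in at_right 0. (prim v (- x + h) - prim v (- x)) / h = (prim w (x + - h) - prim w x) / (- h)"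
      unfolding eventually_at_filter by (intro always_eventually) simp
    have "((\<lambda>h. (prim v (- x + h) - prim v (- x)) / h) \<longlongrightarrow> w x) (at_right 0)"
      using elim(2) unfolding v_def by simp
    from Lim_transform_eventually[OF this ev]
    have "((\<lambda>h. (prim w (x + - h) - prim w x) / (- h)) \<longlongrightarrow> w x) (at_right 0)" .
    then have "((\<lambda>h. (prim w (x + h) - prim w x) / h) \<longlongrightarrow> w x) (at_left 0)"
      by (simp add: filterlim_at_left_to_right[of _ _ 0])
    with elim(1) show ?case by (simp add: DERIV_def filterlim_split_at)
  qed
qed

section \<open>Calculus for Lipschitz functions\<close>

lemma lipschitz_borel:
  fixes F :: "real \<Rightarrow> real"
  assumes "M-lipschitz_on UNIV F" shows "F \<in> borel_measurable borel"
  by (rule borel_measurable_continuous_onI[OF lipschitz_on_continuous_on[OF assms]])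

text \<open>Difference quotients of \<open>F\<close> are bounded by \<open>M\<close>, so that integration by parts passes to the
  limit by dominated convergence.\<close>

lemma lipschitz_ibp:
  fixes F F' \<phi> \<phi>' :: "real \<Rightarrow> real"
  assumes lip: "M-lipschitz_on UNIV F" and F': "AE x in lborel. (F has_real_derivative F' x) (at x)"
    and [measurable]: "F' \<in> borel_measurable borel"
    and \<phi>: "\<And>x. (\<phi> has_real_derivative \<phi>' x) (at x)" "\<And>x. \<bar>\<phi>' x\<bar> \<le> B" "\<And>x. R \<le> \<bar>x\<bar> \<Longrightarrow> \<phi> x = 0" "0 \<le> R"
  shows "(LINT x|lborel. F' x * \<phi> x) = - (LINT x|lborel. F x * \<phi>' x)"
proof -
  note [measurable] = lipschitz_borel[OF lip]
  have \<phi>c: "continuous_on UNIV \<phi>"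
    using \<phi>(1) by (meson DERIV_isCont continuous_at_imp_continuous_on)
  then have [measurable]: "\<phi> \<in> borel_measurable borel" by (rule borel_measurable_continuous_onI)
  have M0: "0 \<le> M" using lip by (rule lipschitz_on_nonneg)
  have B0: "0 \<le> B" using \<phi>(2)[of 0] by linarith
  have bdd: "\<exists>C. \<forall>x\<in>{a..b}. \<bar>f x\<bar> \<le> C" if "continuous_on UNIV f" for f :: "real \<Rightarrow> real" and a b
    using compact_imp_bounded[OF compact_continuous_image[OF continuous_on_subset[OF that] compact_Icc], of a b]
    by (auto simp: bounded_iff)
  obtain C where C: "\<And>x. x \<in> {- R..R} \<Longrightarrow> \<bar>\<phi> x\<bar> \<le> C"
    using bdd[OF \<phi>c, of "- R" R] by blast
  obtain D where D: "\<And>x. x \<in> {- R - 1..R + 1} \<Longrightarrow> \<bar>F x\<bar> \<le> D"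
    using bdd[OF lipschitz_on_continuous_on[OF lip], of "- R - 1" "R + 1"] by blast
  have \<phi>0: "\<phi> x = 0" if "x \<notin> {- R..R}" for x using \<phi>(3)[of x] that by auto
  have \<phi>lip: "\<bar>\<phi> x - \<phi> y\<bar> \<le> B * \<bar>x - y\<bar>" for x y
    using field_differentiable_bound[of UNIV \<phi> \<phi>' B x y] \<phi>(1,2) by auto
  define h where "h n = inverse (real (Suc n))" for n
  have h: "0 < h n" "h n \<le> 1" for n by (auto simp: h_def field_simps)
  have h0: "filterlim h (at 0) sequentially"
    using LIMSEQ_inverse_real_of_nat h(1) by (auto simp: filterlim_at h_def[abs_def] eventually_sequentially)
  have 1: "(\<lambda>n. LINT x|lborel. (F (x + h n) - F x) / h n * \<phi> x) \<longlonglongrightarrow> (LINT x|lborel. F' x * \<phi> x)"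
  proof (rule bounded_convergence[of "{- R..R}" _ _ _ "M * C"])
    show "AE x in lborel. \<bar>(F (x + h n) - F x) / h n * \<phi> x\<bar> \<le> M * C * indicator {- R..R} x" for n
    proof (rule AE_I2)
      fix x
      have "\<bar>F (x + h n) - F x\<bar> \<le> M * h n" using lipschitz_real[OF lip, of "x + h n" x] h[of n] by simp
      then have "\<bar>(F (x + h n) - F x) / h n\<bar> \<le> M" using h(1)[of n] by (simp add: abs_divide divide_le_eq)
      then show "\<bar>(F (x + h n) - F x) / h n * \<phi> x\<bar> \<le> M * C * indicator {- R..R} x"
      proof (cases "x \<in> {- R..R}")
        case True
        then show ?thesis
          using mult_mono[OF \<open>\<bar>(F (x + h n) - F x) / h n\<bar> \<le> M\<close> C[OF True]] M0 unfolding abs_mult by simp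
      qed (use \<phi>0[of x] in simp)
    qed
    show "AE x in lborel. (\<lambda>n. (F (x + h n) - F x) / h n * \<phi> x) \<longlonglongrightarrow> F' x * \<phi> x"
      using F'
    proof eventually_elim
      case (elim x)
      then show ?case
        by (intro tendsto_intros) (use filterlim_compose[OF _ h0] in \<open>auto simp: DERIV_def\<close>)
    qed
  qed (auto intro!: emeasure_bounded_finite)
  \<comment> \<open>The quotients of \<open>\<phi>\<close> are taken backwards because shifting the
    variable of integration moves a forward increment of \<open>F\<close> onto a backward one of
    \<open>\<phi>\<close>. The interval grows by 1, an upper bound for the shifts.\<close>
  have 2: "(\<lambda>n. LINT x|lborel. F x * ((\<phi> (x + - h n) - \<phi> x) / (- h n))) \<longlonglongrightarrow> (LINT x|lborel. F x * \<phi>' x)"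
  proof (rule bounded_convergence[of "{- R - 1..R + 1}" _ _ _ "D * B"])
    have "(\<lambda>n. (\<phi> (x + - h n) - \<phi> x) / (- h n)) \<longlonglongrightarrow> \<phi>' x" for x
    proof -
      have "filterlim (\<lambda>n. - h n) (at 0) sequentially"
        using tendsto_minus[of h 0 sequentially] h0 h(1) by (auto simp: filterlim_at less_le)
      from filterlim_compose[OF \<phi>(1)[of x, unfolded DERIV_def] this] show ?thesis by simp
    qed
    note lim = this
    show "AE x in lborel. (\<lambda>n. F x * ((\<phi> (x + - h n) - \<phi> x) / (- h n))) \<longlonglongrightarrow> F x * \<phi>' x"
      by (intro AE_I2 tendsto_mult tendsto_const lim)
    have "\<phi>' \<in> borel_measurable borel"
      by (rule borel_measurable_LIMSEQ_real[OF lim]) measurable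
    then show "(\<lambda>x. F x * \<phi>' x) \<in> borel_measurable lborel" by measurable
    show "AE x in lborel. \<bar>F x * ((\<phi> (x + - h n) - \<phi> x) / (- h n))\<bar> \<le> D * B * indicator {- R - 1..R + 1} x" for n
    proof (rule AE_I2)
      fix x
      have q: "\<bar>(\<phi> (x + - h n) - \<phi> x) / (- h n)\<bar> \<le> B"
        using \<phi>lip[of "x + - h n" x] h(1)[of n] by (simp add: abs_divide divide_le_eq)
      show "\<bar>F x * ((\<phi> (x + - h n) - \<phi> x) / (- h n))\<bar> \<le> D * B * indicator {- R - 1..R + 1} x"
      proof (cases "x \<in> {- R - 1..R + 1}")
        case True
        have "0 \<le> D" using D[OF True] by linarith
        then show ?thesis using mult_mono[OF D[OF True] q] True unfolding abs_mult by simp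
      next
        case False
        then have "\<phi> (x + - h n) = 0" "\<phi> x = 0" using h[of n] by (auto intro!: \<phi>0)
        then show ?thesis using False by simp
      qed
    qed
  qed (auto intro!: emeasure_bounded_finite)
  have "(LINT x|lborel. (F (x + h n) - F x) / h n * \<phi> x) = - (LINT x|lborel. F x * ((\<phi> (x + - h n) - \<phi> x) / (- h n)))" for n
  proof -
    have i: "integrable lborel (\<lambda>x. F (x + d) * \<phi> (x + e))" if "\<bar>d\<bar> \<le> 1" "\<bar>e\<bar> \<le> 1" "\<bar>d - e\<bar> \<le> 1" for d e
    proof (rule integrable_bounded_support[of "{- R - 1..R + 1}" _ _ "D * C"])
      show "AE x in lborel. \<bar>F (x + d) * \<phi> (x + e)\<bar> \<le> D * C * indicator {- R - 1..R + 1} x"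
      proof (rule AE_I2)
        fix x
        show "\<bar>F (x + d) * \<phi> (x + e)\<bar> \<le> D * C * indicator {- R - 1..R + 1} x"
        proof (cases "x + e \<in> {- R..R}")
          case True
          then have d: "x + d \<in> {- R - 1..R + 1}" and x: "x \<in> {- R - 1..R + 1}"
            using that by (auto simp: abs_le_iff)
          then show ?thesis using mult_mono[OF D[OF d] C[OF True]] D[OF d] unfolding abs_mult by simp
        next
          case False
          have "0 \<le> D * C" if "x \<in> {- R - 1..R + 1}"
          proof -
            have "0 \<in> {- R..R}" using \<phi>(4) by auto
            then have "0 \<le> C" "0 \<le> D" using C[of 0] D[of 0] by auto
            then show ?thesis by simp
          qed
          then show ?thesis using \<phi>0[OF False] by (simp add: indicator_def)
        qed
      qed
    qed (auto intro!: emeasure_bounded_finite)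
    have "(LINT x|lborel. F (x + h n) * \<phi> x) = (LINT x|lborel. F x * \<phi> (x + - h n))"
      using lborel_integral_shift[of "\<lambda>x. F x * \<phi> (x - h n)" "h n"] by simp
    moreover have "(LINT x|lborel. (F (x + h n) - F x) / h n * \<phi> x)
        = ((LINT x|lborel. F (x + h n) * \<phi> x) - (LINT x|lborel. F x * \<phi> x)) / h n"
    proof -
      have "(LINT x|lborel. (F (x + h n) - F x) / h n * \<phi> x) = (LINT x|lborel. (F (x + h n) * \<phi> x - F x * \<phi> x) / h n)"
        by (simp add: left_diff_distrib)
      also have "\<dots> = (LINT x|lborel. F (x + h n) * \<phi> x - F x * \<phi> x) / h n"
        by (rule integral_divide_zero)
      also have "(LINT x|lborel. F (x + h n) * \<phi> x - F x * \<phi> x)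
          = (LINT x|lborel. F (x + h n) * \<phi> x) - (LINT x|lborel. F x * \<phi> x)"
        using i[of "h n" 0] i[of 0 0] h[of n] by (intro Bochner_Integration.integral_diff) auto
      finally show ?thesis .
    qed
    moreover have "(LINT x|lborel. F x * ((\<phi> (x + - h n) - \<phi> x) / (- h n)))
        = ((LINT x|lborel. F x * \<phi> (x + - h n)) - (LINT x|lborel. F x * \<phi> x)) / (- h n)"
    proof -
      have "(LINT x|lborel. F x * ((\<phi> (x + - h n) - \<phi> x) / (- h n)))
          = (LINT x|lborel. (F x * \<phi> (x + - h n) - F x * \<phi> x) / (- h n))"
        by (simp only: right_diff_distrib times_divide_eq_right)
      also have "\<dots> = (LINT x|lborel. (F x * \<phi> (x + - h n) - F x * \<phi> x)) / (- h n)"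
        by (rule integral_divide_zero)
      also have "(LINT x|lborel. (F x * \<phi> (x + - h n) - F x * \<phi> x))
          = (LINT x|lborel. F x * \<phi> (x + - h n)) - (LINT x|lborel. F x * \<phi> x)"
        using i[of 0 "- h n"] i[of 0 0] h[of n] by (intro Bochner_Integration.integral_diff) auto
      finally show ?thesis .
    qed
    ultimately show ?thesis by (simp only: divide_minus_right minus_minus)
  qed
  note eq = this
  have "(\<lambda>n. - (LINT x|lborel. F x * ((\<phi> (x + - h n) - \<phi> x) / (- h n)))) \<longlonglongrightarrow> (LINT x|lborel. F' x * \<phi> x)"
    using 1 unfolding eq .
  from LIMSEQ_unique[OF this tendsto_minus[OF 2]] show ?thesis .
qed

text \<open>The integral of a difference quotient of \<open>F\<close> telescopes to the mean of
  \<open>F\<close> just right of \<open>b\<close> minus the mean just right of \<open>a\<close>.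
  These means converge by Lipschitz continuity, the integrals of the quotients by bounded
  convergence.\<close>

lemma lipschitz_ftc:
  fixes F F' :: "real \<Rightarrow> real"
  assumes lip: "M-lipschitz_on UNIV F" and F': "AE x in lborel. (F has_real_derivative F' x) (at x)"
    and [measurable]: "F' \<in> borel_measurable borel" and ab: "a \<le> b"
  shows "(LINT x:{a<..b}|lborel. F' x) = F b - F a"
proof -
  note [measurable] = lipschitz_borel[OF lip]
  have M0: "0 \<le> M" using lip by (rule lipschitz_on_nonneg)
  have F: "loc_int F"
    using borel_integrable_atLeastAtMost'[OF continuous_on_subset[OF lipschitz_on_continuous_on[OF lip]]]
    by (auto simp: loc_int_def)
  define h where "h n = inverse (real (Suc n))" for n
  have h: "0 < h n" "h n \<le> 1" for n by (auto simp: h_def field_simps)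
  have hl: "h \<longlonglongrightarrow> 0" unfolding h_def[abs_def] by (rule LIMSEQ_inverse_real_of_nat)
  then have h0: "filterlim h (at 0) sequentially"
    using h(1) by (auto simp: filterlim_at less_le)
  have 1: "(\<lambda>n. LINT x|lborel. indicator {a<..b} x * ((F (x + h n) - F x) / h n)) \<longlonglongrightarrow> (LINT x|lborel. indicator {a<..b} x * F' x)"
  proof (rule bounded_convergence[of "{a<..b}" _ _ _ M])
    show "AE x in lborel. \<bar>indicator {a<..b} x * ((F (x + h n) - F x) / h n)\<bar> \<le> M * indicator {a<..b} x" for n
    proof (rule AE_I2)
      fix x
      have "\<bar>F (x + h n) - F x\<bar> \<le> M * h n" using lipschitz_real[OF lip, of "x + h n" x] h[of n] by simp
      then show "\<bar>indicator {a<..b} x * ((F (x + h n) - F x) / h n)\<bar> \<le> M * indicator {a<..b} x"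
        using h(1)[of n] by (simp add: abs_divide divide_le_eq indicator_def)
    qed
    show "AE x in lborel. (\<lambda>n. indicator {a<..b} x * ((F (x + h n) - F x) / h n)) \<longlonglongrightarrow> indicator {a<..b} x * F' x"
      using F'
    proof eventually_elim
      case (elim x)
      then show ?case
        by (intro tendsto_intros) (use filterlim_compose[OF _ h0] in \<open>auto simp: DERIV_def\<close>)
    qed
  qed (use ab in auto)
  have mean: "\<bar>(LINT x:{y<..y + d}|lborel. F x) / d - F y\<bar> \<le> M * d" if d: "0 < d" for y d
  proof -
    have i: "set_integrable lborel {y<..y + d} F" by (rule loc_int_set_integrable[OF F, of _ y "y + d"]) auto
    have "\<bar>LINT x:{y<..y + d}|lborel. F x - F y\<bar> \<le> (LINT x:{y<..y + d}|lborel. M * d)"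
      unfolding set_lebesgue_integral_def
    proof (rule order_trans[OF integral_abs_bound integral_mono_AE])
      show "integrable lborel (\<lambda>x. \<bar>indicat_real {y<..y + d} x *\<^sub>R (F x - F y)\<bar>)"
        using i d unfolding scaleR_diff_right
        by (intro integrable_abs Bochner_Integration.integrable_diff) (auto simp: set_integrable_def)
      show "AE x in lborel. \<bar>indicat_real {y<..y + d} x *\<^sub>R (F x - F y)\<bar> \<le> indicat_real {y<..y + d} x *\<^sub>R (M * d)"
      proof (rule AE_I2)
        fix x
        have "M * \<bar>x - y\<bar> \<le> M * d" if "x \<in> {y<..y + d}" using that M0 by (intro mult_left_mono) auto
        then show "\<bar>indicat_real {y<..y + d} x *\<^sub>R (F x - F y)\<bar> \<le> indicat_real {y<..y + d} x *\<^sub>R (M * d)"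
          using lipschitz_real[OF lip, of x y] by (auto simp: indicator_def)
      qed
    qed (use d in auto)
    moreover have "(LINT x:{y<..y + d}|lborel. F x - F y) = (LINT x:{y<..y + d}|lborel. F x) - d * F y"
      using i d by (subst set_integral_diff) (auto simp: set_integral_const set_integrable_def)
    ultimately have "\<bar>(LINT x:{y<..y + d}|lborel. F x) - d * F y\<bar> \<le> M * d * d"
      using d by (simp add: set_integral_const mult_ac)
    then have "\<bar>(LINT x:{y<..y + d}|lborel. F x) - d * F y\<bar> / d \<le> M * d"
      by (simp only: pos_divide_le_eq[OF d])
    moreover have "(LINT x:{y<..y + d}|lborel. F x) / d - F y = ((LINT x:{y<..y + d}|lborel. F x) - d * F y) / d"
      using d by (simp add: field_simps)
    ultimately show ?thesis using d by (simp add: abs_divide)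
  qed
  have lim_mean: "(\<lambda>n. (LINT x:{y<..y + h n}|lborel. F x) / h n) \<longlonglongrightarrow> F y" for y
  proof -
    have "(\<lambda>n. (LINT x:{y<..y + h n}|lborel. F x) / h n - F y) \<longlonglongrightarrow> 0"
      by (rule Lim_null_comparison[OF _ tendsto_mult_right_zero[OF hl, of M]]) (use mean h in auto)
    then show ?thesis by (rule LIM_zero_cancel)
  qed
  have "(LINT x|lborel. indicator {a<..b} x * ((F (x + h n) - F x) / h n))
      = (LINT x:{b<..b + h n}|lborel. F x) / h n - (LINT x:{a<..a + h n}|lborel. F x) / h n" for n
  proof -
    let ?d = "h n"
    have ii: "integrable lborel (\<lambda>x. indicator {a<..b} x * F x)"
      by (rule loc_int_Ioc[OF F])
    have ish: "integrable lborel (\<lambda>x. indicator {a<..b} x * F (x + ?d))"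
    proof -
      have "integrable lborel (\<lambda>x. indicator {a + ?d<..b + ?d} (?d + 1 * x) * F (?d + 1 * x))"
        by (intro lborel_integrable_real_affine loc_int_Ioc[OF F]) simp
      also have "(\<lambda>x. indicator {a + ?d<..b + ?d} (?d + 1 * x) * F (?d + 1 * x)) = (\<lambda>x. indicator {a<..b} x * F (x + ?d))"
        by (auto simp: indicator_def add.commute)
      finally show ?thesis .
    qed
    have "(LINT x|lborel. indicator {a<..b} x * F (x + ?d)) = (LINT x|lborel. indicator {a + ?d<..b + ?d} x * F x)"
      using lborel_integral_shift[of "\<lambda>x. indicator {a + ?d<..b + ?d} x * F x" ?d] by (simp add: indicator_def)
    also have "\<dots> = prim F (b + ?d) - prim F (a + ?d)"
      using prim_diff[OF F, of "a + ?d" "b + ?d"] ab by (simp add: set_lebesgue_integral_def)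
    finally have "(LINT x|lborel. indicator {a<..b} x * F (x + ?d)) = prim F (b + ?d) - prim F (a + ?d)" .
    moreover have "(LINT x|lborel. indicator {a<..b} x * F x) = prim F b - prim F a"
      using prim_diff[OF F ab] by (simp add: set_lebesgue_integral_def)
    moreover have "(LINT x|lborel. indicator {a<..b} x * ((F (x + ?d) - F x) / ?d))
       = ((LINT x|lborel. indicator {a<..b} x * F (x + ?d)) - (LINT x|lborel. indicator {a<..b} x * F x)) / ?d"
    proof -
      have "(LINT x|lborel. indicator {a<..b} x * ((F (x + ?d) - F x) / ?d))
          = (LINT x|lborel. (indicator {a<..b} x * F (x + ?d) - indicator {a<..b} x * F x) / ?d)"
        by (simp only: right_diff_distrib times_divide_eq_right)
      also have "\<dots> = (LINT x|lborel. (indicator {a<..b} x * F (x + ?d) - indicator {a<..b} x * F x)) / ?d"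
        by (rule integral_divide_zero)
      also have "(LINT x|lborel. (indicator {a<..b} x * F (x + ?d) - indicator {a<..b} x * F x))
          = (LINT x|lborel. indicator {a<..b} x * F (x + ?d)) - (LINT x|lborel. indicator {a<..b} x * F x)"
        by (intro Bochner_Integration.integral_diff ish ii)
      finally show ?thesis .
    qed
    ultimately show ?thesis
      using prim_diff[OF F, of b "b + ?d"] prim_diff[OF F, of a "a + ?d"] h(1)[of n]
      by (simp add: diff_divide_distrib[symmetric])
  qed
  with 1 have "(\<lambda>n. (LINT x:{b<..b + h n}|lborel. F x) / h n - (LINT x:{a<..a + h n}|lborel. F x) / h n)
     \<longlonglongrightarrow> (LINT x|lborel. indicator {a<..b} x * F' x)" by simp
  from LIMSEQ_unique[OF this tendsto_diff[OF lim_mean lim_mean]] show ?thesis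
    by (simp add: set_lebesgue_integral_def)
qed

section \<open>The solution given by the Hopf-Lax formula\<close>

context convex_flux
begin

text \<open>The foot with speed \<open>deriv f p\<close> bounds \<open>HL U h x\<close> from above,
  and \<open>young_strong\<close> at the true minimiser bounds it from below with the quadratic
  defect to spare. The two bounds differ by \<open>2 * e * h\<close>, so the defect is at most
  \<open>2 * e\<close>: one estimate controls the value and the velocity.\<close>

lemma HL_small_time:
  assumes lip: "M-lipschitz_on UNIV U" and D: "(U has_real_derivative p) (at x)" and e: "0 < e"
  shows "\<forall>\<^sub>F h in at_right 0. \<bar>HL U h x - U x + h * f p\<bar> \<le> e * h \<and> c / 2 * (vel U h x - p)\<^sup>2 \<le> 2 * e"
proof -
  \<comment> \<open>\<open>B\<close> bounds the speeds of all minimisers as well as the test speed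
    \<open>deriv f p\<close>, so every foot in play lies within \<open>h * B\<close> of
    \<open>x\<close>.\<close>
  define B where "B = max (max \<bar>deriv f M\<bar> \<bar>deriv f (- M)\<bar>) \<bar>deriv f p\<bar>"
  have B0: "0 \<le> B" by (auto simp: B_def)
  have "\<exists>d>0. \<forall>k. \<bar>k\<bar> < d \<longrightarrow> \<bar>U (x + k) - U x - k * p\<bar> \<le> e / (B + 1) * \<bar>k\<bar>"
  proof -
    have "0 < e / (B + 1)" using e B0 by simp
    moreover have "(U has_derivative (\<lambda>h. h * p)) (at x)" using D by (simp add: has_field_derivative_def mult_commute_abs)
    ultimately obtain d where "d > 0" and d: "\<And>y. norm (y - x) < d \<Longrightarrow> norm (U y - U x - (y - x) * p) \<le> e / (B + 1) * norm (y - x)"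
      unfolding has_derivative_at_alt by blast
    have "\<bar>U (x + k) - U x - k * p\<bar> \<le> e / (B + 1) * \<bar>k\<bar>" if "\<bar>k\<bar> < d" for k
      using d[of "x + k"] that by simp
    with \<open>d > 0\<close> show ?thesis by blast
  qed
  then obtain d where d: "0 < d" "\<And>k. \<bar>k\<bar> < d \<Longrightarrow> \<bar>U (x + k) - U x - k * p\<bar> \<le> e / (B + 1) * \<bar>k\<bar>"
    by blast
  have "\<bar>HL U h x - U x + h * f p\<bar> \<le> e * h \<and> c / 2 * (vel U h x - p)\<^sup>2 \<le> 2 * e"
    if h: "0 < h" "h < d / (B + 1)" for h
  proof -
    have U: "\<bar>U (x - h * q) - U x + h * q * p\<bar> \<le> e * h" if "\<bar>q\<bar> \<le> B" for q
    proof -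
      have hq: "\<bar>- (h * q)\<bar> \<le> h * B" using that h by (simp add: abs_mult)
      also have "\<dots> \<le> h * (B + 1)" using h by simp
      also have "\<dots> < d" using h B0 by (simp add: field_simps)
      finally have "\<bar>U (x - h * q) - U x + h * q * p\<bar> \<le> e / (B + 1) * \<bar>- (h * q)\<bar>"
        using d(2)[of "- (h * q)"] by simp
      also have "\<dots> \<le> e / (B + 1) * (h * (B + 1))"
        using hq h e B0 by (intro mult_left_mono) (auto simp: algebra_simps)
      also have "\<dots> = e * h" using B0 by simp
      finally show ?thesis .
    qed
    have c: "cost U h x (x - h * q) = U (x - h * q) + h * L q" for q using h by (simp add: cost_def)
    have "HL U h x \<le> cost U h x (x - h * deriv f p)" by (rule HL_le[OF lip h(1)])
    then have 1: "HL U h x \<le> U x - h * f p + e * h"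
      using U[of "deriv f p"] by (simp add: c B_def L_f1 algebra_simps)
    define q where "q = (x - ymax U h x) / h"
    have y: "ymax U h x = x - h * q" using h by (simp add: q_def)
    have q: "\<bar>q\<bar> \<le> B"
      using arg_bounds[OF lip h(1) is_arg_ymax[OF lip h(1)], of x] by (auto simp: q_def B_def)
    have vel: "vel U h x = g q" by (simp add: vel_def q_def)
    have "h * (p * q - f p + c / 2 * (g q - p)\<^sup>2) \<le> h * L q"
      using young_strong[of p q] h by simp
    moreover have "HL U h x = U (x - h * q) + h * L q" by (simp add: HL_def y c)
    ultimately have 2: "U x - h * f p - e * h + h * (c / 2 * (vel U h x - p)\<^sup>2) \<le> HL U h x"
      using U[OF q] by (simp add: vel algebra_simps)
    have "0 \<le> h * (c / 2 * (vel U h x - p)\<^sup>2)" using h c_pos by simp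
    moreover have "h * (c / 2 * (vel U h x - p)\<^sup>2) \<le> h * (2 * e)" using 1 2 by (simp add: algebra_simps)
    then have "c / 2 * (vel U h x - p)\<^sup>2 \<le> 2 * e" by (simp only: mult_le_cancel_left_pos[OF h(1)])
    ultimately show ?thesis using 1 2 by (auto simp: abs_le_iff)
  qed
  then show ?thesis
    using d(1) B0 by (auto simp: eventually_at_right_field intro!: exI[of _ "d / (B + 1)"])
qed

lemma HL_quotient_tendsto:
  assumes lip: "M-lipschitz_on UNIV U" and D: "(U has_real_derivative p) (at x)"
  shows "((\<lambda>h. (HL U h x - U x) / h) \<longlongrightarrow> - f p) (at_right 0)"
proof (rule tendstoI)
  fix e :: real assume e: "0 < e"
  have "\<forall>\<^sub>F h::real in at_right 0. 0 < h" by (rule eventually_at_right_less)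
  moreover have "\<forall>\<^sub>F h in at_right 0. \<bar>HL U h x - U x + h * f p\<bar> \<le> e / 2 * h \<and> c / 2 * (vel U h x - p)\<^sup>2 \<le> 2 * (e / 2)"
    using HL_small_time[OF lip D, of "e / 2"] e by simp
  ultimately show "\<forall>\<^sub>F h in at_right 0. dist ((HL U h x - U x) / h) (- f p) < e"
  proof eventually_elim
    case h: (elim h)
    have "(HL U h x - U x) / h - (- f p) = (HL U h x - U x + h * f p) / h" using h by (simp add: field_simps)
    then have "\<bar>(HL U h x - U x) / h - (- f p)\<bar> \<le> e / 2"
      using h by (simp add: abs_divide pos_divide_le_eq)
    then show "dist ((HL U h x - U x) / h) (- f p) < e" using e by (simp add: dist_real_def)
  qed
qed

lemma vel_tendsto_initial:
  assumes lip: "M-lipschitz_on UNIV U" and D: "(U has_real_derivative p) (at x)"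
  shows "((\<lambda>h. vel U h x) \<longlongrightarrow> p) (at_right 0)"
proof (rule tendstoI)
  fix e :: real assume e: "0 < e"
  \<comment> \<open>With this tolerance \<open>HL_small_time\<close> gives
    \<open>(vel U h x - p)\<^sup>2 \<le> e\<^sup>2 / 2\<close>, strictly below the square of
    \<open>e\<close>.\<close>
  define d where "d = c * e\<^sup>2 / 8"
  have d: "0 < d" using e c_pos by (simp add: d_def)
  from HL_small_time[OF lip D d] show "\<forall>\<^sub>F h in at_right 0. dist (vel U h x) p < e"
  proof eventually_elim
    case (elim h)
    then have "c * (vel U h x - p)\<^sup>2 \<le> c * (e\<^sup>2 / 2)" by (simp add: d_def)
    then have "(vel U h x - p)\<^sup>2 \<le> e\<^sup>2 / 2" using c_pos by (simp only: mult_le_cancel_left_pos)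
    also have "\<dots> < e\<^sup>2" using e by simp
    finally have "\<bar>vel U h x - p\<bar>\<^sup>2 < e\<^sup>2" by simp
    then have "\<bar>vel U h x - p\<bar> < e" by (rule power2_less_imp_less) (use e in simp)
    then show ?case using e by (simp add: dist_real_def)
  qed
qed

section \<open>The candidate solution and its continuity in time\<close>

definition sol :: "(real \<Rightarrow> real) \<Rightarrow> real \<times> real \<Rightarrow> real" where
  "sol w z = (if 0 < fst z then vel (prim w) (fst z) (snd z) else w (snd z))"

lemma sol_pos: "0 < t \<Longrightarrow> sol w (t, x) = vel (prim w) t x"
  by (simp add: sol_def)

lemma ess_bounded_sol:
  assumes "ess_bounded M w" shows "ess_bounded M (\<lambda>x. sol w (t, x))"
proof (cases "0 < t")
  case True
  with vel_borel_slice[OF prim_lipschitz[OF assms] True] vel_bound[OF prim_lipschitz[OF assms] True]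
  show ?thesis by (simp add: ess_bounded_def sol_pos)
qed (use assms in \<open>simp add: sol_def\<close>)

lemma sol_borel:
  assumes w: "ess_bounded M w" shows "sol w \<in> borel_measurable borel"
proof -
  define A where "A = (\<lambda>z. if 0 < fst z then vel (prim w) (fst z) (snd z) else 0)"
  have [measurable]: "A \<in> borel_measurable (borel \<Otimes>\<^sub>M borel)" "w \<in> borel_measurable borel"
    using vel_borel[OF prim_lipschitz[OF w]] w unfolding A_def borel_prod by (auto simp: ess_bounded_def)
  have "(\<lambda>z. if 0 < fst z then A z else w (snd z)) \<in> borel_measurable (borel \<Otimes>\<^sub>M borel)" by measurable
  also have "(\<lambda>z. if 0 < fst z then A z else w (snd z)) = sol w" by (auto simp: A_def sol_def)
  finally show ?thesis by (simp only: borel_prod)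
qed

lemma isCont_sol:
  assumes w: "ess_bounded M w" and t: "0 < t" and uq: "uniq (prim w) t x"
  shows "isCont (sol w) (t, x)"
proof -
  have "\<forall>\<^sub>F z in nhds (t, x). z \<in> {z. 0 < fst z}"
    using t by (intro eventually_nhds_in_open open_Collect_less continuous_intros) auto
  then have "\<forall>\<^sub>F z in nhds (t, x). sol w z = vel (prim w) (fst z) (snd z)"
    by eventually_elim (simp add: sol_def)
  then show ?thesis using isCont_vel[OF prim_lipschitz[OF w] t uq] by (simp add: isCont_cong)
qed

text \<open>For positive \<open>t\<close>, convergence holds wherever the minimiser is unique; for
  \<open>t = 0\<close>, wherever the primitive has derivative \<open>w x\<close>.\<close>

lemma AE_sol_tendsto:
  assumes w: "ess_bounded M w" and t: "0 \<le> t" and X: "X \<longlonglongrightarrow> t" "\<And>n. 0 < X n"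
  shows "AE x in lborel. (\<lambda>n. sol w (X n, x)) \<longlonglongrightarrow> sol w (t, x)"
proof (cases "t = 0")
  case False
  then have t: "0 < t" using t by simp
  show ?thesis using AE_uniq[OF prim_lipschitz[OF w] t]
  proof eventually_elim
    case (elim x)
    show ?case
      by (rule isCont_tendsto_compose[OF isCont_sol[OF w t elim]]) (intro tendsto_intros X)
  qed
next
  case True
  show ?thesis using AE_prim_deriv[OF ess_bounded_loc_int[OF w]]
  proof eventually_elim
    case (elim x)
    have "X n \<noteq> 0" for n using X(2)[of n] by simp
    then have "filterlim X (at_right 0) sequentially"
      using X True by (simp add: filterlim_at)
    from filterlim_compose[OF vel_tendsto_initial[OF prim_lipschitz[OF w] elim] this]
    show ?case using True X(2) by (simp add: sol_def)
  qed
qed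

lemma C0_L1loc_sol:
  assumes w: "ess_bounded M w" shows "C0_L1loc {0..T} (sol w)"
  unfolding C0_L1loc_def
proof (intro conjI ballI allI impI)
  fix t K assume K: "compact (K :: real set)"
  then have K': "K \<in> sets borel" "emeasure lborel K < \<infinity>"
    using emeasure_compact_finite[OF K] by (auto intro: borel_compact)
  show "set_integrable lborel K (\<lambda>x. sol w (t, x))"
    by (rule ess_bounded_set_integrable[OF ess_bounded_sol[OF w] K'])
  assume t: "t \<in> {0..T}"
  have [measurable]: "(\<lambda>x. sol w (s, x)) \<in> borel_measurable borel" for s
    using ess_bounded_sol[OF w, of s] by (simp add: ess_bounded_def)
  have [measurable]: "K \<in> sets borel" by (rule K')
  show "((\<lambda>s. LINT x:K|lborel. \<bar>sol w (s, x) - sol w (t, x)\<bar>) \<longlongrightarrow> 0) (at t within {0..T})"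
    unfolding tendsto_at_iff_sequentially comp_def
  proof (intro allI impI)
    fix X assume X: "\<forall>i. X i \<in> {0..T} - {t}" "X \<longlonglongrightarrow> t"
    have M0: "0 \<le> M" using w by (rule ess_bounded_nonneg)
    have "\<exists>N. \<forall>n\<ge>N. 0 < X n"
    proof (cases "t = 0")
      case True
      then show ?thesis using X(1) by (auto simp: less_le)
    next
      case False
      then have "\<forall>\<^sub>F n in sequentially. 0 < X n" using order_tendstoD(1)[OF X(2)] t by auto
      then show ?thesis by (simp add: eventually_sequentially)
    qed
    then obtain N where "\<forall>n\<ge>N. 0 < X n" by blast
    then have N: "0 < X (n + N)" for n by simp
    have "(\<lambda>n. LINT x|lborel. indicator K x * \<bar>sol w (X (n + N), x) - sol w (t, x)\<bar>) \<longlonglongrightarrow> (LINT (x::real)|lborel. (0::real))"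
    proof (rule bounded_convergence[of K _ _ _ "2 * M"])
      show "AE x in lborel. \<bar>indicator K x * \<bar>sol w (X (n + N), x) - sol w (t, x)\<bar>\<bar> \<le> 2 * M * indicator K x" for n
      proof -
        have "AE x in lborel. \<bar>sol w (X (n + N), x)\<bar> \<le> M" "AE x in lborel. \<bar>sol w (t, x)\<bar> \<le> M"
          using ess_bounded_sol[OF w] by (auto simp: ess_bounded_def)
        then show ?thesis by eventually_elim (auto simp: indicator_def)
      qed
      show "AE x in lborel. (\<lambda>n. indicator K x * \<bar>sol w (X (n + N), x) - sol w (t, x)\<bar>) \<longlonglongrightarrow> 0"
        using AE_sol_tendsto[OF w _ LIMSEQ_ignore_initial_segment[OF X(2)] N] t
        by (auto elim!: eventually_mono intro!: tendsto_mult_right_zero tendsto_rabs_zero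
            simp: LIM_zero_iff)
    qed (use K' in auto)
    then show "(\<lambda>n. LINT x:K|lborel. \<bar>sol w (X n, x) - sol w (t, x)\<bar>) \<longlonglongrightarrow> 0"
      by - (rule LIMSEQ_offset[where k=N], simp add: set_lebesgue_integral_def)
  qed
qed

lemma AE_sol_bound:
  assumes w: "ess_bounded M w" shows "AE z in lborel. \<bar>sol w z\<bar> \<le> M"
proof -
  have "{z \<in> space lborel. \<bar>sol w z\<bar> \<le> M} \<in> sets (lborel \<Otimes>\<^sub>M lborel)"
    using sol_borel[OF w] unfolding lborel_prod by measurable
  then have "AE z in lborel \<Otimes>\<^sub>M lborel. \<bar>sol w z\<bar> \<le> M"
    using ess_bounded_sol[OF w] by (intro lborel_pair.AE_pair_measure) (auto simp: ess_bounded_def space_pair_measure)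
  then show ?thesis unfolding lborel_prod .
qed

lemma sol_Linf:
  assumes w: "ess_bounded M w" shows "sol w \<in> Linf_on ({0..T} \<times> UNIV)"
  using sol_borel[OF w] AE_sol_bound[OF w]
  by (auto simp: Linf_on_def intro!: measurable_restrict_space1 exI[of _ M] elim!: eventually_mono)

end

section \<open>Entropy inequalities from monotonicity\<close>

text \<open>The set where \<open>P\<close> does not exceed \<open>P a\<close> is closed; at its
  supremum the hypothesis allows a further step to the right unless the supremum is
  \<open>b\<close>.\<close>

lemma dini_decreasing:
  fixes P :: "real \<Rightarrow> real"
  assumes ab: "a \<le> b" and cont: "continuous_on {a..b} P"
    and dini: "\<And>t. t \<in> {a..<b} \<Longrightarrow> \<forall>\<^sub>F h in at_right 0. P (t + h) \<le> P t"
  shows "P b \<le> P a"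
proof -
  define S where "S = {t \<in> {a..b}. P t \<le> P a}"
  have "closed S" unfolding S_def
    using continuous_closed_preimage[OF cont closed_atLeastAtMost closed_atMost[of "P a"]]
    by (simp add: vimage_def Int_def)
  moreover have S: "S \<noteq> {}" "bdd_above S" using ab by (auto simp: S_def intro!: bdd_aboveI[of _ b])
  ultimately have s: "Sup S \<in> S" by (intro closed_contains_Sup)
  have "Sup S = b"
  proof (rule ccontr)
    assume "Sup S \<noteq> b"
    then have sb: "Sup S \<in> {a..<b}" using s by (auto simp: S_def)
    from dini[OF this] obtain d where d: "d > 0" "\<And>h. 0 < h \<Longrightarrow> h < d \<Longrightarrow> P (Sup S + h) \<le> P (Sup S)"
      by (auto simp: eventually_at_right_field)
    define h where "h = min (d / 2) (b - Sup S)"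
    have h: "0 < h" "h < d" "Sup S + h \<le> b" using d sb by (auto simp: h_def min_def)
    then have "Sup S + h \<in> S" using d(2)[OF h(1,2)] s by (auto simp: S_def)
    from cSup_upper[OF this S(2)] h show False by simp
  qed
  then show ?thesis using s by (simp add: S_def)
qed

text \<open>Subtracting the integral of \<open>G\<close> and a small linear term reduces the claim
  to \<open>dini_decreasing\<close>. Half of the slack \<open>d\<close> absorbs the error in
  \<open>P\<close>, the other half that in the derivative of the integral.\<close>

lemma dini_integral_bound:
  fixes P G :: "real \<Rightarrow> real"
  assumes ab: "a \<le> b" and cont: "continuous_on {a..b} P" "continuous_on {a..b} G"
    and dini: "\<And>t e. t \<in> {a..<b} \<Longrightarrow> 0 < e \<Longrightarrow> \<forall>\<^sub>F h in at_right 0. P (t + h) - P t \<le> h * (G t + e)"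
  shows "P b - P a \<le> integral {a..b} G"
proof -
  let ?I = "\<lambda>t. integral {a..t} G"
  have "P b - P a \<le> ?I b + e" if e: "0 < e" for e
  proof -
    define d where "d = e / (b - a + 1)"
    have d: "0 < d" "d * (b - a) \<le> e" using e ab by (auto simp: d_def field_simps)
    have "P b - ?I b - d * (b - a) \<le> P a - ?I a - d * (a - a)"
    proof (rule dini_decreasing[OF ab, of "\<lambda>t. P t - ?I t - d * (t - a)"])
      have "continuous_on {a..b} ?I"
        by (rule indefinite_integral_continuous_1) (rule integrable_continuous_real[OF cont(2)])
      then show "continuous_on {a..b} (\<lambda>t. P t - ?I t - d * (t - a))"
        by (intro continuous_intros cont)
      fix t assume t: "t \<in> {a..<b}"
      have "(?I has_real_derivative G t) (at t within {a..b})"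
        by (rule integral_has_real_derivative[OF cont(2)]) (use t in auto)
      have lim: "((\<lambda>h. (?I (t + h) - ?I t) / h) \<longlongrightarrow> G t) (at_right 0)"
      proof -
        have at: "at t within {t..b} = at_right t" using t by (simp add: at_within_Icc_at_right)
        have "(?I has_real_derivative G t) (at t within {t..b})"
          by (rule DERIV_subset[OF \<open>(?I has_real_derivative G t) (at t within {a..b})\<close>]) (use t in auto)
        then have "((\<lambda>y. (?I y - ?I t) / (y - t)) \<longlongrightarrow> G t) (at_right t)"
          unfolding has_field_derivative_iff at .
        then show ?thesis by (subst (asm) filterlim_at_right_to_0) (simp add: add.commute)
      qed
      have "\<forall>\<^sub>F h in at_right 0. G t - d / 2 < (?I (t + h) - ?I t) / h"
        using order_tendstoD(1)[OF lim, of "G t - d / 2"] d by simp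
      moreover have "\<forall>\<^sub>F h in at_right 0. P (t + h) - P t \<le> h * (G t + d / 2)"
        using dini[OF t, of "d / 2"] d by simp
      moreover have "\<forall>\<^sub>F h::real in at_right 0. 0 < h" by (rule eventually_at_right_less)
      ultimately show "\<forall>\<^sub>F h in at_right 0. P (t + h) - ?I (t + h) - d * (t + h - a) \<le> P t - ?I t - d * (t - a)"
      proof eventually_elim
        case (elim h)
        then have "(G t - d / 2) * h \<le> ?I (t + h) - ?I t" by (simp add: pos_less_divide_eq)
        then show ?case using elim(2) by (simp add: algebra_simps)
      qed
    qed
    then show ?thesis using d by simp
  qed
  then show ?thesis by (rule field_le_epsilon)
qed

text \<open>A test function together with formulas for its partial derivatives, a box that carries
  it and a common bound. In this form products and shifts of test functions can be exhibited
  directly, and the integrability and domination arguments are made once.\<close>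

locale test_function =
  fixes T :: real and \<phi> \<phi>t \<phi>x :: "real \<times> real \<Rightarrow> real" and a b R B :: real
  assumes ab: "0 < a" "a < b" "b < T" and R0: "0 \<le> R"
    and deriv: "\<And>z. (\<phi> has_derivative (\<lambda>h. fst h * \<phi>t z + snd h * \<phi>x z)) (at z)"
    and cont: "continuous_on UNIV \<phi>t" "continuous_on UNIV \<phi>x"
    and support: "\<And>z. z \<notin> {a..b} \<times> {- R..R} \<Longrightarrow> \<phi> z = 0 \<and> \<phi>t z = 0 \<and> \<phi>x z = 0"
    and bound: "\<And>z. \<bar>\<phi> z\<bar> \<le> B" "\<And>z. \<bar>\<phi>t z\<bar> \<le> B" "\<And>z. \<bar>\<phi>x z\<bar> \<le> B"
begin

lemma cont_phi: "continuous_on UNIV \<phi>"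
  using deriv by (meson has_derivative_continuous continuous_at_imp_continuous_on)

lemma borel [measurable]:
  "\<phi> \<in> borel_measurable borel" "\<phi>t \<in> borel_measurable borel" "\<phi>x \<in> borel_measurable borel"
  using cont cont_phi by (auto intro: borel_measurable_continuous_onI)

lemma B0: "0 \<le> B" using bound(1)[of "(0, 0)"] by linarith

lemma deriv_t: "((\<lambda>t. \<phi> (t, x)) has_real_derivative \<phi>t (t, x)) (at t)"
proof -
  have "((\<lambda>t. (t, x)) has_derivative (\<lambda>h. (h, 0))) (at t)"
    by (auto intro!: derivative_eq_intros)
  from diff_chain_at[OF this deriv] show ?thesis
    by (simp add: o_def has_field_derivative_def mult_commute_abs)
qed

lemma deriv_x: "((\<lambda>x. \<phi> (t, x)) has_real_derivative \<phi>x (t, x)) (at x)"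
proof -
  have "((\<lambda>x. (t, x)) has_derivative (\<lambda>h. (0, h))) (at x)"
    by (auto intro!: derivative_eq_intros)
  from diff_chain_at[OF this deriv] show ?thesis
    by (simp add: o_def has_field_derivative_def mult_commute_abs)
qed

lemma slice_borel [measurable]:
  "(\<lambda>x. \<phi> (t, x)) \<in> borel_measurable borel" "(\<lambda>x. \<phi>t (t, x)) \<in> borel_measurable borel"
  "(\<lambda>x. \<phi>x (t, x)) \<in> borel_measurable borel"
proof -
  have "(\<lambda>x. (t, x)) \<in> borel \<rightarrow>\<^sub>M (borel :: (real \<times> real) measure)"
    by (intro borel_measurable_continuous_onI continuous_intros)
  from measurable_compose[OF this borel(1)] measurable_compose[OF this borel(2)] measurable_compose[OF this borel(3)]
  show "(\<lambda>x. \<phi> (t, x)) \<in> borel_measurable borel" "(\<lambda>x. \<phi>t (t, x)) \<in> borel_measurable borel"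
    "(\<lambda>x. \<phi>x (t, x)) \<in> borel_measurable borel" .
qed

lemma bound_slice:
  "\<bar>\<phi> (t, x)\<bar> \<le> B * indicator {- R..R} x" "\<bar>\<phi>t (t, x)\<bar> \<le> B * indicator {- R..R} x"
  "\<bar>\<phi>x (t, x)\<bar> \<le> B * indicator {- R..R} x"
  using support[of "(t, x)"] bound[of "(t, x)"] by (auto simp: indicator_def)

lemma bound_box:
  "\<bar>\<phi> z\<bar> \<le> B * indicator ({a..b} \<times> {- R..R}) z" "\<bar>\<phi>t z\<bar> \<le> B * indicator ({a..b} \<times> {- R..R}) z"
  "\<bar>\<phi>x z\<bar> \<le> B * indicator ({a..b} \<times> {- R..R}) z"
  using support[of z] bound[of z] by (auto simp: indicator_def)

lemma slice_mult_bound: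
  assumes v: "AE x in lborel. \<bar>v x\<bar> \<le> N" and \<psi>: "\<And>x. \<bar>\<psi> x\<bar> \<le> B * indicator {- R..R} x"
  shows "AE x in lborel. \<bar>v x * \<psi> x\<bar> \<le> N * B * indicator {- R..R} x"
  using v
proof eventually_elim
  case (elim x)
  have "0 \<le> N" using elim by linarith
  from mult_mono[OF elim \<psi>[of x] this] show ?case by (simp add: abs_mult mult.assoc)
qed

lemma slice_integrable:
  assumes "v \<in> borel_measurable borel" "AE x in lborel. \<bar>v x\<bar> \<le> N"
    and "\<psi> \<in> borel_measurable borel" "\<And>x. \<bar>\<psi> x\<bar> \<le> B * indicator {- R..R} x"
  shows "integrable lborel (\<lambda>x. v x * \<psi> x)"
  by (rule integrable_bounded_support[OF _ _ _ slice_mult_bound[OF assms(2,4)]]) (use assms in auto)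

lemma integrable_mult:
  assumes v: "v \<in> borel_measurable borel" "AE z in lborel. \<bar>v z\<bar> \<le> N"
    and \<psi>: "\<psi> \<in> borel_measurable borel" "\<And>z. \<bar>\<psi> z\<bar> \<le> B * indicator ({a..b} \<times> {- R..R}) z"
  shows "integrable lborel (\<lambda>z. v z * \<psi> z)"
proof (rule integrable_bounded_support[of "{a..b} \<times> {- R..R}" _ _ "N * B"])
  show "emeasure lborel ({a..b} \<times> {- R..R}) < \<infinity>"
    by (intro emeasure_bounded_finite bounded_Times) auto
  show "{a..b} \<times> {- R..R} \<in> sets lborel" by (simp add: borel_Times)
  show "(\<lambda>z. v z * \<psi> z) \<in> borel_measurable lborel" using v \<psi> by simp
  show "AE z in lborel. \<bar>v z * \<psi> z\<bar> \<le> N * B * indicator ({a..b} \<times> {- R..R}) z"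
    using v(2)
  proof eventually_elim
    case (elim z)
    have "0 \<le> N" using elim by linarith
    from mult_mono[OF elim \<psi>(2)[of z] this] show ?case by (simp add: abs_mult mult.assoc)
  qed
qed

lemma diff_bound: "\<bar>\<phi> (s, x) - \<phi> (t, x)\<bar> \<le> B * indicator {- R..R} x * \<bar>s - t\<bar>"
proof (cases "x \<in> {- R..R}")
  case True
  have "norm (\<phi> (s, x) - \<phi> (t, x)) \<le> B * norm (s - t)"
    using field_differentiable_bound[of UNIV "\<lambda>t. \<phi> (t, x)" "\<lambda>t. \<phi>t (t, x)" B s t] deriv_t bound
    by (auto intro: has_field_derivative_at_within)
  then show ?thesis using True by simp
next
  case False
  then show ?thesis using support[of "(s, x)"] support[of "(t, x)"] by simp
qed

end

lemma frechet_direction: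
  assumes "(\<phi> has_derivative D) (at z)" shows "frechet_derivative \<phi> (at z) h = D h"
  using frechet_derivative_at[OF assms] by simp

lemma C1c_test_function:
  assumes \<phi>: "\<phi> \<in> C1c ({0<..<T} \<times> UNIV)" and T: "0 < T"
  obtains a b R B where
    "test_function T \<phi> (\<lambda>z. frechet_derivative \<phi> (at z) (1, 0)) (\<lambda>z. frechet_derivative \<phi> (at z) (0, 1)) a b R B"
proof -
  let ?t = "\<lambda>z. frechet_derivative \<phi> (at z) (1, 0)" and ?x = "\<lambda>z. frechet_derivative \<phi> (at z) (0, 1)"
  let ?K = "closure {z. \<phi> z \<noteq> 0}"
  have D: "(\<phi> has_derivative frechet_derivative \<phi> (at z)) (at z)" for z
  proof -
    have "\<phi> differentiable at z" using \<phi> unfolding C1c_def differentiable_on_def by blast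
    then show ?thesis by (simp add: frechet_derivative_works)
  qed
  have c: "continuous_on UNIV ?t" "continuous_on UNIV ?x" using \<phi> by (auto simp: C1c_def)
  have K: "compact ?K" "?K \<subseteq> {0<..<T} \<times> UNIV" using \<phi> by (auto simp: C1c_def)
  have deriv: "(\<phi> has_derivative (\<lambda>h. fst h * ?t z + snd h * ?x z)) (at z)" for z
  proof -
    interpret linear "frechet_derivative \<phi> (at z)" using D[of z] by (rule has_derivative_linear)
    have "frechet_derivative \<phi> (at z) h = fst h * ?t z + snd h * ?x z" for h
    proof -
      have "h = fst h *\<^sub>R (1, 0) + snd h *\<^sub>R (0, 1)" by (cases h) simp
      then have "frechet_derivative \<phi> (at z) h = frechet_derivative \<phi> (at z) (fst h *\<^sub>R (1, 0) + snd h *\<^sub>R (0, 1))" by simp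
      then show ?thesis by (simp only: add scale real_scaleR_def)
    qed
    then show ?thesis by (intro has_derivative_eq_rhs[OF D] ext)
  qed
  have out: "\<phi> z = 0 \<and> ?t z = 0 \<and> ?x z = 0" if "z \<notin> ?K" for z
  proof -
    have "(\<phi> has_derivative (\<lambda>h. 0)) (at z)"
      by (rule has_derivative_transform_within_open[of "\<lambda>_. 0" _ _ UNIV "- ?K"])
        (use that closure_subset[of "{z. \<phi> z \<noteq> 0}"] in auto)
    from frechet_direction[OF this] show ?thesis using that closure_subset[of "{z. \<phi> z \<noteq> 0}"] by auto
  qed
  have bd: "\<exists>C. \<forall>z. \<bar>F z\<bar> \<le> C" if F: "continuous_on UNIV F" "\<And>z. z \<notin> ?K \<Longrightarrow> F z = 0" for F :: "real \<times> real \<Rightarrow> real"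
  proof -
    obtain C where C: "\<forall>z\<in>?K. \<bar>F z\<bar> \<le> C"
      using compact_imp_bounded[OF compact_continuous_image[OF continuous_on_subset[OF F(1) subset_UNIV] K(1)]]
      by (auto simp: bounded_iff)
    have "\<bar>F z\<bar> \<le> max C 0" for z using C F(2)[of z] by (cases "z \<in> ?K") force+
    then show ?thesis by blast
  qed
  have "continuous_on UNIV \<phi>"
    using D by (meson has_derivative_continuous continuous_at_imp_continuous_on)
  then obtain B1 B2 B3 where B: "\<And>z. \<bar>\<phi> z\<bar> \<le> B1" "\<And>z. \<bar>?t z\<bar> \<le> B2" "\<And>z. \<bar>?x z\<bar> \<le> B3"
    using bd[of \<phi>] bd[OF c(1)] bd[OF c(2)] out by metis
  obtain a' b' where ab: "0 < a'" "b' < T" "\<And>z. z \<in> ?K \<Longrightarrow> a' \<le> fst z \<and> fst z \<le> b'"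
  proof (cases "?K = {}")
    case True
    show thesis by (rule that[of 1 "T - 1"]) (use True in auto)
  next
    case False
    have "continuous_on ?K (fst :: real \<times> real \<Rightarrow> real)" by (intro continuous_intros)
    from continuous_attains_inf[OF K(1) False this] continuous_attains_sup[OF K(1) False this]
    obtain z1 z2 where z: "z1 \<in> ?K" "z2 \<in> ?K" "\<And>z. z \<in> ?K \<Longrightarrow> fst z1 \<le> fst z \<and> fst z \<le> fst z2" by blast
    then show thesis using K(2) by (intro that[of "fst z1" "fst z2"]) auto
  qed
  \<comment> \<open>The caps \<open>T / 3\<close> and \<open>T / 2\<close> force
    \<open>a < b\<close> even when the support is empty or lies in a single time slice.\<close>
  define a where "a = min a' (T / 3)"
  define b where "b = max b' (T / 2)"
  have ab': "0 < a" "a < b" "b < T" using ab(1,2) T by (auto simp: a_def b_def)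
  obtain R where R: "0 < R" "\<And>z. z \<in> ?K \<Longrightarrow> norm z \<le> R"
    using compact_imp_bounded[OF K(1)] by (auto simp: bounded_pos)
  have box: "?K \<subseteq> {a..b} \<times> {- R..R}"
  proof
    fix z assume z: "z \<in> ?K"
    have "\<bar>snd z\<bar> \<le> R" using R(2)[OF z] norm_snd_le[of "snd z" "fst z"] by simp
    then show "z \<in> {a..b} \<times> {- R..R}" using ab(3)[OF z] by (cases z) (auto simp: a_def b_def)
  qed
  have "test_function T \<phi> ?t ?x a b R (max B1 (max B2 B3))"
  proof
    show "\<bar>\<phi> z\<bar> \<le> max B1 (max B2 B3)" "\<bar>?t z\<bar> \<le> max B1 (max B2 B3)" "\<bar>?x z\<bar> \<le> max B1 (max B2 B3)" for z
      using B[of z] by auto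
    show "z \<notin> {a..b} \<times> {- R..R} \<Longrightarrow> \<phi> z = 0 \<and> ?t z = 0 \<and> ?x z = 0" for z
      using out[of z] box by blast
  qed (use R(1) in \<open>intro ab' deriv c | simp\<close>)+
  then show thesis by (rule that)
qed

lemma lborel_pair_integral:
  fixes F :: "real \<times> real \<Rightarrow> real"
  assumes "integrable lborel F"
  shows "(LINT z|lborel. F z) = (LINT t|lborel. LINT x|lborel. F (t, x))"
  using lborel_pair.integral_fst'[of F] assms unfolding lborel_prod by simp

section \<open>One-sided entropy inequalities\<close>

context convex_flux
begin

lemma g_0: "g 0 = 0"
  using g_f1[of 0] by (simp add: f1_0)

text \<open>Since the minimum of \<open>f\<close> is \<open>f 0 = 0\<close>, the function
  \<open>L\<close> is nonnegative and vanishes at 0. The foot \<open>x\<close> itself gives the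
  upper bound; from below, \<open>U\<close> drops by at most \<open>M\<close> times the distance to
  a minimiser. This is the dominating constant for the limit of the quotients.\<close>

lemma HL_quotient_bound:
  assumes lip: "M-lipschitz_on UNIV U" and h: "0 < h"
  shows "\<bar>(HL U h x - U x) / h\<bar> \<le> M * max \<bar>deriv f M\<bar> \<bar>deriv f (- M)\<bar>"
proof -
  have M: "0 \<le> M" using lip by (rule lipschitz_on_nonneg)
  let ?A = "max \<bar>deriv f M\<bar> \<bar>deriv f (- M)\<bar>"
  have "HL U h x \<le> U x" using HL_le[OF lip h, of x x] by (simp add: cost_def L_def g_0 f_0)
  moreover have "U x - M * ?A * h \<le> HL U h x"
  proof -
    let ?y = "ymax U h x"
    have "\<bar>(x - ?y) / h\<bar> \<le> ?A" using arg_bounds[OF lip h is_arg_ymax[OF lip h], of x] by auto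
    then have "\<bar>x - ?y\<bar> \<le> ?A * h" using h by (simp add: abs_divide pos_divide_le_eq)
    then have "M * \<bar>x - ?y\<bar> \<le> M * (?A * h)" using M by (rule mult_left_mono)
    moreover have "0 \<le> h * L ((x - ?y) / h)" using young[of 0 "(x - ?y) / h"] h by (simp add: f_0)
    ultimately show ?thesis using lipschitz_real[OF lip, of x ?y] by (simp add: HL_def cost_def)
  qed
  ultimately show ?thesis using h M by (auto simp: abs_le_iff field_simps)
qed

lemma f_bounded_on: "\<exists>F. \<forall>y. \<bar>y\<bar> \<le> N \<longrightarrow> \<bar>f y\<bar> \<le> F"
proof -
  have "bounded (f ` {- N..N})"
    by (rule compact_imp_bounded[OF compact_continuous_image[OF continuous_f compact_Icc]])
  then obtain F where F: "\<forall>y\<in>{- N..N}. \<bar>f y\<bar> \<le> F" by (auto simp: bounded_iff)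
  have "\<bar>f y\<bar> \<le> F" if "\<bar>y\<bar> \<le> N" for y using F that by (simp add: abs_le_iff)
  then show ?thesis by blast
qed

text \<open>The function \<open>t \<mapsto> \<integral> \<mu>(u) \<phi>\<close> has upper right Dini derivative at most \<open>\<integral> \<mu>(u) \<partial>\<^sub>t\<phi> + f(\<mu>(u)) \<partial>\<^sub>x\<phi>\<close>:
  compare \<open>\<mu>(u(t + h))\<close> with the Hopf-Lax evolution of \<open>\<mu>(u(t))\<close> over time \<open>h\<close>, whose primitive moves at
  speed \<open>- f(\<mu>(u(t)))\<close>.\<close>

lemma entropy_one_sided:
  assumes w: "ess_bounded M w" and \<mu>: "continuous_on UNIV \<mu>" "\<And>y. \<bar>y\<bar> \<le> M \<Longrightarrow> \<bar>\<mu> y\<bar> \<le> N"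
    and comp: "\<And>t h. 0 < t \<Longrightarrow> 0 < h \<Longrightarrow> AE x in lborel.
      \<sigma> * \<mu> (sol w (t + h, x)) \<le> \<sigma> * vel (prim (\<lambda>x. \<mu> (sol w (t, x)))) h x"
    and \<phi>: "test_function T \<phi> \<phi>t \<phi>x a b R B" "\<And>z. 0 \<le> \<phi> z"
  shows "0 \<le> \<sigma> * (LINT z|lborel. \<mu> (sol w z) * \<phi>t z + f (\<mu> (sol w z)) * \<phi>x z)"
proof -
  interpret test_function T \<phi> \<phi>t \<phi>x a b R B by (rule \<phi>)
  define m where "m t x = \<mu> (sol w (t, x))" for t x
  define P where "P t = prim (m t)" for t
  have [measurable]: "\<mu> \<in> borel_measurable borel" using \<mu>(1) by (rule borel_measurable_continuous_onI)
  have [measurable]: "(\<lambda>x. sol w (t, x)) \<in> borel_measurable borel" for t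
    using ess_bounded_sol[OF w, of t] by (simp add: ess_bounded_def)
  have m_eq: "\<mu> (sol w (t, x)) = m t x" for t x by (simp add: m_def)
  have m: "ess_bounded N (m t)" for t
    using ess_bounded_sol[OF w, of t] \<mu>(2) by (auto simp: ess_bounded_def m_def[abs_def] elim!: eventually_mono)
  then have m_bound: "AE x in lborel. \<bar>m t x\<bar> \<le> N" for t by (simp add: ess_bounded_def)
  have [measurable]: "m t \<in> borel_measurable borel" for t using m[of t] by (simp add: ess_bounded_def)
  have N0: "0 \<le> N" using m[of 0] by (rule ess_bounded_nonneg)
  have P: "N-lipschitz_on UNIV (P t)" for t unfolding P_def by (rule prim_lipschitz[OF m])
  have P_deriv: "AE x in lborel. (P t has_real_derivative m t x) (at x)" for t
    unfolding P_def by (rule AE_prim_deriv[OF ess_bounded_loc_int[OF m]])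
  have m_lim: "AE x in lborel. (\<lambda>n. m (X n) x) \<longlonglongrightarrow> m t x" if "0 < t" "X \<longlonglongrightarrow> t" "\<And>n. 0 < X n" for X t
    using AE_sol_tendsto[OF w less_imp_le[OF that(1)] that(2,3)]
  proof eventually_elim
    case (elim x)
    show ?case unfolding m_def
      by (rule isCont_tendsto_compose[OF _ elim]) (use \<mu>(1) in \<open>simp add: continuous_on_eq_continuous_at\<close>)
  qed
  obtain F where F: "\<And>y. \<bar>y\<bar> \<le> N \<Longrightarrow> \<bar>f y\<bar> \<le> F" using f_bounded_on by blast
  have f_bound: "AE x in lborel. \<bar>f (m t x)\<bar> \<le> F" for t
    using m_bound[of t] by eventually_elim (rule F)
  have cf: "isCont f y" for y using continuous_f[of UNIV] by (simp add: continuous_on_eq_continuous_at)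
  have slice_lim: "(\<lambda>n. \<psi> (X n, x)) \<longlonglongrightarrow> \<psi> (t, x)" if "continuous_on UNIV \<psi>" "X \<longlonglongrightarrow> t" for \<psi> :: "real \<times> real \<Rightarrow> real" and X t x
    by (rule isCont_tendsto_compose[of "(t, x)" \<psi>])
      (use that in \<open>auto simp: continuous_on_eq_continuous_at intro!: tendsto_intros\<close>)
  define p where "p t = (LINT x|lborel. m t x * \<phi> (t, x))" for t
  define G where "G t = (LINT x|lborel. m t x * \<phi>t (t, x) + f (m t x) * \<phi>x (t, x))" for t
  have p_lim: "(\<lambda>n. p (X n)) \<longlonglongrightarrow> p t" if X: "0 < t" "X \<longlonglongrightarrow> t" "\<And>n. 0 < X n" for X t
    unfolding p_def
  proof (rule bounded_convergence[of "{- R..R}" _ _ _ "N * B"])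
    show "AE x in lborel. \<bar>m (X n) x * \<phi> (X n, x)\<bar> \<le> N * B * indicator {- R..R} x" for n
      by (rule slice_mult_bound[OF m_bound bound_slice(1)])
    show "AE x in lborel. (\<lambda>n. m (X n) x * \<phi> (X n, x)) \<longlonglongrightarrow> m t x * \<phi> (t, x)"
      using m_lim[OF X] by eventually_elim (intro tendsto_mult slice_lim[OF cont_phi X(2)])
  qed auto
  have G_bound: "AE x in lborel. \<bar>m t x * \<phi>t (t, x) + f (m t x) * \<phi>x (t, x)\<bar> \<le> (N * B + F * B) * indicator {- R..R} x" for t
    using slice_mult_bound[OF m_bound bound_slice(2)] slice_mult_bound[OF f_bound bound_slice(3)]
    by eventually_elim (auto simp: distrib_right intro!: order_trans[OF abs_triangle_ineq add_mono])
  have G_lim: "(\<lambda>n. G (X n)) \<longlonglongrightarrow> G t" if X: "0 < t" "X \<longlonglongrightarrow> t" "\<And>n. 0 < X n" for X t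
    unfolding G_def
  proof (rule bounded_convergence[of "{- R..R}" _ _ _ "N * B + F * B"])
    show "AE x in lborel. (\<lambda>n. m (X n) x * \<phi>t (X n, x) + f (m (X n) x) * \<phi>x (X n, x))
        \<longlonglongrightarrow> m t x * \<phi>t (t, x) + f (m t x) * \<phi>x (t, x)"
      using m_lim[OF X]
      by eventually_elim (intro tendsto_intros slice_lim[OF cont(1) X(2)] slice_lim[OF cont(2) X(2)]
          isCont_tendsto_compose[OF cf])
  qed (use G_bound in auto)
  have cont_on: "continuous_on {a / 2..b + 1} H"
    if "\<And>X t. 0 < t \<Longrightarrow> X \<longlonglongrightarrow> t \<Longrightarrow> (\<And>n. 0 < X n) \<Longrightarrow> (\<lambda>n. H (X n)) \<longlonglongrightarrow> H t" for H :: "real \<Rightarrow> real"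
    unfolding continuous_on_sequentially comp_def
  proof (intro allI ballI impI, elim conjE)
    fix X t assume "t \<in> {a / 2..b + 1}" "\<forall>n. X n \<in> {a / 2..b + 1}" "X \<longlonglongrightarrow> t"
    then show "(\<lambda>n. H (X n)) \<longlonglongrightarrow> H t" using ab(1) by (intro that) (auto intro: less_le_trans[of 0 "a / 2"])
  qed
  have dini: "\<forall>\<^sub>F h in at_right 0. \<sigma> * p (t + h) - \<sigma> * p t \<le> h * (\<sigma> * G t + e)" if t: "0 < t" and e: "0 < e" for t e
  proof -
    \<comment> \<open>\<open>Q h\<close> collects the increment in time of the test function and,
      after integration by parts in space, the increment of the primitive under the Hopf-Lax
      evolution. It tends to \<open>G t\<close>, while \<open>le\<close> shows that
      \<open>h * Q h\<close>, up to the sign \<open>\<sigma>\<close>, dominates the increment of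
      \<open>p\<close>.\<close>
    define Q where "Q h = (LINT x|lborel. m (t + h) x * ((\<phi> (t + h, x) - \<phi> (t, x)) / h))
       - (LINT x|lborel. (HL (P t) h x - P t x) / h * \<phi>x (t, x))" for h
    have Q_lim: "(Q \<longlongrightarrow> G t) (at_right 0)"
      unfolding tendsto_at_iff_sequentially comp_def
    proof (intro allI impI)
      fix X assume X: "\<forall>i. X i \<in> {0<..} - {0::real}" "X \<longlonglongrightarrow> 0"
      then have X0: "0 < X n" for n by simp
      have "X n \<noteq> 0" for n using X0[of n] by simp
      then have Xr: "filterlim X (at_right 0) sequentially" and Xa: "filterlim X (at 0) sequentially"
        using X by (auto simp: filterlim_at)
      have "(\<lambda>n. LINT x|lborel. m (t + X n) x * ((\<phi> (t + X n, x) - \<phi> (t, x)) / X n)) \<longlonglongrightarrow> (LINT x|lborel. m t x * \<phi>t (t, x))"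
      proof (rule bounded_convergence[of "{- R..R}" _ _ _ "N * B"])
        show "AE x in lborel. \<bar>m (t + X n) x * ((\<phi> (t + X n, x) - \<phi> (t, x)) / X n)\<bar> \<le> N * B * indicator {- R..R} x" for n
          using m_bound[of "t + X n"]
        proof eventually_elim
          case (elim x)
          have "\<bar>(\<phi> (t + X n, x) - \<phi> (t, x)) / X n\<bar> \<le> B * indicator {- R..R} x"
            using diff_bound[of "t + X n" x t] X0[of n] by (simp add: abs_divide pos_divide_le_eq)
          from mult_mono[OF elim this] N0 show ?case unfolding abs_mult by (simp add: mult.assoc)
        qed
        have "(\<lambda>n. t + X n) \<longlonglongrightarrow> t" using tendsto_add[OF tendsto_const X(2), of t] by simp
        from m_lim[OF t this] have "AE x in lborel. (\<lambda>n. m (t + X n) x) \<longlonglongrightarrow> m t x"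
          using t X0 by (simp add: add_pos_pos)
        then show "AE x in lborel. (\<lambda>n. m (t + X n) x * ((\<phi> (t + X n, x) - \<phi> (t, x)) / X n)) \<longlonglongrightarrow> m t x * \<phi>t (t, x)"
        proof eventually_elim
          case (elim x)
          show ?case
            by (intro tendsto_mult elim filterlim_compose[OF deriv_t[unfolded DERIV_def] Xa])
        qed
      qed auto
      moreover have "(\<lambda>n. LINT x|lborel. (HL (P t) (X n) x - P t x) / X n * \<phi>x (t, x)) \<longlonglongrightarrow> (LINT x|lborel. - f (m t x) * \<phi>x (t, x))"
      proof (rule bounded_convergence[of "{- R..R}" _ _ _ "N * max \<bar>deriv f N\<bar> \<bar>deriv f (- N)\<bar> * B"])
        have [measurable]: "HL (P t) (X n) \<in> borel_measurable borel" for n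
          by (rule lipschitz_borel[OF HL_lipschitz[OF P X0]])
        have [measurable]: "P t \<in> borel_measurable borel" by (rule lipschitz_borel[OF P])
        show "(\<lambda>x. (HL (P t) (X n) x - P t x) / X n * \<phi>x (t, x)) \<in> borel_measurable lborel" for n by simp
        show "AE x in lborel. \<bar>(HL (P t) (X n) x - P t x) / X n * \<phi>x (t, x)\<bar>
            \<le> N * max \<bar>deriv f N\<bar> \<bar>deriv f (- N)\<bar> * B * indicator {- R..R} x" for n
        proof (rule AE_I2)
          fix x
          show "\<bar>(HL (P t) (X n) x - P t x) / X n * \<phi>x (t, x)\<bar>
            \<le> N * max \<bar>deriv f N\<bar> \<bar>deriv f (- N)\<bar> * B * indicator {- R..R} x"
            unfolding abs_mult mult.assoc[of _ B]
            by (rule mult_mono[OF HL_quotient_bound[OF P X0] bound_slice(3)]) (use N0 in auto)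
        qed
        show "AE x in lborel. (\<lambda>n. (HL (P t) (X n) x - P t x) / X n * \<phi>x (t, x)) \<longlonglongrightarrow> - f (m t x) * \<phi>x (t, x)"
          using P_deriv[of t]
        proof eventually_elim
          case (elim x)
          show ?case
            by (intro tendsto_mult tendsto_const filterlim_compose[OF HL_quotient_tendsto[OF P elim] Xr])
        qed
      qed auto
      ultimately have "(\<lambda>n. Q (X n)) \<longlonglongrightarrow> (LINT x|lborel. m t x * \<phi>t (t, x)) - (LINT x|lborel. - f (m t x) * \<phi>x (t, x))"
        unfolding Q_def by (intro tendsto_diff)
      also have "(LINT x|lborel. m t x * \<phi>t (t, x)) - (LINT x|lborel. - f (m t x) * \<phi>x (t, x)) = G t"
      proof -
        have "integrable lborel (\<lambda>x. m t x * \<phi>t (t, x))" "integrable lborel (\<lambda>x. f (m t x) * \<phi>x (t, x))"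
          by (rule slice_integrable[OF _ m_bound _ bound_slice(2)] slice_integrable[OF _ f_bound _ bound_slice(3)]; simp)+
        then show ?thesis by (simp add: G_def)
      qed
      finally show "(\<lambda>n. Q (X n)) \<longlonglongrightarrow> G t" .
    qed
    have le: "\<sigma> * p (t + h) - \<sigma> * p t \<le> h * (\<sigma> * Q h)" if h: "0 < h" for h
    proof -
      let ?V = "HL (P t) h" and ?v = "vel (P t) h"
      have [measurable]: "?v \<in> borel_measurable borel" by (rule vel_borel_slice[OF P h])
      have intp: "integrable lborel (\<lambda>x. v x * \<phi> (s, x))" if "v \<in> borel_measurable borel"
        and "AE x in lborel. \<bar>v x\<bar> \<le> N" for v s
        by (rule slice_integrable[OF that _ bound_slice(1)]) simp
      have intx: "integrable lborel (\<lambda>x. V x * \<phi>x (t, x))" if V: "N-lipschitz_on UNIV V" for V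
      proof -
        have [measurable]: "V \<in> borel_measurable borel" by (rule lipschitz_borel[OF V])
        have "bounded (V ` {- R..R})"
          by (rule compact_imp_bounded[OF compact_continuous_image[OF
                continuous_on_subset[OF lipschitz_on_continuous_on[OF V]] compact_Icc]]) simp
        then obtain D where D: "\<forall>x\<in>{- R..R}. \<bar>V x\<bar> \<le> D" by (auto simp: bounded_iff)
        show ?thesis
        proof (rule integrable_bounded_support[of "{- R..R}" _ _ "D * B"])
          have "\<bar>V x * \<phi>x (t, x)\<bar> \<le> D * B * indicator {- R..R} x" for x
          proof (cases "x \<in> {- R..R}")
            case True
            then have "\<bar>V x\<bar> \<le> D" using D by blast
            from mult_mono[OF this bound(3)[of "(t, x)"]] B0 True show ?thesis
              using \<open>\<bar>V x\<bar> \<le> D\<close> by (simp add: abs_mult)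
          qed (use support in auto)
          then show "AE x in lborel. \<bar>V x * \<phi>x (t, x)\<bar> \<le> D * B * indicator {- R..R} x" by simp
        qed auto
      qed
      have zero: "\<phi> (t, x) = 0" if "R + 1 \<le> \<bar>x\<bar>" for x
      proof -
        have "(t, x) \<notin> {a..b} \<times> {- R..R}" using that by auto
        then show ?thesis using support by blast
      qed
      have ibp: "(LINT x|lborel. v x * \<phi> (t, x)) = - (LINT x|lborel. V x * \<phi>x (t, x))"
        if "N-lipschitz_on UNIV V" "AE x in lborel. (V has_real_derivative v x) (at x)" "v \<in> borel_measurable borel" for V v
        by (rule lipschitz_ibp[where R="R + 1", OF that deriv_x bound(3) zero]) (use R0 in auto)
      have 1: "(LINT x|lborel. ?v x * \<phi> (t, x)) = - (LINT x|lborel. ?V x * \<phi>x (t, x))"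
        by (rule ibp[OF HL_lipschitz[OF P h] AE_HL_deriv[OF P h]]) simp
      have 2: "p t = - (LINT x|lborel. P t x * \<phi>x (t, x))"
        unfolding p_def by (rule ibp[OF P P_deriv]) simp
      have 3: "\<sigma> * (LINT x|lborel. m (t + h) x * \<phi> (t, x)) \<le> \<sigma> * (LINT x|lborel. ?v x * \<phi> (t, x))"
      proof -
        have "(LINT x|lborel. \<sigma> * (m (t + h) x * \<phi> (t, x))) \<le> (LINT x|lborel. \<sigma> * (?v x * \<phi> (t, x)))"
        proof (rule integral_mono_AE)
          show "integrable lborel (\<lambda>x. \<sigma> * (m (t + h) x * \<phi> (t, x)))"
            by (intro integrable_mult_right intp m_bound) simp
          show "integrable lborel (\<lambda>x. \<sigma> * (?v x * \<phi> (t, x)))"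
            using vel_bound[OF P h] by (intro integrable_mult_right intp) auto
          show "AE x in lborel. \<sigma> * (m (t + h) x * \<phi> (t, x)) \<le> \<sigma> * (?v x * \<phi> (t, x))"
            using comp[OF t h] unfolding m_eq
          proof eventually_elim
            case (elim x)
            from mult_right_mono[OF this \<phi>(2)[of "(t, x)"]] show ?case by (simp add: P_def m_def[abs_def] mult.assoc)
          qed
        qed
        then show ?thesis by simp
      qed
      have 4: "p (t + h) = h * (LINT x|lborel. m (t + h) x * ((\<phi> (t + h, x) - \<phi> (t, x)) / h)) + (LINT x|lborel. m (t + h) x * \<phi> (t, x))"
      proof -
        have "h * (LINT x|lborel. m (t + h) x * ((\<phi> (t + h, x) - \<phi> (t, x)) / h))
            = (LINT x|lborel. h * (m (t + h) x * ((\<phi> (t + h, x) - \<phi> (t, x)) / h)))" by simp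
        also have "\<dots> = (LINT x|lborel. m (t + h) x * \<phi> (t + h, x) - m (t + h) x * \<phi> (t, x))"
          using h by (intro Bochner_Integration.integral_cong) (auto simp flip: right_diff_distrib)
        also have "\<dots> = p (t + h) - (LINT x|lborel. m (t + h) x * \<phi> (t, x))"
          unfolding p_def by (intro Bochner_Integration.integral_diff intp m_bound) auto
        finally show ?thesis by simp
      qed
      have 5: "h * (LINT x|lborel. (?V x - P t x) / h * \<phi>x (t, x)) = (LINT x|lborel. ?V x * \<phi>x (t, x)) - (LINT x|lborel. P t x * \<phi>x (t, x))"
      proof -
        have "h * (LINT x|lborel. (?V x - P t x) / h * \<phi>x (t, x)) = (LINT x|lborel. h * ((?V x - P t x) / h * \<phi>x (t, x)))" by simp
        also have "\<dots> = (LINT x|lborel. ?V x * \<phi>x (t, x) - P t x * \<phi>x (t, x))"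
          using h by (intro Bochner_Integration.integral_cong) (auto simp: left_diff_distrib)
        also have "\<dots> = (LINT x|lborel. ?V x * \<phi>x (t, x)) - (LINT x|lborel. P t x * \<phi>x (t, x))"
          by (intro Bochner_Integration.integral_diff intx P HL_lipschitz[OF P h])
        finally show ?thesis .
      qed
      have "h * (\<sigma> * Q h) = \<sigma> * (h * (LINT x|lborel. m (t + h) x * ((\<phi> (t + h, x) - \<phi> (t, x)) / h)))
          - \<sigma> * (h * (LINT x|lborel. (?V x - P t x) / h * \<phi>x (t, x)))"
        unfolding Q_def by (simp only: right_diff_distrib mult.left_commute)
      also have "\<dots> = \<sigma> * (h * (LINT x|lborel. m (t + h) x * ((\<phi> (t + h, x) - \<phi> (t, x)) / h)))
          + \<sigma> * (LINT x|lborel. ?v x * \<phi> (t, x)) - \<sigma> * p t"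
        unfolding 5 1 2 by (simp add: right_diff_distrib)
      finally show ?thesis using 3 4 by (simp add: distrib_left)
    qed
    have "((\<lambda>h. \<sigma> * Q h) \<longlongrightarrow> \<sigma> * G t) (at_right 0)" by (intro tendsto_mult tendsto_const Q_lim)
    from order_tendstoD(2)[OF this, of "\<sigma> * G t + e"] e
    have "\<forall>\<^sub>F h in at_right 0. \<sigma> * Q h < \<sigma> * G t + e" by simp
    moreover have "\<forall>\<^sub>F h::real in at_right 0. 0 < h" by (rule eventually_at_right_less)
    ultimately show ?thesis
    proof eventually_elim
      case (elim h)
      have "h * (\<sigma> * Q h) \<le> h * (\<sigma> * G t + e)" using elim by (intro mult_left_mono) auto
      with le[OF elim(2)] show ?case by linarith
    qed
  qed
  have cG: "continuous_on {a / 2..b + 1} G" by (rule cont_on[OF G_lim])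
  \<comment> \<open>Both endpoints lie outside the time support, so \<open>p\<close> vanishes there.
    That \<open>b + 1\<close> may exceed \<open>T\<close> is harmless: \<open>sol w\<close> is
    defined, and the comparison is assumed, for all positive times.\<close>
  have "\<sigma> * p (b + 1) - \<sigma> * p (a / 2) \<le> integral {a / 2..b + 1} (\<lambda>t. \<sigma> * G t)"
  proof (rule dini_integral_bound)
    show "a / 2 \<le> b + 1" using ab by simp
    show "continuous_on {a / 2..b + 1} (\<lambda>t. \<sigma> * p t)" "continuous_on {a / 2..b + 1} (\<lambda>t. \<sigma> * G t)"
      by (intro continuous_intros cont_on[OF p_lim] cG; assumption)+
    fix t e assume "t \<in> {a / 2..<b + 1}" "0 < (e::real)"
    then show "\<forall>\<^sub>F h in at_right 0. \<sigma> * p (t + h) - \<sigma> * p t \<le> h * (\<sigma> * G t + e)"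
      using ab by (intro dini) auto
  qed
  moreover have "p (b + 1) = 0" "p (a / 2) = 0"
    using support[of "(b + 1, _)"] support[of "(a / 2, _)"] ab by (auto simp: p_def)
  ultimately have "0 \<le> \<sigma> * integral {a / 2..b + 1} G" by simp
  also have "integral {a / 2..b + 1} G = (LINT t:{a / 2..b + 1}|lborel. G t)"
    by (rule set_borel_integral_eq_integral(2)[symmetric]) (rule borel_integrable_atLeastAtMost'[OF cG])
  also have "\<dots> = (LINT t|lborel. G t)"
  proof -
    have "G t = 0" if "t \<notin> {a / 2..b + 1}" for t
      using support[of "(t, _)"] that ab by (auto simp: G_def)
    then have "indicator {a / 2..b + 1} t *\<^sub>R G t = G t" for t by (cases "t \<in> {a / 2..b + 1}") auto
    then show ?thesis unfolding set_lebesgue_integral_def by (intro Bochner_Integration.integral_cong refl)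
  qed
  also have "\<dots> = (LINT z|lborel. \<mu> (sol w z) * \<phi>t z + f (\<mu> (sol w z)) * \<phi>x z)"
  proof -
    have [measurable]: "sol w \<in> borel_measurable borel" by (rule sol_borel[OF w])
    have b: "AE z in lborel. \<bar>\<mu> (sol w z)\<bar> \<le> N" using AE_sol_bound[OF w] by eventually_elim (rule \<mu>(2))
    then have fb: "AE z in lborel. \<bar>f (\<mu> (sol w z))\<bar> \<le> F" by eventually_elim (rule F)
    have "integrable lborel (\<lambda>z. \<mu> (sol w z) * \<phi>t z + f (\<mu> (sol w z)) * \<phi>x z)"
      by (intro Bochner_Integration.integrable_add integrable_mult[OF _ b] integrable_mult[OF _ fb] bound_box borel; measurable)
    from lborel_pair_integral[OF this] show ?thesis by (simp add: G_def m_def)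
  qed
  finally show ?thesis .
qed

end

section \<open>Comparison principle and Kruzkov's inequalities\<close>

lemma mono_diff_of_AE_deriv:
  fixes F G :: "real \<Rightarrow> real"
  assumes F: "M-lipschitz_on UNIV F" "AE x in lborel. (F has_real_derivative F' x) (at x)" "F' \<in> borel_measurable borel"
    and G: "N-lipschitz_on UNIV G" "AE x in lborel. (G has_real_derivative G' x) (at x)" "G' \<in> borel_measurable borel"
    and le: "AE x in lborel. F' x \<le> G' x"
  shows "mono (\<lambda>x. G x - F x)"
proof (rule monoI)
  fix a b :: real assume ab: "a \<le> b"
  have "(LINT x:{a<..b}|lborel. G' x - F' x) = (G b - F b) - (G a - F a)"
  proof (rule lipschitz_ftc[OF _ _ _ ab])
    show "(N + M)-lipschitz_on UNIV (\<lambda>x. G x - F x)" by (rule lipschitz_on_diff[OF G(1) F(1)])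
    show "AE x in lborel. ((\<lambda>x. G x - F x) has_real_derivative G' x - F' x) (at x)"
      using F(2) G(2) by eventually_elim (rule DERIV_diff)
    show "(\<lambda>x. G' x - F' x) \<in> borel_measurable borel" using F(3) G(3) by measurable
  qed
  moreover have "0 \<le> (LINT x:{a<..b}|lborel. G' x - F' x)"
    unfolding set_lebesgue_integral_def
    by (rule integral_nonneg_AE) (use le in \<open>auto elim!: eventually_mono simp: indicator_def\<close>)
  ultimately show "G a - F a \<le> G b - F b" by simp
qed

lemma deriv_le_of_mono_diff:
  fixes F G :: "real \<Rightarrow> real"
  assumes "mono (\<lambda>x. G x - F x)" "(F has_real_derivative D) (at x)" "(G has_real_derivative E) (at x)"
  shows "D \<le> E"
proof -
  have "((\<lambda>x. G x - F x) has_real_derivative E - D) (at x)" by (rule DERIV_diff[OF assms(3,2)])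
  moreover have "mono_on UNIV (\<lambda>x. G x - F x)" using assms(1) by (simp add: monotone_on_def mono_def)
  ultimately have "0 \<le> E - D" by (intro mono_on_imp_deriv_nonneg[of UNIV]) auto
  then show ?thesis by simp
qed

lemma lipschitz_linear: "\<bar>k\<bar>-lipschitz_on UNIV (\<lambda>x::real. k * x)"
  by (rule lipschitz_onI) (auto simp: dist_real_def abs_mult[symmetric] right_diff_distrib[symmetric])

context convex_flux
begin

text \<open>Comparison principle for derivatives: order almost everywhere makes the difference of
  the functions monotone, \<open>HL_order\<close> propagates this, and differentiation returns to
  the densities.\<close>

lemma HL_mono_deriv:
  assumes F: "M-lipschitz_on UNIV F" "AE x in lborel. (F has_real_derivative F' x) (at x)" "F' \<in> borel_measurable borel"
    and G: "N-lipschitz_on UNIV G" "AE x in lborel. (G has_real_derivative G' x) (at x)" "G' \<in> borel_measurable borel"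
    and le: "AE x in lborel. F' x \<le> G' x" and h: "0 < h"
    and DF: "AE x in lborel. (HL F h has_real_derivative DF x) (at x)"
    and DG: "AE x in lborel. (HL G h has_real_derivative DG x) (at x)"
  shows "AE x in lborel. DF x \<le> DG x"
  using DF DG
proof eventually_elim
  case (elim x)
  show ?case
    by (rule deriv_le_of_mono_diff[OF HL_order[OF F(1) G(1) h mono_diff_of_AE_deriv[OF F G le]] elim])
qed

text \<open>The datum clipped from below dominates both the solution at time \<open>t\<close> and
  the constant \<open>k\<close>. By the semigroup law the former evolves into the solution at time
  \<open>t + h\<close>, the latter persists, so the evolved clipped datum dominates their maximum.
  Clipping from above is dual.\<close>

lemma sol_clip:
  assumes w: "ess_bounded M w" and t: "0 < t" and h: "0 < h"
  shows "AE x in lborel. max (sol w (t + h, x)) k \<le> vel (prim (\<lambda>x. max (sol w (t, x)) k)) h x"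
    and "AE x in lborel. vel (prim (\<lambda>x. min (sol w (t, x)) k)) h x \<le> min (sol w (t + h, x)) k"
proof -
  let ?U = "prim w"
  let ?V = "HL ?U t"
  have th: "0 < t + h" using t h by simp
  have U: "M-lipschitz_on UNIV ?U" by (rule prim_lipschitz[OF w])
  have V: "M-lipschitz_on UNIV ?V" "AE x in lborel. (?V has_real_derivative sol w (t, x)) (at x)"
    "(\<lambda>x. sol w (t, x)) \<in> borel_measurable borel"
    using HL_lipschitz[OF U t] AE_HL_deriv[OF U t] ess_bounded_sol[OF w, of t] t
    by (auto simp: sol_pos ess_bounded_def)
  have "HL ?V h = HL ?U (t + h)" using HL_semigroup[OF U t h] by (rule ext)
  then have Vh: "AE x in lborel. (HL ?V h has_real_derivative sol w (t + h, x)) (at x)"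
    using AE_HL_deriv[OF U th] th by (simp add: sol_pos)
  have K: "\<bar>k\<bar>-lipschitz_on UNIV (\<lambda>x. k * x)" "AE x in lborel. ((\<lambda>x. k * x) has_real_derivative k) (at x)"
    by (rule lipschitz_linear) (auto intro!: AE_I2 derivative_eq_intros)
  have "HL (\<lambda>x. k * x) h = (\<lambda>x. k * x - h * f k)" using HL_linear[OF h, of k] by (rule ext)
  then have Kh: "AE x in lborel. (HL (\<lambda>x. k * x) h has_real_derivative k) (at x)"
    by (auto intro!: AE_I2 derivative_eq_intros)
  have P: "(max M \<bar>k\<bar>)-lipschitz_on UNIV (prim m)" "AE x in lborel. (prim m has_real_derivative m x) (at x)"
    "m \<in> borel_measurable borel" "AE x in lborel. (HL (prim m) h has_real_derivative vel (prim m) h x) (at x)"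
    if m: "ess_bounded (max M \<bar>k\<bar>) m" for m
    using prim_lipschitz[OF m] AE_prim_deriv[OF ess_bounded_loc_int[OF m]] AE_HL_deriv[OF prim_lipschitz[OF m] h] m
    by (auto simp: ess_bounded_def)
  have mx: "ess_bounded (max M \<bar>k\<bar>) (\<lambda>x. max (sol w (t, x)) k)" (is "ess_bounded _ ?m")
    and mn: "ess_bounded (max M \<bar>k\<bar>) (\<lambda>x. min (sol w (t, x)) k)" (is "ess_bounded _ ?n")
    using ess_bounded_sol[OF w, of t] by (auto simp: ess_bounded_def elim!: eventually_mono)
  have "AE x in lborel. sol w (t + h, x) \<le> vel (prim ?m) h x"
    by (rule HL_mono_deriv[OF V P(1-3)[OF mx] _ h Vh P(4)[OF mx]]) simp
  moreover have "AE x in lborel. k \<le> vel (prim ?m) h x"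
    by (rule HL_mono_deriv[OF K _ P(1-3)[OF mx] _ h Kh P(4)[OF mx]]) simp_all
  ultimately show "AE x in lborel. max (sol w (t + h, x)) k \<le> vel (prim ?m) h x"
    by eventually_elim simp
  have "AE x in lborel. vel (prim ?n) h x \<le> sol w (t + h, x)"
    by (rule HL_mono_deriv[OF P(1-3)[OF mn] V _ h P(4)[OF mn] Vh]) simp
  moreover have "AE x in lborel. vel (prim ?n) h x \<le> k"
    by (rule HL_mono_deriv[OF P(1-3)[OF mn] K _ _ h P(4)[OF mn] Kh]) simp_all
  ultimately show "AE x in lborel. vel (prim ?n) h x \<le> min (sol w (t + h, x)) k"
    by eventually_elim simp
qed

text \<open>Kruzkov's entropy is the maximum of the solution and \<open>k\<close> minus their
  minimum, and its flux is \<open>f\<close> of the maximum minus \<open>f\<close> of the minimum.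
  The inequality is therefore the difference of two instances of
  \<open>entropy_one_sided\<close>.\<close>

theorem weak_entropy_solution_sol:
  assumes w: "ess_bounded M w" and T: "0 < T"
  shows "weak_entropy_solution f T (sol w)"
  unfolding weak_entropy_solution_def
proof (intro conjI allI ballI impI)
  show "sol w \<in> Linf_on ({0..T} \<times> UNIV)" by (rule sol_Linf[OF w])
  show "C0_L1loc {0..T} (sol w)" by (rule C0_L1loc_sol[OF w])
  fix k and \<phi> :: "real \<times> real \<Rightarrow> real"
  assume \<phi>: "\<phi> \<in> C1c ({0<..<T} \<times> UNIV)" and pos: "\<forall>z. 0 \<le> \<phi> z"
  let ?t = "\<lambda>z. frechet_derivative \<phi> (at z) (1, 0)" and ?x = "\<lambda>z. frechet_derivative \<phi> (at z) (0, 1)"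
  obtain a b R B where tf: "test_function T \<phi> ?t ?x a b R B" by (rule C1c_test_function[OF \<phi> T])
  then interpret test_function T \<phi> ?t ?x a b R B .
  let ?N = "max M \<bar>k\<bar>"
  have cont: "continuous_on UNIV (\<lambda>y. max y k)" "continuous_on UNIV (\<lambda>y. min y k)"
    by (intro continuous_intros)+
  have bd: "\<bar>y\<bar> \<le> M \<Longrightarrow> \<bar>max y k\<bar> \<le> ?N" "\<bar>y\<bar> \<le> M \<Longrightarrow> \<bar>min y k\<bar> \<le> ?N" for y by auto
  \<comment> \<open>The factors \<open>1\<close> and \<open>- 1\<close> are the values of
    \<open>\<sigma>\<close>, for a subsolution and a supersolution respectively.\<close>
  have 1: "0 \<le> 1 * (LINT z|lborel. max (sol w z) k * ?t z + f (max (sol w z) k) * ?x z)"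
    by (rule entropy_one_sided[OF w cont(1) bd(1) _ tf]) (use sol_clip(1)[OF w] pos in auto)
  have 2: "0 \<le> - 1 * (LINT z|lborel. min (sol w z) k * ?t z + f (min (sol w z) k) * ?x z)"
    by (rule entropy_one_sided[OF w cont(2) bd(2) _ tf]) (use sol_clip(2)[OF w] pos in auto)
  obtain F where F: "\<And>y. \<bar>y\<bar> \<le> ?N \<Longrightarrow> \<bar>f y\<bar> \<le> F" using f_bounded_on by blast
  have [measurable]: "sol w \<in> borel_measurable borel" by (rule sol_borel[OF w])
  have b: "AE z in lborel. \<bar>max (sol w z) k\<bar> \<le> ?N" "AE z in lborel. \<bar>min (sol w z) k\<bar> \<le> ?N"
    using AE_sol_bound[OF w] by (eventually_elim, auto)+
  have bf: "AE z in lborel. \<bar>f (max (sol w z) k)\<bar> \<le> F" "AE z in lborel. \<bar>f (min (sol w z) k)\<bar> \<le> F"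
    using b by (eventually_elim, auto intro: F)+
  have int: "integrable lborel (\<lambda>z. max (sol w z) k * ?t z + f (max (sol w z) k) * ?x z)"
    "integrable lborel (\<lambda>z. min (sol w z) k * ?t z + f (min (sol w z) k) * ?x z)"
    by (intro Bochner_Integration.integrable_add integrable_mult[OF _ b(1)] integrable_mult[OF _ b(2)]
        integrable_mult[OF _ bf(1)] integrable_mult[OF _ bf(2)] bound_box borel; measurable)+
  have "(LINT z:{0<..<T} \<times> UNIV|lborel.
      \<bar>sol w z - k\<bar> * ?t z + sgn (sol w z - k) * (f (sol w z) - f k) * ?x z)
    = (LINT z|lborel. (max (sol w z) k * ?t z + f (max (sol w z) k) * ?x z) - (min (sol w z) k * ?t z + f (min (sol w z) k) * ?x z))"
    unfolding set_lebesgue_integral_def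
  proof (intro Bochner_Integration.integral_cong refl)
    fix z :: "real \<times> real"
    have 1: "\<bar>sol w z - k\<bar> = max (sol w z) k - min (sol w z) k" by auto
    have 2: "sgn (sol w z - k) * (f (sol w z) - f k) = f (max (sol w z) k) - f (min (sol w z) k)"
      by (auto simp: sgn_if max_def min_def)
    have "z \<notin> {0<..<T} \<times> UNIV \<Longrightarrow> ?t z = 0 \<and> ?x z = 0" using support[of z] ab by (cases z) auto
    then show "indicat_real ({0<..<T} \<times> UNIV) z *\<^sub>R
          (\<bar>sol w z - k\<bar> * ?t z + sgn (sol w z - k) * (f (sol w z) - f k) * ?x z)
        = (max (sol w z) k * ?t z + f (max (sol w z) k) * ?x z) - (min (sol w z) k * ?t z + f (min (sol w z) k) * ?x z)"
      unfolding 1 2 by (cases "z \<in> {0<..<T} \<times> UNIV") (simp_all add: algebra_simps)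
  qed
  also have "\<dots> = (LINT z|lborel. max (sol w z) k * ?t z + f (max (sol w z) k) * ?x z)
      - (LINT z|lborel. min (sol w z) k * ?t z + f (min (sol w z) k) * ?x z)"
    by (rule Bochner_Integration.integral_diff[OF int])
  finally show "0 \<le> (LINT z:{0<..<T} \<times> UNIV|lborel.
      \<bar>sol w z - k\<bar> * ?t z + sgn (sol w z - k) * (f (sol w z) - f k) * ?x z)"
    using 1 2 by simp
qed

end

section \<open>Doubling of variables\<close>

text \<open>The squared positive part is a simple one-sided cut-off with continuous derivative; the
  kernel, the smooth step and the cone below are all built from it.\<close>

definition kap :: "real \<Rightarrow> real" where "kap s = (max 0 s)\<^sup>2"

lemma kap_deriv: "(kap has_real_derivative 2 * max 0 s) (at s)"
proof -
  consider "0 < s" | "s < 0" | "s = 0" by linarith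
  then show ?thesis
  proof cases
    case 1
    have "((\<lambda>s. s\<^sup>2) has_real_derivative 2 * max 0 s) (at s)"
      using 1 by (auto intro!: derivative_eq_intros)
    then show ?thesis
      by (rule DERIV_cong_ev[THEN iffD1, OF refl _ refl, rotated])
        (use 1 eventually_nhds_in_open[of "{0<..}" s] in \<open>auto simp: kap_def elim!: eventually_mono\<close>)
  next
    case 2
    have "((\<lambda>s. 0) has_real_derivative 2 * max 0 s) (at s)" using 2 by simp
    then show ?thesis
      by (rule DERIV_cong_ev[THEN iffD1, OF refl _ refl, rotated])
        (use 2 eventually_nhds_in_open[of "{..<0}" s] in \<open>auto simp: kap_def elim!: eventually_mono\<close>)
  next
    case 3
    have "((\<lambda>h. kap h / h) \<longlongrightarrow> 0) (at 0)"
    proof (rule Lim_null_comparison)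
      show "\<forall>\<^sub>F h in at 0. norm (kap h / h) \<le> \<bar>h\<bar>"
        by (intro always_eventually allI) (auto simp: kap_def power2_eq_square max_def)
      show "((\<lambda>h::real. \<bar>h\<bar>) \<longlongrightarrow> 0) (at 0)" by (auto intro!: tendsto_eq_intros)
    qed
    then show ?thesis using 3 by (simp add: DERIV_def kap_def)
  qed
qed

section \<open>A compactly supported kernel with continuous derivatives\<close>

definition bump :: "real \<Rightarrow> real" where "bump s = kap (1 - s\<^sup>2)"

definition bump' :: "real \<Rightarrow> real" where "bump' s = - 4 * s * max 0 (1 - s\<^sup>2)"

lemma bump_deriv: "(bump has_real_derivative bump' s) (at s)"
proof -
  have "((\<lambda>s. 1 - s\<^sup>2) has_real_derivative - 2 * s) (at s)" by (auto intro!: derivative_eq_intros)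
  from DERIV_chain2[OF kap_deriv this] show ?thesis
    by (simp add: bump_def[abs_def] bump'_def mult_ac)
qed

lemma bump_out: "1 < \<bar>s\<bar> \<Longrightarrow> bump s = 0" "1 < \<bar>s\<bar> \<Longrightarrow> bump' s = 0"
proof -
  assume "1 < \<bar>s\<bar>"
  then have "1 < \<bar>s\<bar>\<^sup>2" by (simp only: one_less_power)
  then have "1 < s\<^sup>2" by simp
  then show "bump s = 0" "bump' s = 0" by (auto simp: bump_def bump'_def kap_def)
qed

lemma bump_bounds: "0 \<le> bump s" "bump s \<le> 1" "\<bar>bump' s\<bar> \<le> 4"
proof -
  have m: "0 \<le> max 0 (1 - s\<^sup>2)" "max 0 (1 - s\<^sup>2) \<le> 1" by auto
  show "0 \<le> bump s" by (simp add: bump_def kap_def)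
  show "bump s \<le> 1" using m by (simp add: bump_def kap_def power_le_one)
  show "\<bar>bump' s\<bar> \<le> 4"
  proof (cases "1 < \<bar>s\<bar>")
    case False
    then have "\<bar>s\<bar> * \<bar>max 0 (1 - s\<^sup>2)\<bar> \<le> 1 * 1" using m by (intro mult_mono) auto
    then show ?thesis by (simp add: bump'_def abs_mult)
  qed (simp add: bump_out)
qed

lemma continuous_bump [continuous_intros]: "continuous_on A bump" "continuous_on A bump'"
  using bump_deriv by (meson DERIV_isCont continuous_at_imp_continuous_on)
    (auto simp: bump'_def[abs_def] intro!: continuous_intros)

definition ker :: "real \<times> real \<Rightarrow> real" where "ker z = bump (fst z) * bump (snd z)"

definition kert :: "real \<times> real \<Rightarrow> real" where "kert z = bump' (fst z) * bump (snd z)"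

definition kerx :: "real \<times> real \<Rightarrow> real" where "kerx z = bump (fst z) * bump' (snd z)"

lemma ker_deriv: "(ker has_derivative (\<lambda>h. fst h * kert z + snd h * kerx z)) (at z)"
proof -
  have 1: "((\<lambda>z. bump (fst z)) has_derivative (\<lambda>h. fst h * bump' (fst z))) (at z)"
    by (rule DERIV_compose_FDERIV[OF bump_deriv]) (auto intro!: derivative_eq_intros)
  have 2: "((\<lambda>z. bump (snd z)) has_derivative (\<lambda>h. snd h * bump' (snd z))) (at z)"
    by (rule DERIV_compose_FDERIV[OF bump_deriv]) (auto intro!: derivative_eq_intros)
  show ?thesis
    unfolding ker_def[abs_def] kert_def kerx_def
    by (rule has_derivative_eq_rhs[OF has_derivative_mult[OF 1 2]]) (auto simp: algebra_simps)
qed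

lemma ker_bounds: "0 \<le> ker z" "ker z \<le> 1" "\<bar>kert z\<bar> \<le> 4" "\<bar>kerx z\<bar> \<le> 4"
  using mult_mono[OF bump_bounds(2)[of "fst z"] bump_bounds(2)[of "snd z"]]
    mult_mono[OF bump_bounds(3)[of "fst z"] bump_bounds(2)[of "snd z"]]
    mult_mono[OF bump_bounds(2)[of "fst z"] bump_bounds(3)[of "snd z"]]
    bump_bounds(1)[of "fst z"] bump_bounds(1)[of "snd z"]
  by (auto simp: ker_def kert_def kerx_def abs_mult)

lemma ker_out:
  assumes "z \<notin> {- 1..1} \<times> {- 1..1}" shows "ker z = 0" "kert z = 0" "kerx z = 0"
proof -
  have "1 < \<bar>fst z\<bar> \<or> 1 < \<bar>snd z\<bar>" using assms by (cases z) auto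
  then show "ker z = 0" "kert z = 0" "kerx z = 0" by (auto simp: ker_def kert_def kerx_def bump_out)
qed

lemma continuous_ker: "continuous_on UNIV ker" "continuous_on UNIV kert" "continuous_on UNIV kerx"
  unfolding ker_def[abs_def] kert_def[abs_def] kerx_def[abs_def]
  by (intro continuous_intros continuous_on_compose2[OF continuous_bump(1)[of UNIV]] continuous_on_compose2[OF continuous_bump(2)[of UNIV]]; simp)+

lemma ker_borel [measurable]:
  "ker \<in> borel_measurable borel" "kert \<in> borel_measurable borel" "kerx \<in> borel_measurable borel"
  using continuous_ker by (auto intro: borel_measurable_continuous_onI)

text \<open>The kernel is not normalised: the limit of the doubled inequality is the desired
  integral times this constant, and positivity suffices to cancel it.\<close>

lemma ker_integral_pos: "0 < (LINT z|lborel. ker z)"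
proof -
  have i: "integrable lborel ker"
  proof (rule integrable_bounded_support[of "{- 1..1} \<times> {- 1..1}" _ _ 1])
    show "emeasure lborel ({- 1..1} \<times> {- 1..1::real} :: (real \<times> real) set) < \<infinity>"
      by (intro emeasure_bounded_finite bounded_Times) auto
    show "AE z in lborel. \<bar>ker z\<bar> \<le> 1 * indicator ({- 1..1} \<times> {- 1..1}) z"
      using ker_bounds ker_out by (intro AE_I2) (simp add: indicator_def)
  qed (auto simp: borel_Times)
  let ?S = "{- 1 / 2<..<1 / 2} \<times> {- 1 / 2<..<1 / 2} :: (real \<times> real) set"
  have "(LINT z|lborel. ker z) \<noteq> 0"
  proof
    assume "(LINT z|lborel. ker z) = 0"
    then have "AE z in lborel. ker z = 0"
      using integral_nonneg_eq_0_iff_AE[OF i] ker_bounds(1) by simp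
    moreover have "ker z \<noteq> 0" if "z \<in> ?S" for z
    proof -
      have "bump s \<noteq> 0" if "\<bar>s\<bar> < 1" for s
      proof -
        have "\<bar>s\<bar>\<^sup>2 < 1" using that by (simp only: abs_square_less_1 power2_abs)
        then show ?thesis by (simp add: bump_def kap_def)
      qed
      then show ?thesis using that by (cases z) (auto simp: ker_def abs_less_iff)
    qed
    ultimately have "AE z in lborel. z \<notin> ?S" by (auto elim!: eventually_mono)
    then have "?S \<in> null_sets lborel" by (subst AE_iff_null_sets) (auto simp: borel_open open_Times)
    moreover have "open ?S" "?S \<noteq> {}" by (auto intro!: open_Times)
    ultimately show False using open_not_negligible[of ?S] by (auto simp: negligible_iff_null_sets null_sets_completionI)
  qed
  moreover have "0 \<le> (LINT z|lborel. ker z)" by (rule Bochner_Integration.integral_nonneg) (simp add: ker_bounds)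
  ultimately show ?thesis by simp
qed

lemma lborel_integral_affine:
  fixes F :: "'a::euclidean_space \<Rightarrow> real"
  assumes [measurable]: "F \<in> borel_measurable borel" and c: "c \<noteq> 0"
  shows "(LINT x|lborel. F x) = \<bar>c\<bar> ^ DIM('a) * (LINT x|lborel. F (t + c *\<^sub>R x))"
proof -
  have "(LINT x|lborel. F x) = (LINT x|density (distr lborel borel (\<lambda>x. t + c *\<^sub>R x)) (\<lambda>_. ennreal (\<bar>c\<bar> ^ DIM('a))). F x)"
    by (subst lborel_affine[OF c, of t]) (simp add: ennreal_power)
  also have "\<dots> = (LINT x|distr lborel borel (\<lambda>x. t + c *\<^sub>R x). \<bar>c\<bar> ^ DIM('a) * F x)"
    by (subst integral_density) auto
  also have "\<dots> = (LINT x|lborel. \<bar>c\<bar> ^ DIM('a) * F (t + c *\<^sub>R x))"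
    by (subst integral_distr) auto
  finally show ?thesis by simp
qed

lemma AE_fst:
  fixes P :: "'a::euclidean_space \<Rightarrow> bool"
  assumes "AE x in lborel. P x"
  shows "AE p in (lborel :: ('a \<times> 'b::euclidean_space) measure). P (fst p)"
proof -
  obtain N where N: "N \<in> null_sets lborel" "{x. \<not> P x} \<subseteq> N"
    using assms by (auto simp: eventually_ae_filter)
  have [measurable]: "N \<in> sets borel" using N(1) by auto
  have "AE p in (lborel :: 'a measure) \<Otimes>\<^sub>M (lborel :: 'b measure). fst p \<notin> N"
  proof (rule lborel_pair.AE_pair_measure)
    show "{p \<in> space ((lborel :: 'a measure) \<Otimes>\<^sub>M (lborel :: 'b measure)). fst p \<notin> N} \<in> sets (lborel \<Otimes>\<^sub>M lborel)"
      by measurable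
    show "AE x in (lborel :: 'a measure). AE y in (lborel :: 'b measure). fst (x, y) \<notin> N"
      using AE_not_in[OF N(1)] by eventually_elim simp
  qed
  then show ?thesis unfolding lborel_prod by eventually_elim (use N(2) in auto)
qed

section \<open>Kruzkov's inequality between two entropy solutions\<close>

context convex_flux
begin

text \<open>Kruzkov's entropy flux between two states, written without \<open>sgn\<close> so that
  its continuity and symmetry are visible.\<close>

definition flux_diff :: "real \<Rightarrow> real \<Rightarrow> real" where
  "flux_diff a b = f (max a b) - f (min a b)"

lemma flux_diff_sgn: "sgn (a - b) * (f a - f b) = flux_diff a b"
  by (auto simp: sgn_if max_def min_def flux_diff_def)

lemma flux_diff_commute: "flux_diff a b = flux_diff b a"
  by (simp add: flux_diff_def max.commute min.commute)

lemma flux_diff_borel [measurable (raw)]: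
  assumes [measurable]: "u \<in> borel_measurable M" "v \<in> borel_measurable M"
  shows "(\<lambda>x. flux_diff (u x) (v x)) \<in> borel_measurable M"
  unfolding flux_diff_def by measurable

lemma flux_diff_tendsto:
  assumes "(v \<longlongrightarrow> b) F" shows "((\<lambda>x. flux_diff a (v x)) \<longlongrightarrow> flux_diff a b) F"
proof -
  have cf: "isCont f y" for y using continuous_f[of UNIV] by (simp add: continuous_on_eq_continuous_at)
  show ?thesis unfolding flux_diff_def by (intro tendsto_intros isCont_tendsto_compose[OF cf] assms)
qed

text \<open>Kruzkov's inequalities over the whole plane for explicitly given partial derivatives, so
  that test functions built by formulas can be inserted without
  \<open>frechet_derivative\<close>.\<close>

definition entropic :: "real \<Rightarrow> (real \<times> real \<Rightarrow> real) \<Rightarrow> bool" where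
  "entropic T u \<longleftrightarrow> (\<forall>k \<phi> \<phi>t \<phi>x a b R B. test_function T \<phi> \<phi>t \<phi>x a b R B \<longrightarrow> (\<forall>z. 0 \<le> \<phi> z) \<longrightarrow>
     0 \<le> (LINT z|lborel. \<bar>u z - k\<bar> * \<phi>t z + flux_diff (u z) k * \<phi>x z))"

lemma entropicD:
  assumes "entropic T u" "test_function T \<phi> \<phi>t \<phi>x a b R B" "\<And>z. 0 \<le> \<phi> z"
  shows "0 \<le> (LINT z|lborel. \<bar>u z - k\<bar> * \<phi>t z + flux_diff (u z) k * \<phi>x z)"
  using assms unfolding entropic_def by blast

text \<open>The test function is \<open>\<psi> z\<close> times a kernel of width \<open>e\<close> in
  \<open>z - \<zeta>\<close>. With \<open>\<zeta>\<close> frozen, \<open>v \<zeta>\<close> is a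
  constant for the inequality of \<open>u\<close>; with \<open>z\<close> frozen, \<open>u z\<close>
  is one for that of \<open>v\<close>. In the sum the derivatives of the kernel cancel, as it
  depends on the difference only. Since \<open>\<psi>\<close> sits at \<open>z\<close>, rescaling
  displaces \<open>v\<close> alone, and its continuity almost everywhere gives the limit.\<close>

theorem kruzkov_doubling:
  assumes [measurable]: "u \<in> borel_measurable borel" "v \<in> borel_measurable borel"
    and le: "\<And>z. \<bar>u z\<bar> \<le> M" "\<And>z. \<bar>v z\<bar> \<le> M"
    and ent: "entropic T u" "entropic T v"
    and cont_v: "AE z in lborel. z \<in> {0<..<T} \<times> UNIV \<longrightarrow> isCont v z"
    and tf: "test_function T \<psi> \<psi>t \<psi>x a b R B" and \<psi>0: "\<And>z. 0 \<le> \<psi> z"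
  shows "0 \<le> (LINT z|lborel. \<bar>u z - v z\<bar> * \<psi>t z + flux_diff (u z) (v z) * \<psi>x z)"
proof -
  interpret test_function T \<psi> \<psi>t \<psi>x a b R B by (rule tf)
  obtain F where F: "\<And>y. \<bar>y\<bar> \<le> M \<Longrightarrow> \<bar>f y\<bar> \<le> F" using f_bounded_on by blast
  have M0: "0 \<le> M" using le(1)[of 0] by linarith
  have F0: "0 \<le> F" using F[of 0] M0 by auto
  have q: "\<bar>flux_diff x y\<bar> \<le> 2 * F" if "\<bar>x\<bar> \<le> M" "\<bar>y\<bar> \<le> M" for x y
    using F[of "max x y"] F[of "min x y"] that by (auto simp: flux_diff_def max_def min_def)
  have uv: "\<bar>\<bar>u z - v \<zeta>\<bar>\<bar> \<le> 2 * M" for z \<zeta> using le(1)[of z] le(2)[of \<zeta>] by auto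
  have quv: "\<bar>flux_diff (u z) (v \<zeta>)\<bar> \<le> 2 * F" for z \<zeta> using q le by blast
  have pair_bound: "\<bar>\<bar>u z - v \<zeta>\<bar> * x + flux_diff (u z) (v \<zeta>) * y\<bar> \<le> 2 * M * X + 2 * F * X"
    if "\<bar>x\<bar> \<le> X" "\<bar>y\<bar> \<le> X" for z \<zeta> x y X
  proof -
    have "\<bar>\<bar>u z - v \<zeta>\<bar> * x\<bar> \<le> 2 * M * X"
      unfolding abs_mult by (rule mult_mono[OF uv that(1)]) (use M0 in auto)
    moreover have "\<bar>flux_diff (u z) (v \<zeta>) * y\<bar> \<le> 2 * F * X"
      unfolding abs_mult by (rule mult_mono[OF quv that(2)]) (use F0 in auto)
    ultimately show ?thesis by linarith
  qed
  let ?box = "{a..b} \<times> {- R..R}" and ?sq = "{- 1..1} \<times> {- 1..1} :: (real \<times> real) set"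
  \<comment> \<open>The integrand after rescaling, in the variables
    \<open>p = (z, \<omega>)\<close>: \<open>u\<close> is taken at \<open>z\<close>, and
    \<open>q p\<close> stands for the value of \<open>v\<close> at the displaced point. The kernel
    no longer involves \<open>e\<close>.\<close>
  define W where "W q p = (\<bar>u (fst p) - q p\<bar> * \<psi>t (fst p) + flux_diff (u (fst p)) (q p) * \<psi>x (fst p)) * ker (snd p)"
    for q and p :: "(real \<times> real) \<times> real \<times> real"
  have box_sq: "?box \<times> ?sq \<in> sets lborel" "emeasure lborel (?box \<times> ?sq) < \<infinity>"
    by (simp add: borel_Times) (intro emeasure_bounded_finite bounded_Times; simp)
  have W_meas: "W (\<lambda>p. v (fst p + k *\<^sub>R snd p)) \<in> borel_measurable lborel" for k
  proof -
    have "W (\<lambda>p. v (fst p + k *\<^sub>R snd p)) \<in> borel_measurable (borel \<Otimes>\<^sub>M borel)"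
      unfolding W_def[abs_def] by measurable
    then show ?thesis by (simp add: borel_prod)
  qed
  have W_bound: "AE p in lborel. \<bar>W (\<lambda>p. v (fst p + k *\<^sub>R snd p)) p\<bar> \<le> (2 * M * B + 2 * F * B) * indicator (?box \<times> ?sq) p" for k
  proof (rule AE_I2)
    fix p :: "(real \<times> real) \<times> real \<times> real"
    let ?W = "W (\<lambda>p. v (fst p + k *\<^sub>R snd p)) p"
    have "\<bar>?W\<bar> \<le> (2 * M * B + 2 * F * B) * 1"
      unfolding W_def abs_mult[of _ "ker _"]
      by (intro mult_mono pair_bound bound) (use ker_bounds M0 F0 B0 in auto)
    moreover have "?W = 0" if "p \<notin> ?box \<times> ?sq"
      using that support[of "fst p"] ker_out[of "snd p"] unfolding W_def mem_Times_iff[of p] by auto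
    ultimately show "\<bar>?W\<bar> \<le> (2 * M * B + 2 * F * B) * indicator (?box \<times> ?sq) p"
      by (cases "p \<in> ?box \<times> ?sq") (simp_all del: mem_Times_iff)
  qed
  have W_int: "integrable lborel (W (\<lambda>p. v (fst p + k *\<^sub>R snd p)))" for k
    by (rule integrable_bounded_support[OF box_sq W_meas W_bound])
  have W_fubini: "(LINT p|lborel. W (\<lambda>p. v (fst p + k *\<^sub>R snd p)) p)
      = (LINT z|lborel. LINT \<omega>|lborel. W (\<lambda>p. v (fst p + k *\<^sub>R snd p)) (z, \<omega>))" for k
    using lborel_pair.integral_fst'[of "W (\<lambda>p. v (fst p + k *\<^sub>R snd p))", unfolded lborel_prod, OF W_int] by simp
  define I where "I e = (LINT p|lborel. W (\<lambda>p. v (fst p + (- e) *\<^sub>R snd p)) p)" for e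
  have I_nonneg: "0 \<le> I e" if e: "0 < e" "e < a" "b + e < T" for e
  proof -
    define K where "K p = ker ((fst p - snd p) /\<^sub>R e)" for p
    define Kt where "Kt p = kert ((fst p - snd p) /\<^sub>R e) / e" for p
    define Kx where "Kx p = kerx ((fst p - snd p) /\<^sub>R e) / e" for p
    have [measurable]: "K \<in> borel_measurable (borel \<Otimes>\<^sub>M borel)" "Kt \<in> borel_measurable (borel \<Otimes>\<^sub>M borel)"
      "Kx \<in> borel_measurable (borel \<Otimes>\<^sub>M borel)"
      unfolding K_def[abs_def] Kt_def[abs_def] Kx_def[abs_def] by measurable
    have K: "0 \<le> K p" "K p \<le> 1" "\<bar>Kt p\<bar> \<le> 4 / e" "\<bar>Kx p\<bar> \<le> 4 / e" for p
      using ker_bounds[of "(fst p - snd p) /\<^sub>R e"] e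
      by (auto simp: K_def Kt_def Kx_def abs_divide intro!: divide_right_mono)
    \<comment> \<open>\<open>H\<close> is the integrand for \<open>u\<close> in the variable
      \<open>z\<close>, and \<open>J\<close> below that for \<open>v\<close> in the variable
      \<open>\<zeta>\<close>. Differentiating the kernel in its second argument changes the sign, so
      \<open>Kt\<close> and \<open>Kx\<close> drop out of \<open>H + J\<close>.\<close>
    define H where "H p = \<bar>u (fst p) - v (snd p)\<bar> * (\<psi>t (fst p) * K p + \<psi> (fst p) * Kt p)
        + flux_diff (u (fst p)) (v (snd p)) * (\<psi>x (fst p) * K p + \<psi> (fst p) * Kx p)" for p
    define J where "J p = \<bar>u (fst p) - v (snd p)\<bar> * (- \<psi> (fst p) * Kt p)
        + flux_diff (u (fst p)) (v (snd p)) * (- \<psi> (fst p) * Kx p)" for p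
    \<comment> \<open>It contains all \<open>\<zeta>\<close> within reach \<open>e\<close> of the
      box of \<open>\<psi>\<close>. The test function in \<open>\<zeta>\<close> lives here, hence
      the conditions \<open>e < a\<close> and \<open>b + e < T\<close>.\<close>
    let ?box2 = "{a - e..b + e} \<times> {- (R + e)..R + e}"
    have far: "K (z, \<zeta>) = 0 \<and> Kt (z, \<zeta>) = 0 \<and> Kx (z, \<zeta>) = 0" if "z \<in> ?box" "\<zeta> \<notin> ?box2" for z \<zeta>
    proof -
      have "(z - \<zeta>) /\<^sub>R e \<notin> {- 1..1} \<times> {- 1..1}"
      proof
        assume "(z - \<zeta>) /\<^sub>R e \<in> {- 1..1} \<times> {- 1..1}"
        then have "\<bar>(fst z - fst \<zeta>) / e\<bar> \<le> 1" "\<bar>(snd z - snd \<zeta>) / e\<bar> \<le> 1"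
          by (auto simp: mem_Times_iff divide_inverse mult.commute abs_le_iff)
        then have "\<bar>fst z - fst \<zeta>\<bar> \<le> e" "\<bar>snd z - snd \<zeta>\<bar> \<le> e"
          using e by (auto simp: abs_divide pos_divide_le_eq)
        then show False using that by (auto simp: mem_Times_iff abs_le_iff)
      qed
      from ker_out[OF this] show ?thesis by (simp add: K_def Kt_def Kx_def)
    qed
    have vanish: "H p = 0 \<and> J p = 0" if "p \<notin> ?box \<times> ?box2" for p
    proof (cases "fst p \<in> ?box")
      case True
      then show ?thesis using far[of "fst p" "snd p"] that by (auto simp: H_def J_def mem_Times_iff)
    next
      case False
      then show ?thesis using support[OF False] by (simp add: H_def J_def)
    qed
    define X where "X = B + B * (4 / e)"
    have X: "\<bar>\<psi>' * K p + \<psi> (fst p) * k\<bar> \<le> X" if "\<bar>\<psi>'\<bar> \<le> B" "\<bar>k\<bar> \<le> 4 / e" for \<psi>' k p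
    proof -
      have "\<bar>\<psi>' * K p\<bar> \<le> B * 1" unfolding abs_mult using K that B0 by (intro mult_mono) auto
      moreover have "\<bar>\<psi> (fst p) * k\<bar> \<le> B * (4 / e)" unfolding abs_mult using bound(1)[of "fst p"] that B0
        by (intro mult_mono) auto
      ultimately show ?thesis by (simp add: X_def)
    qed
    have int: "integrable lborel W" if "W \<in> borel_measurable (borel \<Otimes>\<^sub>M borel)" "\<And>p. \<bar>W p\<bar> \<le> C" "\<And>p. p \<notin> ?box \<times> ?box2 \<Longrightarrow> W p = 0"
      for W :: "(real \<times> real) \<times> (real \<times> real) \<Rightarrow> real" and C
    proof (rule integrable_bounded_support[of "?box \<times> ?box2" _ _ C])
      show "emeasure lborel (?box \<times> ?box2) < \<infinity>" by (intro emeasure_bounded_finite bounded_Times) auto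
      show "?box \<times> ?box2 \<in> sets lborel" by (simp add: borel_Times)
      show "W \<in> borel_measurable lborel" using that(1) by (simp add: borel_prod)
      show "AE p in lborel. \<bar>W p\<bar> \<le> C * indicator (?box \<times> ?box2) p"
        using that(2,3) by (intro AE_I2) (simp add: indicator_def del: mem_Times_iff)
    qed
    have H_int: "integrable lborel H"
    proof (rule int)
      show "H \<in> borel_measurable (borel \<Otimes>\<^sub>M borel)" unfolding H_def[abs_def] by measurable
      show "\<bar>H p\<bar> \<le> 2 * M * X + 2 * F * X" for p
        unfolding H_def by (intro pair_bound X K bound)
    qed (use vanish in blast)
    have J_int: "integrable lborel J"
    proof (rule int)
      show "J \<in> borel_measurable (borel \<Otimes>\<^sub>M borel)" unfolding J_def[abs_def] by measurable
      have neg: "\<bar>- \<psi> (fst p) * k\<bar> \<le> X" if "\<bar>k\<bar> \<le> 4 / e" for k and p :: "(real \<times> real) \<times> real \<times> real"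
        using X[of 0 k p] that B0 by simp
      show "\<bar>J p\<bar> \<le> 2 * M * X + 2 * F * X" for p
        unfolding J_def by (intro pair_bound neg K)
    qed (use vanish in blast)
    have ker_shift: "((\<lambda>z. ker ((s *\<^sub>R z - y) /\<^sub>R e)) has_derivative
        (\<lambda>h. fst h * (s * (kert ((s *\<^sub>R z - y) /\<^sub>R e) / e)) + snd h * (s * (kerx ((s *\<^sub>R z - y) /\<^sub>R e) / e)))) (at z)" for s y z
    proof -
      have "((\<lambda>z. (s *\<^sub>R z - y) /\<^sub>R e) has_derivative (\<lambda>h. (s *\<^sub>R h) /\<^sub>R e)) (at z)"
        by (auto intro!: derivative_eq_intros)
      from diff_chain_at[OF this ker_deriv]
      have "((\<lambda>z. ker ((s *\<^sub>R z - y) /\<^sub>R e)) has_derivative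
        (\<lambda>h. fst ((s *\<^sub>R h) /\<^sub>R e) * kert ((s *\<^sub>R z - y) /\<^sub>R e) + snd ((s *\<^sub>R h) /\<^sub>R e) * kerx ((s *\<^sub>R z - y) /\<^sub>R e))) (at z)"
        unfolding o_def .
      then show ?thesis by (rule has_derivative_eq_rhs) (simp add: divide_inverse mult_ac)
    qed
    have H_nonneg: "0 \<le> (LINT p|lborel. H p)"
    proof -
      have "0 \<le> (LINT z|lborel. H (z, \<zeta>))" for \<zeta>
      proof -
        have "test_function T (\<lambda>z. \<psi> z * K (z, \<zeta>)) (\<lambda>z. \<psi>t z * K (z, \<zeta>) + \<psi> z * Kt (z, \<zeta>))
            (\<lambda>z. \<psi>x z * K (z, \<zeta>) + \<psi> z * Kx (z, \<zeta>)) a b R (max B X)"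
        proof
          fix z
          have "((\<lambda>z. K (z, \<zeta>)) has_derivative (\<lambda>h. fst h * Kt (z, \<zeta>) + snd h * Kx (z, \<zeta>))) (at z)"
            using ker_shift[of 1 \<zeta> z] by (simp add: K_def Kt_def Kx_def)
          from has_derivative_mult[OF deriv[of z] this]
          show "((\<lambda>z. \<psi> z * K (z, \<zeta>)) has_derivative (\<lambda>h. fst h * (\<psi>t z * K (z, \<zeta>) + \<psi> z * Kt (z, \<zeta>))
              + snd h * (\<psi>x z * K (z, \<zeta>) + \<psi> z * Kx (z, \<zeta>)))) (at z)"
            by (rule has_derivative_eq_rhs) (simp add: algebra_simps)
        next
          have c: "continuous_on UNIV (\<lambda>z. G ((z - \<zeta>) /\<^sub>R e))" if "continuous_on UNIV G" for G :: "real \<times> real \<Rightarrow> real"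
            by (rule continuous_on_compose2[OF that]) (auto intro!: continuous_intros)
          show "continuous_on UNIV (\<lambda>z. \<psi>t z * K (z, \<zeta>) + \<psi> z * Kt (z, \<zeta>))"
            "continuous_on UNIV (\<lambda>z. \<psi>x z * K (z, \<zeta>) + \<psi> z * Kx (z, \<zeta>))"
            unfolding K_def Kt_def Kx_def fst_conv snd_conv using e
            by (intro continuous_intros cont cont_phi c continuous_ker; simp)+
          show "z \<notin> ?box \<Longrightarrow> \<psi> z * K (z, \<zeta>) = 0 \<and> \<psi>t z * K (z, \<zeta>) + \<psi> z * Kt (z, \<zeta>) = 0
              \<and> \<psi>x z * K (z, \<zeta>) + \<psi> z * Kx (z, \<zeta>) = 0" for z
            using support[of z] by simp
          fix z
          show "\<bar>\<psi>t z * K (z, \<zeta>) + \<psi> z * Kt (z, \<zeta>)\<bar> \<le> max B X" "\<bar>\<psi>x z * K (z, \<zeta>) + \<psi> z * Kx (z, \<zeta>)\<bar> \<le> max B X"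
            using X[of "\<psi>t z" "Kt (z, \<zeta>)" "(z, \<zeta>)"] X[of "\<psi>x z" "Kx (z, \<zeta>)" "(z, \<zeta>)"] K bound[of z] by auto
          have "\<bar>\<psi> z * K (z, \<zeta>)\<bar> \<le> B * 1" unfolding abs_mult
            using K[of "(z, \<zeta>)"] bound[of z] B0 by (intro mult_mono) auto
          then show "\<bar>\<psi> z * K (z, \<zeta>)\<bar> \<le> max B X" by simp
        qed (use ab R0 in auto)
        from entropicD[OF ent(1) this, of "v \<zeta>"] show ?thesis using \<psi>0 K by (simp add: H_def)
      qed
      then have "0 \<le> (LINT \<zeta>|lborel. LINT z|lborel. H (z, \<zeta>))" by (rule Bochner_Integration.integral_nonneg)
      then show ?thesis
        using lborel_pair.integral_snd[of "\<lambda>z \<zeta>. H (z, \<zeta>)"] H_int unfolding lborel_prod by simp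
    qed
    have J_nonneg: "0 \<le> (LINT p|lborel. J p)"
    proof -
      have "0 \<le> (LINT \<zeta>|lborel. J (z, \<zeta>))" for z
      proof -
        have "test_function T (\<lambda>\<zeta>. \<psi> z * K (z, \<zeta>)) (\<lambda>\<zeta>. - \<psi> z * Kt (z, \<zeta>)) (\<lambda>\<zeta>. - \<psi> z * Kx (z, \<zeta>))
           (a - e) (b + e) (R + e) (max B X)"
        proof
          fix \<zeta>
          have "((\<lambda>\<zeta>. K (z, \<zeta>)) has_derivative (\<lambda>h. fst h * - Kt (z, \<zeta>) + snd h * - Kx (z, \<zeta>))) (at \<zeta>)"
            using ker_shift[of "-1" "- z" \<zeta>] by (simp add: K_def Kt_def Kx_def)
          from has_derivative_mult_right[OF this, of "\<psi> z"]
          show "((\<lambda>\<zeta>. \<psi> z * K (z, \<zeta>)) has_derivative (\<lambda>h. fst h * (- \<psi> z * Kt (z, \<zeta>)) + snd h * (- \<psi> z * Kx (z, \<zeta>)))) (at \<zeta>)"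
            by (rule has_derivative_eq_rhs) (simp add: algebra_simps)
        next
          have c: "continuous_on UNIV (\<lambda>\<zeta>. G ((z - \<zeta>) /\<^sub>R e))" if "continuous_on UNIV G" for G :: "real \<times> real \<Rightarrow> real"
            by (rule continuous_on_compose2[OF that]) (auto intro!: continuous_intros)
          show "continuous_on UNIV (\<lambda>\<zeta>. - \<psi> z * Kt (z, \<zeta>))" "continuous_on UNIV (\<lambda>\<zeta>. - \<psi> z * Kx (z, \<zeta>))"
            unfolding K_def Kt_def Kx_def fst_conv snd_conv using e
            by (intro continuous_intros c continuous_ker; simp)+
          show "\<zeta> \<notin> ?box2 \<Longrightarrow> \<psi> z * K (z, \<zeta>) = 0 \<and> - \<psi> z * Kt (z, \<zeta>) = 0 \<and> - \<psi> z * Kx (z, \<zeta>) = 0" for \<zeta>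
            using far[of z \<zeta>] support[of z] by (cases "z \<in> ?box") auto
          fix \<zeta>
          show "\<bar>- \<psi> z * Kt (z, \<zeta>)\<bar> \<le> max B X" "\<bar>- \<psi> z * Kx (z, \<zeta>)\<bar> \<le> max B X"
            using X[of 0 "Kt (z, \<zeta>)" "(z, \<zeta>)"] X[of 0 "Kx (z, \<zeta>)" "(z, \<zeta>)"] K B0 by auto
          have "\<bar>\<psi> z * K (z, \<zeta>)\<bar> \<le> B * 1" unfolding abs_mult
            using K[of "(z, \<zeta>)"] bound[of z] B0 by (intro mult_mono) auto
          then show "\<bar>\<psi> z * K (z, \<zeta>)\<bar> \<le> max B X" by simp
        qed (use ab R0 e in auto)
        from entropicD[OF ent(2) this, of "u z"] show ?thesis
          using \<psi>0 K by (simp add: J_def flux_diff_commute[of "v _"] abs_minus_commute[of "v _"])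
      qed
      then have "0 \<le> (LINT z|lborel. LINT \<zeta>|lborel. J (z, \<zeta>))" by (rule Bochner_Integration.integral_nonneg)
      then show ?thesis
        using lborel_pair.integral_fst'[of J] J_int unfolding lborel_prod by simp
    qed
    let ?E = "\<lambda>z \<zeta>. \<bar>u z - v \<zeta>\<bar> * \<psi>t z + flux_diff (u z) (v \<zeta>) * \<psi>x z"
    have "0 \<le> (LINT p|lborel. H p + J p)" using H_nonneg J_nonneg H_int J_int by simp
    also have "(\<lambda>p. H p + J p) = (\<lambda>p. ?E (fst p) (snd p) * K p)"
      by (auto simp: H_def J_def algebra_simps)
    also have "(LINT p|lborel. ?E (fst p) (snd p) * K p) = (LINT z|lborel. LINT \<zeta>|lborel. ?E z \<zeta> * K (z, \<zeta>))"
    proof -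
      have "integrable lborel (\<lambda>p. ?E (fst p) (snd p) * K p)"
        using Bochner_Integration.integrable_add[OF H_int J_int] by (simp add: H_def J_def algebra_simps)
      from lborel_pair.integral_fst'[of "\<lambda>p. ?E (fst p) (snd p) * K p", unfolded lborel_prod, OF this] show ?thesis by simp
    qed
    \<comment> \<open>The substitution of \<open>z - e * \<omega>\<close> for \<open>\<zeta>\<close>
      in the plane has Jacobian \<open>e\<^sup>2\<close>, a positive factor that does not affect the
      sign.\<close>
    also have "(\<lambda>z. LINT \<zeta>|lborel. ?E z \<zeta> * K (z, \<zeta>)) = (\<lambda>z. e\<^sup>2 * (LINT \<omega>|lborel. ?E z (z + (- e) *\<^sub>R \<omega>) * ker \<omega>))"
    proof
      fix z
      have [measurable]: "(\<lambda>\<zeta>. K (z, \<zeta>)) \<in> borel_measurable borel" by (simp add: K_def)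
      have k: "K (z, z + (- e) *\<^sub>R \<omega>) = ker \<omega>" for \<omega> using e by (simp add: K_def)
      have "(LINT \<zeta>|lborel. ?E z \<zeta> * K (z, \<zeta>)) = \<bar>- e\<bar> ^ DIM(real \<times> real) * (LINT \<omega>|lborel. ?E z (z + (- e) *\<^sub>R \<omega>) * K (z, z + (- e) *\<^sub>R \<omega>))"
        by (rule lborel_integral_affine) (use e in auto)
      then show "(LINT \<zeta>|lborel. ?E z \<zeta> * K (z, \<zeta>)) = e\<^sup>2 * (LINT \<omega>|lborel. ?E z (z + (- e) *\<^sub>R \<omega>) * ker \<omega>)"
        unfolding k by (simp add: power2_eq_square)
    qed
    also have "(LINT z|lborel. e\<^sup>2 * (LINT \<omega>|lborel. ?E z (z + (- e) *\<^sub>R \<omega>) * ker \<omega>)) = e\<^sup>2 * I e"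
      using W_fubini[of "- e"] by (simp add: I_def W_def)
    finally show ?thesis using e by (simp add: zero_le_mult_iff)
  qed
  define I0 where "I0 = (LINT p|lborel. W (\<lambda>p. v (fst p + 0 *\<^sub>R snd p)) p)"
  \<comment> \<open>Half the smaller distance from \<open>a\<close> and \<open>b\<close> to the ends
    of the time interval, so that every \<open>e n \<le> d\<close> is an admissible width.\<close>
  define d where "d = min a (T - b) / 2"
  have d: "0 < d" "d < a" "b + d < T" using ab by (auto simp: d_def min_def field_simps)
  define e where "e n = d * inverse (real (Suc n))" for n
  have e: "0 < e n" "e n < a" "b + e n < T" for n
  proof -
    show "0 < e n" using d by (simp add: e_def)
    have "e n \<le> d * 1" unfolding e_def using d by (intro mult_left_mono) (auto simp: field_simps)
    then show "e n < a" "b + e n < T" using d by simp_all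
  qed
  have e0: "e \<longlonglongrightarrow> 0" unfolding e_def[abs_def] using tendsto_mult_right_zero[OF LIMSEQ_inverse_real_of_nat] by simp
  have "(\<lambda>n. I (e n)) \<longlonglongrightarrow> I0"
    unfolding I_def I0_def
  proof (rule bounded_convergence[OF box_sq W_meas W_meas W_bound])
    show "AE p in lborel. (\<lambda>n. W (\<lambda>p. v (fst p + (- e n) *\<^sub>R snd p)) p) \<longlonglongrightarrow> W (\<lambda>p. v (fst p + 0 *\<^sub>R snd p)) p"
      using AE_fst[OF cont_v]
    proof eventually_elim
      case (elim p)
      show ?case
      proof (cases "fst p \<in> ?box")
        case True
        then have "isCont v (fst p)" using elim ab by (auto simp: mem_Times_iff)
        moreover have "(\<lambda>n. fst p + (- e n) *\<^sub>R snd p) \<longlonglongrightarrow> fst p + (- 0) *\<^sub>R snd p" by (intro tendsto_intros e0)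
        ultimately have "(\<lambda>n. v (fst p + (- e n) *\<^sub>R snd p)) \<longlonglongrightarrow> v (fst p)"
          by (intro isCont_tendsto_compose[of "fst p" v]) auto
        then show ?thesis unfolding W_def scaleR_zero_left add_0_right by (intro tendsto_intros flux_diff_tendsto)
      next
        case False
        then show ?thesis using support[OF False] by (simp add: W_def)
      qed
    qed
  qed
  then have "0 \<le> I0" by (rule LIMSEQ_le_const) (use I_nonneg e in auto)
  also have "I0 = (LINT z|lborel. \<bar>u z - v z\<bar> * \<psi>t z + flux_diff (u z) (v z) * \<psi>x z) * (LINT z|lborel. ker z)"
    unfolding I0_def W_fubini by (simp add: W_def)
  finally show ?thesis using ker_integral_pos by (simp add: zero_le_mult_iff)
qed

end

section \<open>Uniqueness\<close>

text \<open>Half the second difference of \<open>kap\<close>: a smooth step from 0 at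
  \<open>- 1\<close> to 1 at \<open>1\<close>. Its derivative \<open>hat\<close> is the tent
  function of integral 1.\<close>

definition step :: "real \<Rightarrow> real" where "step s = (kap (s + 1) - 2 * kap s + kap (s - 1)) / 2"

definition hat :: "real \<Rightarrow> real" where "hat s = max 0 (s + 1) - 2 * max 0 s + max 0 (s - 1)"

lemma step_deriv: "(step has_real_derivative hat s) (at s)"
proof -
  have "((\<lambda>s. kap (s + e)) has_real_derivative 2 * max 0 (s + e)) (at s)" for e
  proof -
    have "((\<lambda>s. s + e) has_real_derivative 1) (at s)" by (auto intro!: derivative_eq_intros)
    from DERIV_chain2[OF kap_deriv this] show ?thesis by simp
  qed
  from DERIV_cdivide[OF DERIV_add[OF DERIV_diff[OF this[of 1] DERIV_cmult[OF kap_deriv]] this[of "-1"]], of 2 2]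
  have "(step has_real_derivative (2 * max 0 (s + 1) - 2 * (2 * max 0 s) + 2 * max 0 (s + - 1)) / 2) (at s)"
    by (simp add: step_def[abs_def])
  moreover have "(2 * max 0 (s + 1) - 2 * (2 * max 0 s) + 2 * max 0 (s + - 1)) / 2 = hat s"
    by (simp add: hat_def)
  ultimately show ?thesis by simp
qed

lemma hat_nonneg: "0 \<le> hat s"
  by (auto simp: hat_def max_def)

lemma hat_out: "1 \<le> \<bar>s\<bar> \<Longrightarrow> hat s = 0"
  by (auto simp: hat_def max_def)

lemma step_values: "s \<le> - 1 \<Longrightarrow> step s = 0" "1 \<le> s \<Longrightarrow> step s = 1"
  by (auto simp: step_def kap_def max_def power2_eq_square algebra_simps)

lemma step_mono: "s \<le> t \<Longrightarrow> step s \<le> step t"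
  by (rule DERIV_nonneg_imp_nondecreasing) (use step_deriv hat_nonneg in blast)+

lemma continuous_hat: "continuous_on A hat"
  unfolding hat_def[abs_def] by (intro continuous_intros)

text \<open>The hypothesis \<open>test\<close> says in the weak sense that \<open>D\<close> does not
  increase. A plateau function \<open>\<eta>\<close> that rises near 0 and falls near
  \<open>T\<close> has a tent near 0 minus a tent near \<open>T\<close> as its derivative, so it
  compares an average of \<open>D\<close> near 0, below \<open>d / 3\<close>, with one near
  \<open>T\<close>, above \<open>2 * d / 3\<close>.\<close>

lemma zero_of_nonincreasing:
  fixes D :: "real \<Rightarrow> real"
  assumes T: "0 < T" and cont: "continuous_on {0..T} D" and D0: "D 0 = 0" and pos: "0 \<le> D T"
    and test: "\<And>\<eta> \<eta>' p q. \<lbrakk>0 < p; p < q; q < T; \<And>t. (\<eta> has_real_derivative \<eta>' t) (at t);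
      continuous_on UNIV \<eta>'; \<And>t. 0 \<le> \<eta> t; \<And>t. t \<notin> {p..q} \<Longrightarrow> \<eta> t = 0 \<and> \<eta>' t = 0\<rbrakk>
      \<Longrightarrow> 0 \<le> integral {0..T} (\<lambda>t. \<eta>' t * D t)"
  shows "D T = 0"
proof (rule ccontr)
  assume "D T \<noteq> 0"
  then have d: "0 < D T" using pos by simp
  define d where "d = D T"
  have "\<exists>\<delta>>0. \<forall>s\<in>{0..T}. \<bar>s - t\<bar> < \<delta> \<longrightarrow> \<bar>D s - D t\<bar> < d / 3" if "t \<in> {0..T}" for t
    using cont that d unfolding continuous_on_iff d_def dist_real_def by (metis zero_less_divide_iff zero_less_numeral)
  note near = this
  obtain \<delta>1 where "\<delta>1 > 0" "\<And>s. s \<in> {0..T} \<Longrightarrow> \<bar>s - 0\<bar> < \<delta>1 \<Longrightarrow> \<bar>D s - D 0\<bar> < d / 3"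
    using near[of 0] T by force
  then have \<delta>1: "\<delta>1 > 0" "\<And>s. s \<in> {0..T} \<Longrightarrow> s < \<delta>1 \<Longrightarrow> D s < d / 3"
    by (force simp: D0 abs_less_iff)+
  obtain \<delta>2 where "\<delta>2 > 0" "\<And>s. s \<in> {0..T} \<Longrightarrow> \<bar>s - T\<bar> < \<delta>2 \<Longrightarrow> \<bar>D s - D T\<bar> < d / 3"
    using near[of T] T by force
  note \<delta>2' = this
  have \<delta>2: "\<delta>2 > 0" "\<And>s. s \<in> {0..T} \<Longrightarrow> T - s < \<delta>2 \<Longrightarrow> 2 * d / 3 < D s"
  proof -
    show "\<delta>2 > 0" by (rule \<delta>2')
    fix s assume s: "s \<in> {0..T}" "T - s < \<delta>2"
    then have "\<bar>D s - d\<bar> < d / 3" using \<delta>2'(2)[of s] by (simp add: d_def)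
    then show "2 * d / 3 < D s" by linarith
  qed
  define \<delta> where "\<delta> = min (min \<delta>1 \<delta>2) (T / 2)"
  have \<delta>: "0 < \<delta>" "\<delta> \<le> \<delta>1" "\<delta> \<le> \<delta>2" "\<delta> \<le> T / 2" using \<delta>1(1) \<delta>2(1) T by (auto simp: \<delta>_def)
  \<comment> \<open>Tents of half-width \<open>l\<close> around \<open>p = 2 * l\<close> and
    \<open>q = T - 2 * l\<close> stay within \<open>\<delta> = 4 * l\<close> of the two ends, and
    \<open>\<eta>\<close> vanishes off \<open>{l..T - l}\<close>, strictly inside the time
    interval.\<close>
  define l p q where "l = \<delta> / 4" and "p = \<delta> / 2" and "q = T - \<delta> / 2"
  have l: "0 < l" "p = 2 * l" "q = T - 2 * l" "\<delta> = 4 * l" using \<delta> by (auto simp: l_def p_def q_def)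
  have pq: "p < q" using \<delta> by (simp add: p_def q_def)
  define \<alpha> where "\<alpha> r t = hat ((t - r) / l) / l" for r t
  define \<sigma> where "\<sigma> r t = step ((t - r) / l)" for r t
  have \<sigma>: "(\<sigma> r has_real_derivative \<alpha> r t) (at t)" for r t
  proof -
    have "((\<lambda>t. (t - r) / l) has_real_derivative 1 / l) (at t)" using l by (auto intro!: derivative_eq_intros)
    from DERIV_chain2[OF step_deriv this] show ?thesis by (simp add: \<alpha>_def \<sigma>_def[abs_def])
  qed
  have c\<alpha>: "continuous_on A (\<alpha> r)" for r A
    unfolding \<alpha>_def[abs_def] using l by (intro continuous_intros continuous_on_compose2[OF continuous_hat[of UNIV]]) auto
  have \<alpha>0: "0 \<le> \<alpha> r t" for r t using hat_nonneg l by (simp add: \<alpha>_def)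
  have \<alpha>_out: "\<alpha> r t = 0" if "l \<le> \<bar>t - r\<bar>" for r t
    using hat_out[of "(t - r) / l"] that l by (simp add: \<alpha>_def abs_divide pos_le_divide_eq)
  have \<sigma>_lo: "\<sigma> r t = 0" if "t \<le> r - l" for r t
    using that l unfolding \<sigma>_def by (intro step_values) (simp add: pos_divide_le_eq)
  have \<sigma>_hi: "\<sigma> r t = 1" if "r + l \<le> t" for r t
    using that l unfolding \<sigma>_def by (intro step_values) (simp add: pos_le_divide_eq)
  have \<alpha>_int: "(\<alpha> r has_integral 1) {0..T}" if "r \<in> {p, q}" for r
  proof -
    have "(\<alpha> r has_integral \<sigma> r T - \<sigma> r 0) {0..T}"
      using T \<sigma> by (intro fundamental_theorem_of_calculus)
        (auto simp: has_real_derivative_iff_has_vector_derivative[symmetric] intro: has_field_derivative_at_within)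
    moreover have "\<sigma> r T = 1" "\<sigma> r 0 = 0" using that l pq by (auto intro!: \<sigma>_lo \<sigma>_hi)
    ultimately show ?thesis by simp
  qed
  have "0 \<le> integral {0..T} (\<lambda>t. (\<alpha> p t - \<alpha> q t) * D t)"
  proof (rule test[of l "T - l" "\<lambda>t. \<sigma> p t - \<sigma> q t"])
    show "((\<lambda>t. \<sigma> p t - \<sigma> q t) has_real_derivative \<alpha> p t - \<alpha> q t) (at t)" for t
      by (rule DERIV_diff[OF \<sigma> \<sigma>])
    show "continuous_on UNIV (\<lambda>t. \<alpha> p t - \<alpha> q t)" by (intro continuous_intros c\<alpha>)
    show "0 \<le> \<sigma> p t - \<sigma> q t" for t
      using step_mono[of "(t - q) / l" "(t - p) / l"] pq l by (simp add: \<sigma>_def divide_right_mono)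
    fix t assume "t \<notin> {l..T - l}"
    then consider "t < l" | "T - l < t" by force
    then show "\<sigma> p t - \<sigma> q t = 0 \<and> \<alpha> p t - \<alpha> q t = 0"
    proof cases
      case 1
      then show ?thesis using l pq \<sigma>_lo[of t p] \<sigma>_lo[of t q] \<alpha>_out[of t p] \<alpha>_out[of t q] by auto
    next
      case 2
      then show ?thesis using l pq \<sigma>_hi[of p t] \<sigma>_hi[of q t] \<alpha>_out[of t p] \<alpha>_out[of t q] by auto
    qed
  qed (use l pq in auto)
  moreover have "integral {0..T} (\<lambda>t. (\<alpha> p t - \<alpha> q t) * D t) \<le> d / 3 - 2 * d / 3"
  proof -
    have i: "(\<lambda>t. \<alpha> r t * D t) integrable_on {0..T}" for r
      by (intro integrable_continuous_real continuous_intros c\<alpha> cont)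
    have "integral {0..T} (\<lambda>t. \<alpha> p t * D t) \<le> integral {0..T} (\<lambda>t. \<alpha> p t * (d / 3))"
    proof (rule integral_le[OF i])
      show "(\<lambda>t. \<alpha> p t * (d / 3)) integrable_on {0..T}"
        by (intro integrable_continuous_real continuous_intros c\<alpha>)
      fix t assume t: "t \<in> {0..T}"
      show "\<alpha> p t * D t \<le> \<alpha> p t * (d / 3)"
      proof (cases "l \<le> \<bar>t - p\<bar>")
        case False
        then have "D t < d / 3" using t l \<delta> by (intro \<delta>1(2)) (auto simp: abs_le_iff)
        then show ?thesis using \<alpha>0[of p t] by (intro mult_left_mono) auto
      qed (simp add: \<alpha>_out)
    qed
    moreover have "integral {0..T} (\<lambda>t. \<alpha> q t * (2 * d / 3)) \<le> integral {0..T} (\<lambda>t. \<alpha> q t * D t)"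
    proof (rule integral_le[OF _ i])
      show "(\<lambda>t. \<alpha> q t * (2 * d / 3)) integrable_on {0..T}"
        by (intro integrable_continuous_real continuous_intros c\<alpha>)
      fix t assume t: "t \<in> {0..T}"
      show "\<alpha> q t * (2 * d / 3) \<le> \<alpha> q t * D t"
      proof (cases "l \<le> \<bar>t - q\<bar>")
        case False
        then have "2 * d / 3 < D t" using t l \<delta> by (intro \<delta>2(2)) (auto simp: abs_le_iff)
        then show ?thesis using \<alpha>0[of q t] by (intro mult_left_mono) auto
      qed (simp add: \<alpha>_out)
    qed
    moreover have "integral {0..T} (\<lambda>t. \<alpha> p t * (d / 3)) = d / 3" "integral {0..T} (\<lambda>t. \<alpha> q t * (2 * d / 3)) = 2 * d / 3"
      using integral_unique[OF \<alpha>_int[of p]] integral_unique[OF \<alpha>_int[of q]] by simp_all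
    moreover have "integral {0..T} (\<lambda>t. (\<alpha> p t - \<alpha> q t) * D t)
        = integral {0..T} (\<lambda>t. \<alpha> p t * D t) - integral {0..T} (\<lambda>t. \<alpha> q t * D t)"
      using Henstock_Kurzweil_Integration.integral_diff[OF i i] by (simp add: left_diff_distrib)
    ultimately show ?thesis by linarith
  qed
  ultimately show False using d by (simp add: d_def)
qed

lemma (in test_function) in_C1c: "\<phi> \<in> C1c ({0<..<T} \<times> UNIV)"
proof -
  have f: "frechet_derivative \<phi> (at z) h = fst h * \<phi>t z + snd h * \<phi>x z" for z h
    by (rule frechet_direction[OF deriv])
  let ?box = "{a..b} \<times> {- R..R}"
  have cb: "compact ?box" by (intro compact_Times compact_Icc)
  have "{z. \<phi> z \<noteq> 0} \<subseteq> ?box" using support by blast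
  then have sub: "closure {z. \<phi> z \<noteq> 0} \<subseteq> ?box"
    using closure_minimal[OF _ compact_imp_closed[OF cb]] by blast
  then have "compact (closure {z. \<phi> z \<noteq> 0})"
    using compact_Int_closed[OF cb closed_closure, of "{z. \<phi> z \<noteq> 0}"] by (simp add: Int_absorb1)
  moreover have "closure {z. \<phi> z \<noteq> 0} \<subseteq> {0<..<T} \<times> UNIV" using sub ab by fastforce
  moreover have "\<phi> differentiable_on UNIV"
    unfolding differentiable_on_def differentiable_def using deriv by blast
  moreover have "continuous_on UNIV (\<lambda>z. frechet_derivative \<phi> (at z) h)" for h
    unfolding f by (intro continuous_intros cont)
  ultimately show ?thesis unfolding C1c_def by blast
qed

section \<open>Comparison with an arbitrary entropy solution\<close>

context convex_flux
begin

text \<open>\<open>deriv f\<close> is increasing, so its modulus on \<open>{- N..N}\<close> is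
  largest at an endpoint. The constant is the maximal speed of propagation for states bounded by
  \<open>N\<close>.\<close>

lemma flux_diff_le:
  assumes "\<bar>x\<bar> \<le> N" "\<bar>y\<bar> \<le> N"
  shows "\<bar>flux_diff x y\<bar> \<le> max \<bar>deriv f N\<bar> \<bar>deriv f (- N)\<bar> * \<bar>x - y\<bar>"
proof -
  have *: "\<bar>f q - f p\<bar> \<le> max \<bar>deriv f N\<bar> \<bar>deriv f (- N)\<bar> * \<bar>q - p\<bar>" if "p \<in> {- N..N}" "q \<in> {- N..N}" for p q
  proof -
    have "norm (f q - f p) \<le> max \<bar>deriv f N\<bar> \<bar>deriv f (- N)\<bar> * norm (q - p)"
    proof (rule field_differentiable_bound[of "{- N..N}" f "deriv f"])
      show "(f has_real_derivative deriv f z) (at z within {- N..N})" for z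
        using f_deriv by (rule has_field_derivative_at_within)
      show "norm (deriv f z) \<le> max \<bar>deriv f N\<bar> \<bar>deriv f (- N)\<bar>" if "z \<in> {- N..N}" for z
        using f1_mono[of "- N" z] f1_mono[of z N] that by auto
    qed (use that in auto)
    then show ?thesis by simp
  qed
  have "\<bar>flux_diff x y\<bar> \<le> max \<bar>deriv f N\<bar> \<bar>deriv f (- N)\<bar> * \<bar>max x y - min x y\<bar>"
    unfolding flux_diff_def by (rule *) (use assms in \<open>auto simp: min_def max_def abs_le_iff\<close>)
  also have "\<bar>max x y - min x y\<bar> = \<bar>x - y\<bar>" by auto
  finally show ?thesis .
qed

text \<open>The inequalities see \<open>u\<close> only almost everywhere inside the open strip, so a
  solution may be exchanged for a Borel function on the plane with pointwise bounds, as
  \<open>kruzkov_doubling\<close> requires.\<close>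

lemma entropic_of_solution:
  assumes u: "weak_entropy_solution f T u" and [measurable]: "v \<in> borel_measurable borel"
    and eq: "AE z in lborel. z \<in> {0<..<T} \<times> UNIV \<longrightarrow> v z = u z"
  shows "entropic T v"
  unfolding entropic_def
proof (intro allI impI)
  fix k \<phi> \<phi>t \<phi>x a b R B assume tf: "test_function T \<phi> \<phi>t \<phi>x a b R B" and pos: "\<forall>z. 0 \<le> \<phi> z"
  interpret test_function T \<phi> \<phi>t \<phi>x a b R B by (rule tf)
  define u1 where "u1 z = indicator ({0..T} \<times> UNIV) z *\<^sub>R u z" for z
  have "({0..T} \<times> UNIV) \<inter> space lborel \<in> sets (lborel :: (real \<times> real) measure)" by (simp add: borel_Times)
  then have [measurable]: "u1 \<in> borel_measurable borel"
    using u borel_measurable_restrict_space_iff[of "{0..T} \<times> UNIV" lborel u]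
    by (simp add: weak_entropy_solution_def Linf_on_def u1_def[abs_def])
  let ?Q = "{0<..<T} \<times> UNIV :: (real \<times> real) set"
  have Q: "?Q \<in> sets borel" by (intro borel_open open_Times) auto
  have f: "frechet_derivative \<phi> (at z) (1, 0) = \<phi>t z" "frechet_derivative \<phi> (at z) (0, 1) = \<phi>x z" for z
    by (simp_all add: frechet_direction[OF deriv])
  have "0 \<le> (LINT z:?Q|lborel. \<bar>u z - k\<bar> * \<phi>t z + sgn (u z - k) * (f (u z) - f k) * \<phi>x z)"
    using u in_C1c pos unfolding weak_entropy_solution_def f[symmetric] by blast
  also have "\<dots> = (LINT z|lborel. indicator ?Q z *\<^sub>R (\<bar>u1 z - k\<bar> * \<phi>t z + flux_diff (u1 z) k * \<phi>x z))"
    unfolding set_lebesgue_integral_def flux_diff_sgn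
    by (intro Bochner_Integration.integral_cong refl) (auto simp: indicator_def u1_def)
  also have "\<dots> = (LINT z|lborel. \<bar>v z - k\<bar> * \<phi>t z + flux_diff (v z) k * \<phi>x z)"
  proof (rule integral_cong_AE)
    have [measurable]: "?Q \<in> sets borel" by (rule Q)
    show "(\<lambda>z. indicat_real ?Q z *\<^sub>R (\<bar>u1 z - k\<bar> * \<phi>t z + flux_diff (u1 z) k * \<phi>x z)) \<in> borel_measurable lborel"
      by measurable
    show "(\<lambda>z. \<bar>v z - k\<bar> * \<phi>t z + flux_diff (v z) k * \<phi>x z) \<in> borel_measurable lborel" by measurable
    show "AE z in lborel. indicat_real ?Q z *\<^sub>R (\<bar>u1 z - k\<bar> * \<phi>t z + flux_diff (u1 z) k * \<phi>x z)
        = \<bar>v z - k\<bar> * \<phi>t z + flux_diff (v z) k * \<phi>x z"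
      using eq
    proof eventually_elim
      case (elim z)
      show ?case
      proof (cases "z \<in> ?Q")
        case True
        then show ?thesis using elim by (auto simp: u1_def)
      next
        case False
        then have "z \<notin> {a..b} \<times> {- R..R}" using ab by auto
        then show ?thesis using support[of z] False by simp
      qed
    qed
  qed
  finally show "0 \<le> (LINT z|lborel. \<bar>v z - k\<bar> * \<phi>t z + flux_diff (v z) k * \<phi>x z)" .
qed

text \<open>The cone test function \<open>kap (\<rho> - sqrt (1 + x\<^sup>2) - A t)\<close> shrinks at the maximal speed \<open>A\<close>, so
  that the flux term in the doubled entropy inequality is absorbed by its time derivative.\<close>

theorem entropy_solution_unique:
  assumes u: "weak_entropy_solution f T u" and T: "0 < T"
    and w: "ess_bounded M w" and init: "AE x in lborel. u (0, x) = w x"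
  shows "AE x in lborel. u (T, x) = sol w (T, x)"
proof -
  define u1 where "u1 z = indicator ({0..T} \<times> UNIV) z *\<^sub>R u z" for z
  have "({0..T} \<times> UNIV) \<inter> space lborel \<in> sets (lborel :: (real \<times> real) measure)" by (simp add: borel_Times)
  then have u1 [measurable]: "u1 \<in> borel_measurable borel"
    using u borel_measurable_restrict_space_iff[of "{0..T} \<times> UNIV" lborel u]
    by (simp add: weak_entropy_solution_def Linf_on_def u1_def[abs_def])
  obtain M' where M': "AE z\<in>{0..T} \<times> UNIV in lborel. \<bar>u z\<bar> \<le> M'"
    using u by (auto simp: weak_entropy_solution_def Linf_on_def)
  define N where "N = max M M'"
  have N0: "0 \<le> N" using ess_bounded_nonneg[OF w] by (simp add: N_def)
  let ?Q = "{0<..<T} \<times> UNIV :: (real \<times> real) set"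
  have [measurable]: "?Q \<in> sets borel" by (intro borel_open open_Times) auto
  \<comment> \<open>Truncation at \<open>N\<close> turns the essential bound into a pointwise one
    and changes \<open>u\<close> inside the strip on a null set only.\<close>
  define U where "U z = (if z \<in> ?Q \<and> \<bar>u1 z\<bar> \<le> N then u1 z else 0)" for z
  have U [measurable]: "U \<in> borel_measurable borel" unfolding U_def[abs_def] by measurable
  have U_le: "\<bar>U z\<bar> \<le> N" for z using N0 by (simp add: U_def)
  have U_eq: "AE z in lborel. z \<in> ?Q \<longrightarrow> U z = u z"
    using M' by eventually_elim (auto simp: U_def u1_def N_def)
  \<comment> \<open>Zero replaces the datum at nonpositive times: \<open>w\<close> is bounded almost
    everywhere, \<open>vel\<close> at every point of positive time.\<close>
  define V where "V z = (if 0 < fst z then sol w z else 0)" for z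
  have V: "V \<in> borel_measurable borel"
  proof -
    have "V = (\<lambda>z. if 0 < fst z then vel (prim w) (fst z) (snd z) else 0)" by (auto simp: V_def[abs_def] sol_def)
    then show ?thesis using vel_borel[OF prim_lipschitz[OF w]] by simp
  qed
  note [measurable] = V
  have V_le: "\<bar>V z\<bar> \<le> N" for z
    using vel_bound[OF prim_lipschitz[OF w], of "fst z" "snd z"] N0 by (auto simp: V_def sol_def N_def)
  have entU: "entropic T U" by (rule entropic_of_solution[OF u U U_eq])
  have entV: "entropic T V"
    by (rule entropic_of_solution[OF weak_entropy_solution_sol[OF w T] V]) (auto simp: V_def)
  have contV: "AE z in lborel. z \<in> ?Q \<longrightarrow> isCont V z"
    using AE_uniq_pair[OF prim_lipschitz[OF w]]
  proof eventually_elim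
    case (elim z)
    show ?case
    proof
      assume "z \<in> ?Q"
      then have z: "0 < fst z" by auto
      with isCont_sol[OF w z, of "snd z"] elim have "isCont (sol w) z" by simp
      moreover have "\<forall>\<^sub>F y in nhds z. y \<in> {y. 0 < fst y}"
        using z by (intro eventually_nhds_in_open open_Collect_less continuous_intros) auto
      then have "\<forall>\<^sub>F y in nhds z. V y = sol w y" by eventually_elim (simp add: V_def)
      ultimately show "isCont V z" by (simp add: isCont_cong)
    qed
  qed
  define A where "A = max \<bar>deriv f N\<bar> \<bar>deriv f (- N)\<bar>"
  have A0: "0 \<le> A" by (auto simp: A_def)
  have u_int: "set_integrable lborel {- \<rho>..\<rho>} (\<lambda>x. u (t, x))" if "t \<in> {0..T}" for \<rho> t
    using u that by (auto simp: weak_entropy_solution_def C0_L1loc_def)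
  have v_int: "set_integrable lborel {- \<rho>..\<rho>} (\<lambda>x. sol w (t, x))" for \<rho> t
    using ess_bounded_loc_int[OF ess_bounded_sol[OF w]] by (auto simp: loc_int_def)
  have cone: "AE x in lborel. sqrt (1 + x\<^sup>2) + A * T < \<rho> \<longrightarrow> u (T, x) = sol w (T, x)" if \<rho>: "0 < \<rho>" for \<rho>
  proof -
    \<comment> \<open>\<open>sqrt (1 + x\<^sup>2)\<close> is a smooth substitute for the modulus of
      \<open>x\<close>; its slope \<open>sg\<close> has modulus at most 1, so \<open>A\<close> times
      the spatial slope of \<open>r\<close> never outweighs the decay \<open>A\<close> in
      time.\<close>
    define r where "r z = \<rho> - sqrt (1 + (snd z)\<^sup>2) - A * fst z" for z :: "real \<times> real"
    define \<Gamma> where "\<Gamma> z = kap (r z)" for z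
    define \<gamma> where "\<gamma> z = 2 * max 0 (r z)" for z
    define sg where "sg x = x / sqrt (1 + x\<^sup>2)" for x :: real
    have sq: "1 \<le> sqrt (1 + x\<^sup>2)" "\<bar>x\<bar> \<le> sqrt (1 + x\<^sup>2)" for x :: real
      by (auto simp: real_le_rsqrt)
    have sg1: "\<bar>sg x\<bar> \<le> 1" for x
    proof -
      have p: "0 < sqrt (1 + x\<^sup>2)" using sq(1)[of x] by linarith
      have "\<bar>x\<bar> / sqrt (1 + x\<^sup>2) \<le> 1" using sq(2)[of x] by (simp only: pos_divide_le_eq[OF p] mult_1)
      then show ?thesis using p by (simp add: sg_def)
    qed
    have r_deriv: "(r has_derivative (\<lambda>h. fst h * (- A) + snd h * (- sg (snd z)))) (at z)" for z
    proof -
      have "((\<lambda>x. sqrt (1 + x\<^sup>2)) has_real_derivative sg x) (at x)" for x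
      proof -
        have "0 < 1 + x\<^sup>2" by (simp add: add_pos_nonneg)
        then show ?thesis by (auto intro!: derivative_eq_intros simp: sg_def field_simps)
      qed
      from DERIV_compose_FDERIV[OF this has_derivative_snd[OF has_derivative_ident]]
      have "((\<lambda>z::real \<times> real. sqrt (1 + (snd z)\<^sup>2)) has_derivative (\<lambda>h. snd h * sg (snd z))) (at z)" .
      then have "((\<lambda>z. \<rho> - sqrt (1 + (snd z)\<^sup>2) - A * fst z) has_derivative (\<lambda>h. 0 - snd h * sg (snd z) - A * fst h)) (at z)"
        by (intro derivative_intros) (auto intro!: derivative_eq_intros)
      then show ?thesis unfolding r_def[abs_def] by (rule has_derivative_eq_rhs) (auto simp: algebra_simps)
    qed
    have r_cont: "continuous_on UNIV r"
      using r_deriv by (meson has_derivative_continuous continuous_at_imp_continuous_on)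
    have \<Gamma>_deriv: "(\<Gamma> has_derivative (\<lambda>h. fst h * (- A * \<gamma> z) + snd h * (- sg (snd z) * \<gamma> z))) (at z)" for z
      unfolding \<Gamma>_def[abs_def] \<gamma>_def
      by (rule has_derivative_eq_rhs[OF DERIV_compose_FDERIV[OF kap_deriv r_deriv]]) (auto simp: algebra_simps)
    have \<Gamma>_cont: "continuous_on UNIV \<Gamma>"
      using \<Gamma>_deriv by (meson has_derivative_continuous continuous_at_imp_continuous_on)
    have \<gamma>_cont: "continuous_on UNIV \<gamma>"
      unfolding \<gamma>_def[abs_def] by (intro continuous_intros r_cont)
    have sg_cont: "continuous_on UNIV sg"
      unfolding sg_def[abs_def] by (intro continuous_intros) (use sq(1) in \<open>force simp: add_nonneg_eq_0_iff\<close>)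
    have \<Gamma>0: "0 \<le> \<Gamma> z" "0 \<le> \<gamma> z" for z by (auto simp: \<Gamma>_def \<gamma>_def kap_def)
    have r_le: "r (t, x) \<le> \<rho>" if "0 \<le> t" for t x
      using sq(1)[of x] mult_nonneg_nonneg[OF A0 that] unfolding r_def fst_conv snd_conv by linarith
    have \<Gamma>_le: "\<Gamma> (t, x) \<le> \<rho>\<^sup>2" "\<gamma> (t, x) \<le> 2 * \<rho>" if "0 \<le> t" for t x
      using r_le[OF that, of x] \<rho> by (auto simp: \<Gamma>_def \<gamma>_def kap_def max_def intro!: power_mono)
    have \<Gamma>_out: "\<Gamma> (t, x) = 0 \<and> \<gamma> (t, x) = 0" if "0 \<le> t" "x \<notin> {- \<rho>..\<rho>}" for t x
    proof -
      have "\<rho> < \<bar>x\<bar>" using that by auto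
      then have "r (t, x) \<le> 0" using sq(2)[of x] mult_nonneg_nonneg[OF A0 that(1)]
        unfolding r_def fst_conv snd_conv by linarith
      then show ?thesis by (simp add: \<Gamma>_def \<gamma>_def kap_def)
    qed
    have [measurable]: "(\<lambda>x. \<Gamma> (t, x)) \<in> borel_measurable borel" for t
      by (intro borel_measurable_continuous_onI continuous_on_compose2[OF \<Gamma>_cont] continuous_intros) auto
    have \<Gamma>_lip: "\<bar>\<Gamma> (s, x) - \<Gamma> (t, x)\<bar> \<le> A * (2 * \<rho>) * \<bar>s - t\<bar>" if "s \<in> {0..T}" "t \<in> {0..T}" for s t x
    proof -
      have "norm (\<Gamma> (s, x) - \<Gamma> (t, x)) \<le> A * (2 * \<rho>) * norm (s - t)"
      proof (rule field_differentiable_bound[of "{0..T}" "\<lambda>t. \<Gamma> (t, x)" "\<lambda>t. - A * \<gamma> (t, x)"])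
        show "((\<lambda>t. \<Gamma> (t, x)) has_real_derivative - A * \<gamma> (t, x)) (at t within {0..T})" for t
        proof -
          have "((\<lambda>t. (t, x)) has_derivative (\<lambda>h. (h, 0))) (at t)" by (auto intro!: derivative_eq_intros)
          from diff_chain_at[OF this \<Gamma>_deriv] have "((\<lambda>t. \<Gamma> (t, x)) has_real_derivative - A * \<gamma> (t, x)) (at t)"
            unfolding o_def has_field_derivative_def by (rule has_derivative_eq_rhs) (simp add: fun_eq_iff)
          then show ?thesis by (rule has_field_derivative_at_within)
        qed
        show "norm (- A * \<gamma> (t, x)) \<le> A * (2 * \<rho>)" if "t \<in> {0..T}" for t
          using \<Gamma>_le(2)[of t x] \<Gamma>0(2)[of "(t, x)"] A0 that by (auto simp: abs_mult intro!: mult_left_mono)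
      qed (use that in auto)
      then show ?thesis by simp
    qed
    \<comment> \<open>The slices of \<open>u\<close> itself are used here, not those of
      \<open>U\<close>: continuity in time and the traces at 0 and \<open>T\<close> concern every
      single slice of \<open>u\<close>, whereas \<open>U\<close> agrees with it only almost
      everywhere in the plane.\<close>
    define D where "D t = (LINT x|lborel. \<bar>u (t, x) - sol w (t, x)\<bar> * \<Gamma> (t, x))" for t
    have w_int: "integrable lborel (\<lambda>x. indicator {- \<rho>..\<rho>} x * \<bar>a x - b x\<bar>)"
      if "set_integrable lborel {- \<rho>..\<rho>} a" "set_integrable lborel {- \<rho>..\<rho>} b" for a b :: "real \<Rightarrow> real"
    proof -
      have "integrable lborel (\<lambda>x. \<bar>indicator {- \<rho>..\<rho>} x * a x - indicator {- \<rho>..\<rho>} x * b x\<bar>)"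
        using that unfolding set_integrable_def real_scaleR_def by (intro integrable_abs Bochner_Integration.integrable_diff)
      also have "(\<lambda>x. \<bar>indicator {- \<rho>..\<rho>} x * a x - indicator {- \<rho>..\<rho>} x * b x\<bar>) = (\<lambda>x. indicator {- \<rho>..\<rho>} x * \<bar>a x - b x\<bar>)"
        by (auto simp: indicator_def)
      finally show ?thesis .
    qed
    have G_int: "integrable lborel (\<lambda>x. \<bar>a x - b x\<bar> * \<Gamma> (s, x))"
      if "set_integrable lborel {- \<rho>..\<rho>} a" "set_integrable lborel {- \<rho>..\<rho>} b" "0 \<le> s" for a b :: "real \<Rightarrow> real" and s
    proof (rule Bochner_Integration.integrable_bound[OF integrable_mult_right[OF w_int[OF that(1,2)], of "\<rho>\<^sup>2"]])
      have "(\<lambda>x. (indicator {- \<rho>..\<rho>} x * \<bar>a x - b x\<bar>) * \<Gamma> (s, x)) \<in> borel_measurable lborel"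
        using borel_measurable_integrable[OF w_int[OF that(1,2)]] by measurable
      also have "(\<lambda>x. (indicator {- \<rho>..\<rho>} x * \<bar>a x - b x\<bar>) * \<Gamma> (s, x)) = (\<lambda>x. \<bar>a x - b x\<bar> * \<Gamma> (s, x))"
      proof
        fix x
        show "(indicator {- \<rho>..\<rho>} x * \<bar>a x - b x\<bar>) * \<Gamma> (s, x) = \<bar>a x - b x\<bar> * \<Gamma> (s, x)"
          by (cases "x \<in> {- \<rho>..\<rho>}") (use \<Gamma>_out[OF that(3), of x] in simp_all)
      qed
      finally show "(\<lambda>x. \<bar>a x - b x\<bar> * \<Gamma> (s, x)) \<in> borel_measurable lborel" .
      show "AE x in lborel. norm (\<bar>a x - b x\<bar> * \<Gamma> (s, x)) \<le> norm (\<rho>\<^sup>2 * (indicator {- \<rho>..\<rho>} x * \<bar>a x - b x\<bar>))"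
      proof (rule AE_I2)
        fix x
        show "norm (\<bar>a x - b x\<bar> * \<Gamma> (s, x)) \<le> norm (\<rho>\<^sup>2 * (indicator {- \<rho>..\<rho>} x * \<bar>a x - b x\<bar>))"
        proof (cases "x \<in> {- \<rho>..\<rho>}")
          case True
          then show ?thesis
            using \<Gamma>_le(1)[OF that(3), of x] \<Gamma>0(1)[of "(s, x)"] by (simp add: abs_mult mult.commute[of _ "\<Gamma> _"] mult_right_mono)
        qed (use \<Gamma>_out[OF that(3)] in simp)
      qed
    qed
    have D_cont: "continuous_on {0..T} D"
      unfolding continuous_on_def
    proof
      fix t assume t: "t \<in> {0..T}"
      let ?K = "{- \<rho>..\<rho>}"
      let ?C = "LINT x:?K|lborel. \<bar>u (t, x) - sol w (t, x)\<bar>"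
      let ?a = "\<lambda>s. LINT x:?K|lborel. \<bar>u (s, x) - u (t, x)\<bar>"
      let ?b = "\<lambda>s. LINT x:?K|lborel. \<bar>sol w (s, x) - sol w (t, x)\<bar>"
      \<comment> \<open>Three sources of variation: the slices of \<open>u\<close>, those of
        \<open>sol w\<close>, and the weight, which is Lipschitz in time.\<close>
      have le: "\<bar>D s - D t\<bar> \<le> \<rho>\<^sup>2 * ?a s + \<rho>\<^sup>2 * ?b s + A * (2 * \<rho>) * \<bar>s - t\<bar> * ?C" if s: "s \<in> {0..T}" for s
      proof -
        have s0: "0 \<le> s" "0 \<le> t" using s t by auto
        let ?m = "\<lambda>x. \<rho>\<^sup>2 * (indicator ?K x * \<bar>u (s, x) - u (t, x)\<bar>)
            + \<rho>\<^sup>2 * (indicator ?K x * \<bar>sol w (s, x) - sol w (t, x)\<bar>)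
            + A * (2 * \<rho>) * \<bar>s - t\<bar> * (indicator ?K x * \<bar>u (t, x) - sol w (t, x)\<bar>)"
        let ?d = "\<lambda>x. \<bar>u (s, x) - sol w (s, x)\<bar> * \<Gamma> (s, x) - \<bar>u (t, x) - sol w (t, x)\<bar> * \<Gamma> (t, x)"
        have e1: "D s - D t = (LINT x|lborel. ?d x)"
          unfolding D_def by (rule Bochner_Integration.integral_diff[symmetric]) (intro G_int u_int v_int s t s0)+
        have e2: "\<bar>LINT x|lborel. ?d x\<bar>
          \<le> (LINT x|lborel. ?m x)"
        proof (rule order_trans[OF integral_abs_bound integral_mono])
          show "integrable lborel (\<lambda>x. \<bar>?d x\<bar>)"
            by (intro integrable_abs Bochner_Integration.integrable_diff G_int u_int v_int s t s0)
          show "integrable lborel ?m"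
            by (intro Bochner_Integration.integrable_add integrable_mult_right w_int u_int v_int s t)
          fix x
          show "\<bar>?d x\<bar>
            \<le> ?m x"
          proof (cases "x \<in> ?K")
            case True
            let ?p = "\<bar>u (s, x) - sol w (s, x)\<bar>" and ?q = "\<bar>u (t, x) - sol w (t, x)\<bar>"
            have "\<bar>?p * \<Gamma> (s, x) - ?q * \<Gamma> (t, x)\<bar> = \<bar>(?p - ?q) * \<Gamma> (s, x) + ?q * (\<Gamma> (s, x) - \<Gamma> (t, x))\<bar>"
              by (simp add: algebra_simps)
            also have "\<dots> \<le> \<bar>?p - ?q\<bar> * \<Gamma> (s, x) + ?q * \<bar>\<Gamma> (s, x) - \<Gamma> (t, x)\<bar>"
              using \<Gamma>0(1)[of "(s, x)"] by (intro order_trans[OF abs_triangle_ineq]) (simp add: abs_mult)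
            also have "\<dots> \<le> (\<bar>u (s, x) - u (t, x)\<bar> + \<bar>sol w (s, x) - sol w (t, x)\<bar>) * \<rho>\<^sup>2 + ?q * (A * (2 * \<rho>) * \<bar>s - t\<bar>)"
              by (intro add_mono mult_mono \<Gamma>_le \<Gamma>_lip s t s0 \<Gamma>0) auto
            finally show ?thesis using True by (simp add: algebra_simps)
          next
            case False
            then show ?thesis using \<Gamma>_out[OF s0(1) False] \<Gamma>_out[OF s0(2) False] by simp
          qed
        qed
        have e3: "(LINT x|lborel. ?m x)
          = \<rho>\<^sup>2 * ?a s + \<rho>\<^sup>2 * ?b s + A * (2 * \<rho>) * \<bar>s - t\<bar> * ?C"
          by (subst Bochner_Integration.integral_add,
              (intro Bochner_Integration.integrable_add integrable_mult_right w_int u_int v_int s t)+,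
              subst Bochner_Integration.integral_add,
              (intro integrable_mult_right w_int u_int v_int s t)+)
            (simp add: set_lebesgue_integral_def)
        show ?thesis unfolding e1 e3[symmetric] by (rule e2)
      qed
      have C0: "(?a \<longlongrightarrow> 0) (at t within {0..T})"
        using u t compact_Icc[of "- \<rho>" \<rho>] unfolding weak_entropy_solution_def C0_L1loc_def by simp
      have "(?b \<longlongrightarrow> 0) (at t within {0..T})"
        using C0_L1loc_sol[OF w, of T] t compact_Icc[of "- \<rho>" \<rho>] unfolding C0_L1loc_def by simp
      with C0 have "((\<lambda>s. \<rho>\<^sup>2 * ?a s + \<rho>\<^sup>2 * ?b s + A * (2 * \<rho>) * \<bar>s - t\<bar> * ?C)
          \<longlongrightarrow> \<rho>\<^sup>2 * 0 + \<rho>\<^sup>2 * 0 + A * (2 * \<rho>) * \<bar>t - t\<bar> * ?C) (at t within {0..T})"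
        by (intro tendsto_intros)
      then have "((\<lambda>s. \<rho>\<^sup>2 * ?a s + \<rho>\<^sup>2 * ?b s + A * (2 * \<rho>) * \<bar>s - t\<bar> * ?C) \<longlongrightarrow> 0) (at t within {0..T})"
        by simp
      then have "((\<lambda>s. D s - D t) \<longlongrightarrow> 0) (at t within {0..T})"
        by (rule Lim_null_comparison[rotated]) (use le in \<open>auto simp: eventually_at_filter\<close>)
      then show "(D \<longlongrightarrow> D t) (at t within {0..T})" by (rule LIM_zero_cancel)
    qed
    have D_nonneg: "0 \<le> D t" for t
      unfolding D_def by (rule Bochner_Integration.integral_nonneg) (simp add: \<Gamma>0)
    have "D T = 0"
    proof (rule zero_of_nonincreasing[OF T D_cont _ D_nonneg])
      show "D 0 = 0"
        unfolding D_def by (rule integral_eq_zero_AE) (use init in \<open>auto simp: sol_def elim!: eventually_mono\<close>)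
      fix \<eta> \<eta>' :: "real \<Rightarrow> real" and p q
      assume pq: "0 < p" "p < q" "q < T" and \<eta>: "\<And>t. (\<eta> has_real_derivative \<eta>' t) (at t)"
        and \<eta>'c: "continuous_on UNIV \<eta>'" and \<eta>0: "\<And>t. 0 \<le> \<eta> t"
        and \<eta>_out: "\<And>t. t \<notin> {p..q} \<Longrightarrow> \<eta> t = 0 \<and> \<eta>' t = 0"
      have \<eta>c: "continuous_on UNIV \<eta>"
        using \<eta> by (meson DERIV_isCont continuous_at_imp_continuous_on)
      have bdd: "\<exists>C. \<forall>t. \<bar>h t\<bar> \<le> C" if h: "continuous_on UNIV h" "\<And>t. t \<notin> {p..q} \<Longrightarrow> h t = 0" for h :: "real \<Rightarrow> real"
      proof -
        have "bounded (h ` {p..q})"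
          by (rule compact_imp_bounded[OF compact_continuous_image[OF continuous_on_subset[OF h(1)] compact_Icc]]) simp
        then obtain C where C: "\<forall>t\<in>{p..q}. \<bar>h t\<bar> \<le> C" by (auto simp: bounded_iff)
        have "\<bar>h t\<bar> \<le> max C 0" for t using C h(2)[of t] by (cases "t \<in> {p..q}") force+
        then show ?thesis by blast
      qed
      obtain E E' where E: "\<And>t. \<bar>\<eta> t\<bar> \<le> E" and E': "\<And>t. \<bar>\<eta>' t\<bar> \<le> E'"
        using bdd[OF \<eta>c] bdd[OF \<eta>'c] \<eta>_out by metis
      have E0: "0 \<le> E" "0 \<le> E'" using E[of 0] E'[of 0] by auto
      have [measurable]: "\<eta> \<in> borel_measurable borel" "\<eta>' \<in> borel_measurable borel"
        using \<eta>c \<eta>'c by (auto intro: borel_measurable_continuous_onI)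
      define \<psi> where "\<psi> z = \<eta> (fst z) * \<Gamma> z" for z
      define \<psi>t where "\<psi>t z = \<eta>' (fst z) * \<Gamma> z + \<eta> (fst z) * (- A * \<gamma> z)" for z
      define \<psi>x where "\<psi>x z = \<eta> (fst z) * (- sg (snd z) * \<gamma> z)" for z
      define B where "B = E * \<rho>\<^sup>2 + E' * \<rho>\<^sup>2 + E * (A * (2 * \<rho>)) + E * (1 * (2 * \<rho>))"
      have nn: "0 \<le> E * \<rho>\<^sup>2" "0 \<le> E' * \<rho>\<^sup>2" "0 \<le> E * (A * (2 * \<rho>))" "0 \<le> E * (1 * (2 * \<rho>))"
        using E0 A0 \<rho> by auto
      have tf: "test_function T \<psi> \<psi>t \<psi>x p q \<rho> B"
      proof
        fix z :: "real \<times> real"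
        have "((\<lambda>z. \<eta> (fst z)) has_derivative (\<lambda>h. fst h * \<eta>' (fst z))) (at z)"
          by (rule DERIV_compose_FDERIV[OF \<eta>]) (auto intro!: derivative_eq_intros)
        from has_derivative_mult[OF this \<Gamma>_deriv[of z]]
        show "(\<psi> has_derivative (\<lambda>h. fst h * \<psi>t z + snd h * \<psi>x z)) (at z)"
          unfolding \<psi>_def[abs_def] \<psi>t_def \<psi>x_def by (rule has_derivative_eq_rhs) (auto simp: algebra_simps)
        show zero: "\<psi> z = 0 \<and> \<psi>t z = 0 \<and> \<psi>x z = 0" if "z \<notin> {p..q} \<times> {- \<rho>..\<rho>}"
        proof (cases "fst z \<in> {p..q}")
          case True
          then have "\<Gamma> (fst z, snd z) = 0 \<and> \<gamma> (fst z, snd z) = 0"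
            using that pq by (intro \<Gamma>_out) (auto simp: mem_Times_iff)
          then show ?thesis by (simp add: \<psi>_def \<psi>t_def \<psi>x_def)
        qed (use \<eta>_out in \<open>simp add: \<psi>_def \<psi>t_def \<psi>x_def\<close>)
        have bounds: "\<bar>\<psi> z\<bar> \<le> E * \<rho>\<^sup>2 \<and> \<bar>\<psi>t z\<bar> \<le> E' * \<rho>\<^sup>2 + E * (A * (2 * \<rho>)) \<and> \<bar>\<psi>x z\<bar> \<le> E * (1 * (2 * \<rho>))"
        proof (cases "0 \<le> fst z")
          case True
          have g: "\<bar>\<Gamma> z\<bar> \<le> \<rho>\<^sup>2" "\<bar>\<gamma> z\<bar> \<le> 2 * \<rho>"
            using \<Gamma>_le[OF True, of "snd z"] \<Gamma>0[of z] by auto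
          have "\<bar>\<psi> z\<bar> \<le> E * \<rho>\<^sup>2" "\<bar>\<eta>' (fst z) * \<Gamma> z\<bar> \<le> E' * \<rho>\<^sup>2"
            unfolding \<psi>_def abs_mult by (intro mult_mono E E' g E0; simp)+
          moreover have "\<bar>\<eta> (fst z) * (- A * \<gamma> z)\<bar> \<le> E * (A * (2 * \<rho>))"
            unfolding abs_mult abs_minus_cancel using A0 by (intro mult_mono E g E0) auto
          moreover have "\<bar>\<psi>x z\<bar> \<le> E * (1 * (2 * \<rho>))"
            unfolding \<psi>x_def abs_mult abs_minus_cancel by (intro mult_mono E g E0 sg1) auto
          ultimately show ?thesis unfolding \<psi>t_def by linarith
        next
          case False
          then have "\<psi> z = 0 \<and> \<psi>t z = 0 \<and> \<psi>x z = 0" using \<eta>_out[of "fst z"] pq by (simp add: \<psi>_def \<psi>t_def \<psi>x_def)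
          then show ?thesis using nn by simp
        qed
        show "\<bar>\<psi> z\<bar> \<le> B" "\<bar>\<psi>t z\<bar> \<le> B" "\<bar>\<psi>x z\<bar> \<le> B" using bounds nn unfolding B_def by linarith+
      next
        have c: "continuous_on UNIV (\<lambda>z::real \<times> real. \<eta> (fst z))" "continuous_on UNIV (\<lambda>z::real \<times> real. \<eta>' (fst z))"
          "continuous_on UNIV (\<lambda>z::real \<times> real. sg (snd z))"
          by (intro continuous_on_compose2[OF \<eta>c] continuous_on_compose2[OF \<eta>'c] continuous_on_compose2[OF sg_cont] continuous_intros; simp)+
        show "continuous_on UNIV \<psi>t" "continuous_on UNIV \<psi>x"
          unfolding \<psi>t_def[abs_def] \<psi>x_def[abs_def] by (intro continuous_intros c \<Gamma>_cont \<gamma>_cont)+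
      qed (use pq \<rho> in auto)
      interpret tf: test_function T \<psi> \<psi>t \<psi>x p q \<rho> B by (rule tf)
      have [measurable]: "\<Gamma> \<in> borel_measurable borel" using \<Gamma>_cont by (rule borel_measurable_continuous_onI)
      let ?H = "\<lambda>z. \<bar>U z - V z\<bar> * (\<eta>' (fst z) * \<Gamma> z)"
      have e_bound: "AE z in lborel. \<bar>\<bar>U z - V z\<bar>\<bar> \<le> 2 * N" using U_le V_le by (intro AE_I2) (smt (verit, best))
      have eta_m: "(\<lambda>z. \<eta>' (fst z) * \<Gamma> z) \<in> borel_measurable (borel :: (real \<times> real) measure)"
        by (intro borel_measurable_continuous_onI continuous_intros continuous_on_compose2[OF \<eta>'c] \<Gamma>_cont) auto
      have H_int: "integrable lborel ?H"
      proof (rule tf.integrable_mult[OF _ e_bound eta_m])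
        fix z
        show "\<bar>\<eta>' (fst z) * \<Gamma> z\<bar> \<le> B * indicator ({p..q} \<times> {- \<rho>..\<rho>}) z"
        proof (cases "z \<in> {p..q} \<times> {- \<rho>..\<rho>}")
          case True
          then have "\<bar>\<Gamma> z\<bar> \<le> \<rho>\<^sup>2" using \<Gamma>_le(1)[of "fst z" "snd z"] \<Gamma>0[of z] pq by auto
          then have "\<bar>\<eta>' (fst z) * \<Gamma> z\<bar> \<le> E' * \<rho>\<^sup>2"
            unfolding abs_mult by (intro mult_mono E' E0) auto
          then have "\<bar>\<eta>' (fst z) * \<Gamma> z\<bar> \<le> B" using nn unfolding B_def by linarith
          then show ?thesis using True by simp
        next
          case False
          have "\<eta>' (fst z) * \<Gamma> z = 0"
          proof (cases "fst z \<in> {p..q}")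
            case True
            then have "\<Gamma> (fst z, snd z) = 0" using False pq \<Gamma>_out[of "fst z" "snd z"] by (auto simp: mem_Times_iff)
            then show ?thesis by simp
          qed (use \<eta>_out in simp)
          then show ?thesis using False by simp
        qed
      qed measurable
      have "0 \<le> (LINT z|lborel. \<bar>U z - V z\<bar> * \<psi>t z + flux_diff (U z) (V z) * \<psi>x z)"
        by (rule kruzkov_doubling[OF U V U_le V_le entU entV contV tf]) (simp add: \<psi>_def \<eta>0 \<Gamma>0)
      also have "\<dots> \<le> (LINT z|lborel. ?H z)"
      proof (rule integral_mono[OF _ H_int])
        have "AE z in lborel. \<bar>flux_diff (U z) (V z)\<bar> \<le> A * (2 * N)"
        proof (rule AE_I2)
          fix z
          have "\<bar>flux_diff (U z) (V z)\<bar> \<le> A * \<bar>U z - V z\<bar>"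
            unfolding A_def by (rule flux_diff_le[OF U_le V_le])
          also have "\<dots> \<le> A * (2 * N)" using U_le[of z] V_le[of z] A0 by (intro mult_left_mono) auto
          finally show "\<bar>flux_diff (U z) (V z)\<bar> \<le> A * (2 * N)" .
        qed
        then show "integrable lborel (\<lambda>z. \<bar>U z - V z\<bar> * \<psi>t z + flux_diff (U z) (V z) * \<psi>x z)"
          by (intro Bochner_Integration.integrable_add tf.integrable_mult[OF _ e_bound] tf.integrable_mult
              tf.borel tf.bound_box; measurable?)
        fix z
        \<comment> \<open>The flux term is at most
          \<open>A * \<bar>U z - V z\<bar> * \<eta> (fst z) * \<gamma> z\<close>, exactly what the
          decay of the cone takes away in \<open>\<psi>t\<close>; only the term with
          \<open>\<eta>'\<close> survives.\<close>
        have "flux_diff (U z) (V z) * \<psi>x z \<le> \<bar>flux_diff (U z) (V z)\<bar> * \<bar>\<psi>x z\<bar>"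
          unfolding abs_mult[symmetric] by (rule abs_ge_self)
        also have "\<dots> \<le> (A * \<bar>U z - V z\<bar>) * (\<eta> (fst z) * \<gamma> z)"
        proof (rule mult_mono)
          show "\<bar>flux_diff (U z) (V z)\<bar> \<le> A * \<bar>U z - V z\<bar>"
            unfolding A_def by (rule flux_diff_le[OF U_le V_le])
          have "\<bar>sg (snd z)\<bar> * \<gamma> z \<le> 1 * \<gamma> z" by (rule mult_right_mono[OF sg1 \<Gamma>0(2)])
          then show "\<bar>\<psi>x z\<bar> \<le> \<eta> (fst z) * \<gamma> z"
            using \<eta>0[of "fst z"] \<Gamma>0(2)[of z] by (simp add: \<psi>x_def abs_mult mult_left_mono)
        qed (use A0 in auto)
        finally show "\<bar>U z - V z\<bar> * \<psi>t z + flux_diff (U z) (V z) * \<psi>x z \<le> ?H z"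
          by (simp add: \<psi>t_def algebra_simps)
      qed
      also have "\<dots> = (LINT t|lborel. LINT x|lborel. ?H (t, x))" by (rule lborel_pair_integral[OF H_int])
      also have "\<dots> = (LINT t|lborel. indicator {0..T} t *\<^sub>R (\<eta>' t * D t))"
      proof (rule integral_cong_AE)
        show "(\<lambda>t. LINT x|lborel. ?H (t, x)) \<in> borel_measurable lborel"
        proof -
          have "?H \<in> borel_measurable (lborel \<Otimes>\<^sub>M lborel)" unfolding lborel_prod using H_int by (rule borel_measurable_integrable)
          then show ?thesis by (intro lborel.borel_measurable_lebesgue_integral) simp
        qed
        have "set_integrable lborel {0..T} (\<lambda>t. \<eta>' t * D t)"
          by (intro borel_integrable_atLeastAtMost' continuous_intros D_cont continuous_on_subset[OF \<eta>'c]) simp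
        then show "(\<lambda>t. indicator {0..T} t *\<^sub>R (\<eta>' t * D t)) \<in> borel_measurable lborel"
          unfolding set_integrable_def by (rule borel_measurable_integrable)
        \<comment> \<open>Fubini turns equality almost everywhere in the plane into equality on
          almost every time slice, which is enough under the integral in \<open>t\<close>.\<close>
        have "AE z in lborel \<Otimes>\<^sub>M lborel. z \<in> ?Q \<longrightarrow> U z = u z" using U_eq unfolding lborel_prod .
        then have "AE t in lborel. AE x in lborel. (t, x) \<in> ?Q \<longrightarrow> U (t, x) = u (t, x)" by (rule lborel_pair.AE_pair)
        then show "AE t in lborel. (LINT x|lborel. ?H (t, x)) = indicator {0..T} t *\<^sub>R (\<eta>' t * D t)"
        proof eventually_elim
          case (elim t)
          show ?case
          proof (cases "t \<in> {p..q}")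
            case True
            then have t: "0 < t" "t < T" using pq by auto
            have "(LINT x|lborel. ?H (t, x)) = (LINT x|lborel. \<eta>' t * (\<bar>u (t, x) - sol w (t, x)\<bar> * \<Gamma> (t, x)))"
            proof (rule integral_cong_AE)
              have [measurable]: "(\<lambda>x. U (t, x)) \<in> borel_measurable borel" "(\<lambda>x. V (t, x)) \<in> borel_measurable borel"
                by (rule measurable_compose[OF _ U], simp, rule measurable_compose[OF _ V], simp)
              show "(\<lambda>x. ?H (t, x)) \<in> borel_measurable lborel" by simp
              show "(\<lambda>x. \<eta>' t * (\<bar>u (t, x) - sol w (t, x)\<bar> * \<Gamma> (t, x))) \<in> borel_measurable lborel"
                using t by (intro borel_measurable_integrable integrable_mult_right G_int u_int v_int) auto
              show "AE x in lborel. ?H (t, x) = \<eta>' t * (\<bar>u (t, x) - sol w (t, x)\<bar> * \<Gamma> (t, x))"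
                using elim by eventually_elim (use t in \<open>auto simp: V_def\<close>)
            qed
            then show ?thesis using t by (simp add: D_def)
          qed (use \<eta>_out in simp)
        qed
      qed
      also have "\<dots> = integral {0..T} (\<lambda>t. \<eta>' t * D t)"
        using set_borel_integral_eq_integral(2)[OF borel_integrable_atLeastAtMost', of 0 T "\<lambda>t. \<eta>' t * D t"]
        unfolding set_lebesgue_integral_def
        by (simp add: continuous_on_mult D_cont continuous_on_subset[OF \<eta>'c])
      finally show "0 \<le> integral {0..T} (\<lambda>t. \<eta>' t * D t)" .
    qed
    then have "AE x in lborel. \<bar>u (T, x) - sol w (T, x)\<bar> * \<Gamma> (T, x) = 0"
      using T unfolding D_def
      by (subst (asm) integral_nonneg_eq_0_iff_AE[OF G_int[OF u_int v_int]]) (auto simp: \<Gamma>0)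
    then show ?thesis
      by eventually_elim (auto simp: \<Gamma>_def kap_def r_def)
  qed
  \<comment> \<open>At time \<open>T\<close> the cones with integer \<open>\<rho>\<close> exhaust
    the line, so countably many null sets suffice.\<close>
  have "AE x in lborel. \<forall>n. sqrt (1 + x\<^sup>2) + A * T < real (Suc n) \<longrightarrow> u (T, x) = sol w (T, x)"
    unfolding AE_all_countable using cone by simp
  then show ?thesis
  proof eventually_elim
    case (elim x)
    obtain n where "sqrt (1 + x\<^sup>2) + A * T < real n" using reals_Archimedean2 by blast
    then show ?case using elim[rule_format, of n] by simp
  qed
qed

end

section \<open>The set of initial data leading to a given profile\<close>

lemma rep_linf_Linf: "rep_linf v \<in> Linf_on UNIV"
  using Quotient3_rep_reflp[OF Quotient3_linf, of v] by (simp add: Linf_eq_def)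

lemma Linf_iff_ess_bounded: "w \<in> Linf_on UNIV \<longleftrightarrow> (\<exists>M. ess_bounded M w)" for w :: "real \<Rightarrow> real"
proof -
  have "borel_measurable (restrict_space lborel (UNIV :: real set)) = (borel_measurable borel :: (real \<Rightarrow> real) set)"
    by (rule measurable_cong_sets) (simp_all add: sets_restrict_UNIV)
  then show ?thesis by (simp add: Linf_on_def ess_bounded_def)
qed

lemma rep_linf_ess_bounded: obtains M where "ess_bounded M (rep_linf v)"
  using rep_linf_Linf[of v] by (auto simp: Linf_iff_ess_bounded)

lemma rep_linf_borel [measurable]: "rep_linf v \<in> borel_measurable borel"
  by (rule rep_linf_ess_bounded[of v]) (simp add: ess_bounded_def)

lemma linf_eqI: "AE x in lborel. rep_linf u x = rep_linf v x \<Longrightarrow> u = v"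
  using Quotient3_rel_rep[OF Quotient3_linf, of u v] rep_linf_Linf by (simp add: Linf_eq_def)

lemma rep_abs_linf:
  assumes "ess_bounded M w" shows "AE x in lborel. rep_linf (abs_linf w) x = w x"
proof -
  have "Linf_eq w w" using assms by (auto simp: Linf_eq_def Linf_iff_ess_bounded)
  from Quotient3_rep_abs[OF Quotient3_linf, OF this] show ?thesis by (simp add: Linf_eq_def)
qed

lemma ess_bounded_mono: "ess_bounded M w \<Longrightarrow> M \<le> N \<Longrightarrow> ess_bounded N w"
  by (auto simp: ess_bounded_def elim!: eventually_mono)

lemma AE_dense:
  fixes P :: "real \<Rightarrow> bool"
  assumes P: "AE x in lborel. P x" and ab: "a < b"
  shows "\<exists>x. a < x \<and> x < b \<and> P x"
proof (rule ccontr)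
  assume "\<not> ?thesis"
  with P have "AE x in lborel. x \<notin> {a<..<b}" by (auto elim!: eventually_mono)
  then have "{a<..<b} \<in> null_sets lborel" by (subst AE_iff_null_sets) auto
  then show False using ab by (simp add: null_sets_def)
qed

lemma prim_cong_AE:
  assumes "AE x in lborel. u x = v x" "u \<in> borel_measurable borel" "v \<in> borel_measurable borel"
  shows "prim u y = prim v y"
proof -
  have "(LINT x:A|lborel. u x) = (LINT x:A|lborel. v x)" if "A \<in> sets borel" for A
    unfolding set_lebesgue_integral_def
    by (rule integral_cong_AE) (use assms that in \<open>auto elim!: eventually_mono\<close>)
  then show ?thesis by (simp add: prim_def)
qed

lemma prim_add:
  assumes u: "loc_int u" and v: "loc_int v"
  shows "prim (\<lambda>x. u x + v x) y = prim u y + prim v y"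
proof -
  have "(LINT x:{a<..b}|lborel. u x + v x) = (LINT x:{a<..b}|lborel. u x) + (LINT x:{a<..b}|lborel. v x)" for a b
    using loc_int_Ioc[OF u, of a b] loc_int_Ioc[OF v, of a b] by (intro set_integral_add) (auto simp: set_integrable_def)
  then show ?thesis by (simp add: prim_def)
qed

lemma prim_indicator:
  assumes R: "0 \<le> R"
  shows "y \<le> R \<Longrightarrow> prim (indicator {R<..R + 1}) y = 0" and "R + 1 \<le> y \<Longrightarrow> prim (indicator {R<..R + 1}) y = 1"
proof -
  have l: "loc_int (indicator {R<..R + 1})"
    by (rule ess_bounded_loc_int[of 1]) (auto simp: ess_bounded_def indicator_def)
  have i: "(LINT x:{a<..b}|lborel. indicat_real {R<..R + 1} x) = measure lborel ({a<..b} \<inter> {R<..R + 1})" for a b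
    by (simp add: set_lebesgue_integral_def indicator_inter_arith[symmetric])
  show "prim (indicator {R<..R + 1}) y = 0" if "y \<le> R"
  proof -
    have "{y<..0} \<inter> {R<..R + 1} = {}" "{0<..y} \<inter> {R<..R + 1} = {}" using that R by auto
    then show ?thesis by (simp add: prim_def i del: Int_greaterThanAtMost)
  qed
  show "prim (indicator {R<..R + 1}) y = 1" if "R + 1 \<le> y"
  proof -
    have "{0<..y} \<inter> {R<..R + 1} = {R<..R + 1}" using that R by auto
    then show ?thesis using that R by (simp add: prim_def i del: Int_greaterThanAtMost)
  qed
qed

text \<open>Both primitives start at 0, so their difference is an integral between 0 and
  \<open>y\<close>. This is where closeness in \<open>L1_dist\<close> becomes uniform closeness of
  primitives.\<close>

lemma prim_diff_le:
  assumes u: "loc_int u" and v: "loc_int v" and y: "y \<in> {- R..R}"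
  shows "\<bar>prim u y - prim v y\<bar> \<le> (LINT x:{- R..R}|lborel. \<bar>u x - v x\<bar>)"
proof -
  have i: "set_integrable lborel A (\<lambda>x. \<bar>u x - v x\<bar>)" if "A \<in> sets borel" "A \<subseteq> {a..b}" for A a b
    using loc_int_set_integrable[OF u that] loc_int_set_integrable[OF v that]
    by (intro set_integrable_abs set_integral_diff(1))
  have *: "\<bar>(LINT x:A|lborel. u x) - (LINT x:A|lborel. v x)\<bar> \<le> (LINT x:{- R..R}|lborel. \<bar>u x - v x\<bar>)"
    if A: "A \<in> sets borel" "A \<subseteq> {- R..R}" for A
  proof -
    have "(LINT x:A|lborel. u x) - (LINT x:A|lborel. v x) = (LINT x:A|lborel. u x - v x)"
      using loc_int_set_integrable[OF u A] loc_int_set_integrable[OF v A] by simp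
    also have "\<bar>\<dots>\<bar> \<le> (LINT x:A|lborel. \<bar>u x - v x\<bar>)"
      using integral_abs_bound[of lborel "\<lambda>x. indicator A x *\<^sub>R (u x - v x)"]
      by (simp add: set_lebesgue_integral_def abs_mult)
    also have "\<dots> \<le> (LINT x:{- R..R}|lborel. \<bar>u x - v x\<bar>)"
      unfolding set_lebesgue_integral_def
      by (rule integral_mono)
        (use i[OF A] i[of "{- R..R}" "- R" R] A in \<open>auto simp: set_integrable_def indicator_def\<close>)
    finally show ?thesis .
  qed
  show ?thesis
  proof (cases "0 \<le> y")
    case True
    moreover have "{0<..y} \<subseteq> {- R..R}" using True y by auto
    ultimately show ?thesis using *[of "{0<..y}"] by (simp add: prim_def)
  next
    case False
    moreover have "{y<..0} \<subseteq> {- R..R}" using False y by auto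
    ultimately show ?thesis using *[of "{y<..0}"] by (simp add: prim_def abs_minus_commute)
  qed
qed

section \<open>Open sets of the L1loc topology\<close>

lemma topspace_L1loc: "topspace L1loc_topology = UNIV"
proof -
  have "v \<in> \<Union> {{v. L1_dist K u v < e} | K u e. compact K \<and> 0 < e}" for v
  proof (rule UnionI)
    show "{x. L1_dist {} v x < 1} \<in> {{v. L1_dist K u v < e} | K u e. compact K \<and> 0 < e}"
      by (intro CollectI exI[of _ "{}"] exI[of _ v] exI[of _ 1] conjI refl) auto
    show "v \<in> {x. L1_dist {} v x < 1}" by (simp add: L1_dist_def set_lebesgue_integral_def)
  qed
  then show ?thesis unfolding L1loc_topology_def topology_generated_by_topspace by blast
qed

lemma openin_L1_ball: "compact K \<Longrightarrow> 0 < e \<Longrightarrow> openin L1loc_topology {v. L1_dist K u v < e}"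
  unfolding L1loc_topology_def by (rule topology_generated_by_Basis) blast

text \<open>A subbasic ball tests a function on one compact set. Induction over the generation of
  the topology keeps such a bound: an intersection takes the larger radius, a union the radius of a
  member containing \<open>u\<close>.\<close>

lemma openin_L1loc_far:
  assumes "openin L1loc_topology S" "u \<in> S"
  shows "\<exists>R>0. \<forall>v. (AE x in lborel. \<bar>x\<bar> \<le> R \<longrightarrow> rep_linf v x = rep_linf u x) \<longrightarrow> v \<in> S"
proof -
  have "generate_topology_on {{v. L1_dist K u v < e} | K u e. compact K \<and> 0 < e} S"
    using assms(1) unfolding L1loc_topology_def by (simp add: openin_topology_generated_by_iff)
  then show ?thesis using assms(2)
  proof (induction arbitrary: u rule: generate_topology_on.induct)
    case (Int A B)
    obtain RA RB where R: "0 < RA" "\<And>v. (AE x in lborel. \<bar>x\<bar> \<le> RA \<longrightarrow> rep_linf v x = rep_linf u x) \<Longrightarrow> v \<in> A"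
      "0 < RB" "\<And>v. (AE x in lborel. \<bar>x\<bar> \<le> RB \<longrightarrow> rep_linf v x = rep_linf u x) \<Longrightarrow> v \<in> B"
      using Int.IH(1)[of u] Int.IH(2)[of u] Int.prems by blast
    have "v \<in> A \<inter> B" if "AE x in lborel. \<bar>x\<bar> \<le> max RA RB \<longrightarrow> rep_linf v x = rep_linf u x" for v
      using that by (intro IntI R(2,4)) (auto elim!: eventually_mono)
    then show ?case using R(1) by (intro exI[of _ "max RA RB"]) auto
  next
    case (UN \<A>)
    then obtain A where A: "A \<in> \<A>" "u \<in> A" by blast
    from UN.IH[OF this] show ?case using A(1) by blast
  next
    case (Basis s)
    then obtain K z e where s: "s = {v. L1_dist K z v < e}" and K: "compact K" by blast
    obtain R where R: "0 < R" "\<And>x. x \<in> K \<Longrightarrow> \<bar>x\<bar> \<le> R"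
      using compact_imp_bounded[OF K] by (auto simp: bounded_pos)
    have [measurable]: "K \<in> sets borel" using K by (rule borel_compact)
    have "v \<in> s" if v: "AE x in lborel. \<bar>x\<bar> \<le> R \<longrightarrow> rep_linf v x = rep_linf u x" for v
    proof -
      have "L1_dist K z v = L1_dist K z u"
        unfolding L1_dist_def set_lebesgue_integral_def
      proof (rule integral_cong_AE)
        show "AE x in lborel. indicat_real K x *\<^sub>R \<bar>rep_linf z x - rep_linf v x\<bar> = indicat_real K x *\<^sub>R \<bar>rep_linf z x - rep_linf u x\<bar>"
          using v by eventually_elim (use R(2) in \<open>auto simp: indicator_def\<close>)
      qed measurable
      then show ?thesis using Basis.prems by (simp add: s)
    qed
    then show ?case using R(1) by blast
  qed simp
qed

section \<open>Membership in \<open>I_CL\<close> in terms of primitives, and the two topological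
  claims\<close>

context convex_flux
begin

text \<open>The slice of \<open>sol\<close> at time \<open>T\<close> is a witness for the definite
  description, and \<open>entropy_solution_unique\<close> makes every other witness agree with it
  almost everywhere.\<close>

lemma S_CL_iff:
  assumes T: "0 < T"
  shows "S_CL f T T uo = v \<longleftrightarrow> (AE x in lborel. sol (rep_linf uo) (T, x) = rep_linf v x)"
proof -
  obtain M where w: "ess_bounded M (rep_linf uo)" by (rule rep_linf_ess_bounded)
  let ?w = "rep_linf uo"
  let ?v = "abs_linf (\<lambda>x. sol ?w (T, x))"
  have v: "AE x in lborel. rep_linf ?v x = sol ?w (T, x)"
    by (rule rep_abs_linf[OF ess_bounded_sol[OF w]])
  have "S_CL f T T uo = ?v"
    unfolding S_CL_def
  proof (rule the_equality)
    have "represents (\<lambda>x. sol ?w (0, x)) uo" by (simp add: represents_def sol_def)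
    moreover have "represents (\<lambda>x. sol ?w (T, x)) ?v"
      using v by (auto simp: represents_def elim!: eventually_mono)
    ultimately show "\<exists>u. weak_entropy_solution f T u \<and> represents (\<lambda>x. u (0, x)) uo \<and> represents (\<lambda>x. u (T, x)) ?v"
      using weak_entropy_solution_sol[OF w T] by blast
    fix v' assume "\<exists>u. weak_entropy_solution f T u \<and> represents (\<lambda>x. u (0, x)) uo \<and> represents (\<lambda>x. u (T, x)) v'"
    then obtain u where u: "weak_entropy_solution f T u" "AE x in lborel. u (0, x) = ?w x" "AE x in lborel. u (T, x) = rep_linf v' x"
      by (auto simp: represents_def)
    have "AE x in lborel. rep_linf v' x = rep_linf ?v x"
      using entropy_solution_unique[OF u(1) T w u(2)] u(3) v by eventually_elim simp
    then show "v' = ?v" by (rule linf_eqI)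
  qed
  moreover have "?v = v \<longleftrightarrow> (AE x in lborel. sol ?w (T, x) = rep_linf v x)"
  proof
    assume "?v = v"
    then show "AE x in lborel. sol ?w (T, x) = rep_linf v x" using v by (auto elim!: eventually_mono)
  next
    assume "AE x in lborel. sol ?w (T, x) = rep_linf v x"
    with v have "AE x in lborel. rep_linf ?v x = rep_linf v x" by eventually_elim simp
    then show "?v = v" by (rule linf_eqI)
  qed
  ultimately show ?thesis by simp
qed

text \<open>Lipschitz functions with equal derivatives almost everywhere differ by a constant.
  Membership thus becomes an equation at every point, in which the datum enters only through values
  of \<open>HL\<close>.\<close>

lemma I_CL_iff_prim:
  assumes T: "0 < T"
  shows "uo \<in> I_CL f T w \<longleftrightarrow>
    (\<forall>x. HL (prim (rep_linf uo)) T x - HL (prim (rep_linf uo)) T 0 = prim (rep_linf w) x)"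
proof -
  obtain M where M: "ess_bounded M (rep_linf uo)" by (rule rep_linf_ess_bounded)
  obtain N where N: "ess_bounded N (rep_linf w)" by (rule rep_linf_ess_bounded)
  note U = prim_lipschitz[OF M]
  let ?V = "HL (prim (rep_linf uo)) T"
  have D: "AE x in lborel. (?V has_real_derivative sol (rep_linf uo) (T, x)) (at x)"
    using AE_HL_deriv[OF U T] T by (simp add: sol_pos)
  have iff: "uo \<in> I_CL f T w \<longleftrightarrow> (AE x in lborel. sol (rep_linf uo) (T, x) = rep_linf w x)"
    by (simp add: I_CL_def S_CL_iff[OF T])
  show ?thesis
  proof
    assume "uo \<in> I_CL f T w"
    then have "AE x in lborel. (?V has_real_derivative rep_linf w x) (at x)"
      unfolding iff using D by eventually_elim simp
    note ftc = lipschitz_ftc[OF HL_lipschitz[OF U T] this rep_linf_borel]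
    show "\<forall>x. ?V x - ?V 0 = prim (rep_linf w) x"
    proof
      fix x
      show "?V x - ?V 0 = prim (rep_linf w) x"
        using ftc[of 0 x] ftc[of x 0] by (cases "0 \<le> x") (auto simp: prim_def)
    qed
  next
    assume eq: "\<forall>x. ?V x - ?V 0 = prim (rep_linf w) x"
    then have "prim (rep_linf w) = (\<lambda>x. ?V x - ?V 0)" by auto
    then have "AE x in lborel. ((\<lambda>x. ?V x - ?V 0) has_real_derivative rep_linf w x) (at x)"
      using AE_prim_deriv[OF ess_bounded_loc_int[OF N]] by simp
    then show "uo \<in> I_CL f T w"
      unfolding iff using D
    proof eventually_elim
      case (elim x)
      from DERIV_diff[OF elim(2) DERIV_const[of "?V 0"]] elim(1) show ?case by (auto dest: DERIV_unique)
    qed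
  qed
qed

lemma arg_dist:
  assumes "M-lipschitz_on UNIV U" "0 < t" "is_arg U t x y"
  shows "\<bar>x - y\<bar> \<le> t * max \<bar>deriv f M\<bar> \<bar>deriv f (- M)\<bar>"
proof -
  have "\<bar>(x - y) / t\<bar> \<le> max \<bar>deriv f M\<bar> \<bar>deriv f (- M)\<bar>" using arg_bounds[OF assms] by auto
  then show ?thesis using assms(2) by (simp add: abs_divide pos_divide_le_eq mult.commute)
qed

text \<open>The bound depends on \<open>w\<close> only: the minimisers are the feet of the backward characteristics
  issued from the final profile. This replaces the missing uniform bound on the initial data.\<close>

lemma I_CL_arg_dist:
  assumes T: "0 < T" and uo: "uo \<in> I_CL f T w" and N: "ess_bounded N (rep_linf w)"
  shows "\<bar>x - ymax (prim (rep_linf uo)) T x\<bar> \<le> T * max \<bar>deriv f N\<bar> \<bar>deriv f (- N)\<bar> + 1"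
proof -
  let ?U = "prim (rep_linf uo)" and ?A = "T * max \<bar>deriv f N\<bar> \<bar>deriv f (- N)\<bar>"
  obtain M where M: "ess_bounded M (rep_linf uo)" by (rule rep_linf_ess_bounded)
  note U = prim_lipschitz[OF M]
  have "AE x in lborel. sol (rep_linf uo) (T, x) = rep_linf w x"
    using uo by (simp add: I_CL_def S_CL_iff[OF T])
  moreover have "AE x in lborel. \<bar>rep_linf w x\<bar> \<le> N" using N by (simp add: ess_bounded_def)
  ultimately have good: "AE x in lborel. \<bar>x - ymax ?U T x\<bar> \<le> ?A"
  proof eventually_elim
    case (elim x)
    define q where "q = (x - ymax ?U T x) / T"
    have "\<bar>g q\<bar> \<le> N" using elim T by (simp add: sol_pos vel_def q_def)
    then have "deriv f (- N) \<le> q" "q \<le> deriv f N"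
      using f1_mono[of "- N" "g q"] f1_mono[of "g q" N] by auto
    then have "\<bar>q\<bar> \<le> max \<bar>deriv f N\<bar> \<bar>deriv f (- N)\<bar>" by auto
    then show ?case using T by (simp add: q_def abs_divide pos_divide_le_eq mult.commute)
  qed
  \<comment> \<open>The bound is known at almost every point only. Good points within distance 1 on
    either side squeeze the monotone \<open>ymax\<close>, which accounts for the summand 1.\<close>
  obtain x1 where x1: "x - 1 < x1" "x1 < x" "\<bar>x1 - ymax ?U T x1\<bar> \<le> ?A"
    using AE_dense[OF good, of "x - 1" x] by auto
  obtain x2 where x2: "x < x2" "x2 < x + 1" "\<bar>x2 - ymax ?U T x2\<bar> \<le> ?A"
    using AE_dense[OF good, of x "x + 1"] by auto
  have "ymax ?U T x1 \<le> ymax ?U T x" "ymax ?U T x \<le> ymax ?U T x2"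
    using monoD[OF mono_ymax[OF U T]] x1 x2 by auto
  then show ?thesis using x1 x2 by (simp add: abs_le_iff)
qed

text \<open>For a datum outside the set the equation of \<open>I_CL_iff_prim\<close> fails at some
  \<open>x0\<close> by \<open>3 * e\<close>. A neighbour in the set would change each of the two
  values of \<open>HL\<close> by at most \<open>e\<close>, too little to restore equality.\<close>

theorem closedin_I_CL:
  assumes T: "0 < T" shows "closedin L1loc_topology (I_CL f T w)"
  unfolding closedin_def topspace_L1loc
proof (intro conjI subset_UNIV)
  show "openin L1loc_topology (UNIV - I_CL f T w)"
  proof (subst openin_subopen, intro ballI)
    fix uo assume "uo \<in> UNIV - I_CL f T w"
    then obtain x0 where x0: "HL (prim (rep_linf uo)) T x0 - HL (prim (rep_linf uo)) T 0 \<noteq> prim (rep_linf w) x0"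
      by (auto simp: I_CL_iff_prim[OF T])
    let ?U = "prim (rep_linf uo)"
    define e where "e = \<bar>HL ?U T x0 - HL ?U T 0 - prim (rep_linf w) x0\<bar> / 3"
    have e: "0 < e" using x0 by (simp add: e_def)
    obtain M where M: "ess_bounded M (rep_linf uo)" by (rule rep_linf_ess_bounded)
    obtain N where N: "ess_bounded N (rep_linf w)" by (rule rep_linf_ess_bounded)
    note U = prim_lipschitz[OF M]
    define A where "A = T * max \<bar>deriv f M\<bar> \<bar>deriv f (- M)\<bar>"
    define A' where "A' = T * max \<bar>deriv f N\<bar> \<bar>deriv f (- N)\<bar> + 1"
    have A: "0 \<le> A" "0 \<le> A'" using T by (auto simp: A_def A'_def)
    \<comment> \<open>The interval holds the minimisers issued from points up to
      \<open>\<bar>x0\<bar>\<close> for both data: \<open>A\<close> covers \<open>uo\<close> through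
      its own bound, \<open>A'\<close> covers any competitor in the set through the bound on
      \<open>w\<close>.\<close>
    define R where "R = \<bar>x0\<bar> + A + A'"
    let ?S = "{v. L1_dist {- R..R} uo v < e}"
    have "openin L1loc_topology ?S" using e by (intro openin_L1_ball) auto
    moreover have "uo \<in> ?S" using e by (simp add: L1_dist_def set_lebesgue_integral_def)
    moreover have "v \<notin> I_CL f T w" if "v \<in> ?S" for v
    proof
      assume v: "v \<in> I_CL f T w"
      let ?V = "prim (rep_linf v)"
      obtain M' where M': "ess_bounded M' (rep_linf v)" by (rule rep_linf_ess_bounded)
      note V = prim_lipschitz[OF M']
      have near: "\<bar>?U y - ?V y\<bar> \<le> e" if "\<bar>y\<bar> \<le> R" for y
      proof -
        have "\<bar>?U y - ?V y\<bar> \<le> L1_dist {- R..R} uo v"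
          unfolding L1_dist_def
          by (rule prim_diff_le[OF ess_bounded_loc_int[OF M] ess_bounded_loc_int[OF M']]) (use that in auto)
        then show ?thesis using \<open>v \<in> ?S\<close> by simp
      qed
      have close: "\<bar>HL ?U T x - HL ?V T x\<bar> \<le> e" if "\<bar>x\<bar> \<le> \<bar>x0\<bar>" for x
      proof -
        have "\<bar>ymax ?U T x\<bar> \<le> R" using arg_dist[OF U T is_arg_ymax[OF U T], of x, folded A_def] that A unfolding R_def by linarith
        from near[OF this] HL_le[OF V T, of x "ymax ?U T x"]
        have "HL ?V T x \<le> HL ?U T x + e" by (simp add: HL_def cost_def)
        moreover have "\<bar>ymax ?V T x\<bar> \<le> R" using I_CL_arg_dist[OF T v N, of x, folded A'_def] that A unfolding R_def by linarith
        from near[OF this] HL_le[OF U T, of x "ymax ?V T x"]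
        have "HL ?U T x \<le> HL ?V T x + e" by (simp add: HL_def cost_def)
        ultimately show ?thesis by linarith
      qed
      have "HL ?V T x0 - HL ?V T 0 = prim (rep_linf w) x0" using v by (simp add: I_CL_iff_prim[OF T])
      moreover have "3 * e = \<bar>HL ?U T x0 - HL ?U T 0 - prim (rep_linf w) x0\<bar>" by (simp add: e_def)
      moreover have "\<bar>HL ?U T x0 - HL ?V T x0\<bar> \<le> e" "\<bar>HL ?U T 0 - HL ?V T 0\<bar> \<le> e"
        by (intro close; simp)+
      ultimately have "3 * e \<le> 2 * e" by linarith
      then show False using e by simp
    qed
    ultimately show "\<exists>S. openin L1loc_topology S \<and> uo \<in> S \<and> S \<subseteq> UNIV - I_CL f T w" by blast
  qed
qed

text \<open>Finite speed separates the two ends: far to the left the evolution sees only the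
  unchanged primitive, far to the right only the primitive raised by 1. Two data with the same final
  profile, however, have equal increments of \<open>HL\<close> between any two points.\<close>

theorem interior_I_CL:
  assumes T: "0 < T" shows "L1loc_topology interior_of (I_CL f T w) = {}"
proof (rule ccontr)
  assume "L1loc_topology interior_of (I_CL f T w) \<noteq> {}"
  then obtain S uo where S: "openin L1loc_topology S" "uo \<in> S" "S \<subseteq> I_CL f T w"
    by (auto simp: interior_of_def)
  obtain R where R: "0 < R" "\<And>v. (AE x in lborel. \<bar>x\<bar> \<le> R \<longrightarrow> rep_linf v x = rep_linf uo x) \<Longrightarrow> v \<in> S"
    using openin_L1loc_far[OF S(1,2)] by blast
  obtain M where M0: "ess_bounded M (rep_linf uo)" by (rule rep_linf_ess_bounded)
  let ?i = "indicat_real {R<..R + 1}"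
  define z where "z x = rep_linf uo x + ?i x" for x
  have M: "ess_bounded (M + 1) (rep_linf uo)" by (rule ess_bounded_mono[OF M0]) simp
  have z: "ess_bounded (M + 1) z"
    using M0 by (auto simp: ess_bounded_def z_def[abs_def] indicator_def elim!: eventually_mono)
  define v where "v = abs_linf z"
  have v: "AE x in lborel. rep_linf v x = z x" unfolding v_def by (rule rep_abs_linf[OF z])
  have "v \<in> S"
    by (rule R(2)) (use v in \<open>eventually_elim, auto simp: z_def indicator_def\<close>)
  then have vI: "v \<in> I_CL f T w" and uI: "uo \<in> I_CL f T w" using S by auto
  let ?U = "prim (rep_linf uo)" and ?V = "prim (rep_linf v)"
  have li: "loc_int ?i"
    by (rule ess_bounded_loc_int[of 1]) (auto simp: ess_bounded_def indicator_def)
  have "?V y = prim z y" for y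
    by (rule prim_cong_AE[OF v]) (use z in \<open>auto simp: ess_bounded_def\<close>)
  also have "prim z y = ?U y + prim ?i y" for y
    unfolding z_def[abs_def] by (rule prim_add[OF ess_bounded_loc_int[OF M] li])
  finally have VU: "?V y = ?U y + prim ?i y" for y .
  have lo: "?V y = ?U y" if "y \<le> R" for y using prim_indicator(1)[of R y] R(1) that by (simp add: VU)
  have hi: "?V y = ?U y + 1" if "R + 1 \<le> y" for y using prim_indicator(2)[of R y] R(1) that by (simp add: VU)
  note U = prim_lipschitz[OF M]
  have V: "(M + 1)-lipschitz_on UNIV ?V"
  proof (rule prim_lipschitz)
    show "ess_bounded (M + 1) (rep_linf v)"
      using z v by (auto simp: ess_bounded_def elim: eventually_elim2)
  qed
  \<comment> \<open>A common radius of dependence at time \<open>T\<close>, available because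
    \<open>M + 1\<close> bounds both data. Within this radius a constant difference of the
    primitives is inherited by \<open>HL\<close>.\<close>
  define B where "B = T * max \<bar>deriv f (M + 1)\<bar> \<bar>deriv f (- (M + 1))\<bar>"
  have "HL ?V T x = HL ?U T x + k" if "\<And>y. \<bar>x - y\<bar> \<le> B \<Longrightarrow> ?V y = ?U y + k" for x k
  proof (rule antisym)
    have "?V (ymax ?U T x) = ?U (ymax ?U T x) + k"
      by (rule that) (use arg_dist[OF U T is_arg_ymax[OF U T], of x] in \<open>simp add: B_def\<close>)
    then show "HL ?V T x \<le> HL ?U T x + k"
      using HL_le[OF V T, of x "ymax ?U T x"] by (simp add: HL_def cost_def)
    have "?V (ymax ?V T x) = ?U (ymax ?V T x) + k"
      by (rule that) (use arg_dist[OF V T is_arg_ymax[OF V T], of x] in \<open>simp add: B_def\<close>)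
    then show "HL ?U T x + k \<le> HL ?V T x"
      using HL_le[OF U T, of x "ymax ?V T x"] by (simp add: HL_def cost_def)
  qed
  note HL_shift = this
  \<comment> \<open>Points within \<open>B\<close> of \<open>- B\<close> are at most 0 and thus left
    of the added mass; points within \<open>B\<close> of \<open>R + 1 + B\<close> are at least
    \<open>R + 1\<close> and thus right of it.\<close>
  have "HL ?V T (- B) = HL ?U T (- B) + 0"
    by (rule HL_shift) (use lo R(1) in \<open>auto simp: abs_le_iff\<close>)
  moreover have "HL ?V T (R + 1 + B) = HL ?U T (R + 1 + B) + 1"
    by (rule HL_shift) (use hi in \<open>auto simp: abs_le_iff\<close>)
  moreover have "HL ?V T x - HL ?V T 0 = HL ?U T x - HL ?U T 0" for x
    using vI uI by (simp add: I_CL_iff_prim[OF T])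
  from this[of "- B"] this[of "R + 1 + B"]
  have "HL ?V T (R + 1 + B) - HL ?V T (- B) = HL ?U T (R + 1 + B) - HL ?U T (- B)" by linarith
  ultimately show False by linarith
qed

end

theorem proposition5p1:
  fixes f :: "real \<Rightarrow> real" and c T :: real and w :: linf
  assumes "C2 f"
    and "0 < c" and "\<And>x. c \<le> deriv (deriv f) x"
    and "f 0 = 0" and "\<And>x. f 0 \<le> f x"
    and "0 < T"
    and "I_CL f T w \<noteq> {}"
    and "w \<in> SBV_loc"
  shows "closedin L1loc_topology (I_CL f T w)
    \<and> L1loc_topology interior_of (I_CL f T w) = {}"
proof -
  interpret convex_flux f c by unfold_locales (fact assms)+
  show ?thesis using closedin_I_CL[OF \<open>0 < T\<close>] interior_I_CL[OF \<open>0 < T\<close>] by blast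
qed

end
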